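(* Let $\mathcal{X}$ be a $\Lambda$-valued Pfaffian point field with a finite-rank kernel $K$ (with respect to a background measure $\mu$ on $\Lambda$). Let $\mathcal{N}$ denote the number of points of $\mathcal{X}$ in $\Lambda$. Then the characteristic function of the random variable $\mathcal{N}$ satisfies $$\varphi_{\mathcal{N}}(t)\equiv\mathbb{E}\left(e^{i\mathcal{N}t}\right)=\prod_{k=1}^{r}\left(1+(e^{it}-1)\lambda_k\right)=\mathrm{Det}_M\left(I+(e^{it}-1)K\right),$$ where $\lambda_k$ are the eigenvalues of the kernel $K$ and $r$ is its rank.
   Context: Quaternions. "Quaternions" are complexified quaternions $q=s+x\mathbf{i}+y\mathbf{j}+z\mathbf{k}\in\mathbb{Q}_{\mathbb{C}}$ with $s,x,y,z\in\mathbb{C}$ (usual quaternion multiplication rules, complex scalars central). The conjugate is $q^{*}=s-x\mathbf{i}-y\mathbf{j}-z\mathbf{k}$ (the coefficients are not complex-conjugated). The dual $X^*$ of a quaternion matrix is given by $(X^* )_{lk}=(X_{kl})^*$; $X$ is self-dual if $X^*=X$. A quaternion kernel $K:\Lambda\times\Lambda\to\mathbb{Q}_{\mathbb{C}}$ is self-dual if $K(y,x)=K(x,y)^*$. Moore-Dyson determinant. For an $n\times n$ quaternion matrix $X$, write each permutation $\sigma\in S_n$ as a product of cycles $\sigma=(n_1i_2\ldots i_s)(n_2j_2\ldots j_t)\ldots(n_rk_2\ldots k_l)$ where $n_i$ is the largest element of its cycle and $n_1>n_2>\ldots>n_r$. Then $\mathrm{Det}_M(X)=\sum_{\sigma}(-1)^{n-r}\left(X_{n_1i_2}X_{i_2i_3}\ldots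 X_{i_sn_1}\right)\ldots\left(X_{n_rk_2}X_{k_2k_3}\ldots X_{k_ln_r}\right)$. It is scalar for self-dual $X$. Fredholm version. For a self-dual kernel $K$ (and likewise for a scalar multiple of it), $\mathrm{Det}_M(I+K):=1+\sum_{n=1}^\infty\frac1{n!}\int_{\Lambda^n}\mathrm{Det}_M(K(x_i,x_j))_{1\le i,j\le n}\,d\mu(x_1)\cdots d\mu(x_n)$. Random point fields. A random point field on $\Lambda$ is a probability measure on the space of countable configurations of points of $\Lambda$ (with finitely many points in every compact subset). $\#(A)$ is the number of points in $A$. A locally integrable $R_k:\Lambda^k\to\mathbb{R}_+$ is the $k$-point correlation function with respect to $\mu$ if for all disjoint measurable $A_1,\ldots,A_m\subset\Lambda$ and non-negative integers $k_i$ with $\sum k_i=k$: $\mathbb{E}\prod_{i=1}^m[\#(A_i)\cdots(\#(A_i)-k_i+1)]=\int_{A_1^{k_1}\times\cdots\times A_m^{k_m}}R_k\,d\mu(x_1)\cdots d\mu(x_k)$. The field is Pfaffian with kernel $K$ if $K$ is a self-dual quaternion kernel and $R_m(x_1,\ldots,x_m)=\mathrm{Det}_M(K(x_i,x_j))_{1\le i,j\le m}$ for all $m\ge1$. Rank and eigenvalues. Let $\varphi:\mathbb{Q}_{\mathbb{C}}\to M_2(\mathbb{C})$ be the algebra isomorphism with $\mathbf{i}\mapsto\begin{pmatrix}0&i\\i&0\end{pmatrix}$, $\mathbf{j}\mapsto\begin{pmatrix}0&-1\\1&0\end{pmatrix}$, $\mathbf{k}\mapsto\begin{pmatrix}i&0\\0&-i\end{pmatrix}$.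 A scalar $\lambda$ is an eigenvalue of a quaternion matrix or operator $X$ if $Xv=v\lambda$ for some non-zero quaternion vector (function) $v$. Eigenvalues are counted with multiplicity, on the following convention: for self-dual $K$ of finite rank, the integral operator on $L^2(\Lambda,\mu;\mathbb{C}^2)$ with kernel $\varphi(K(x,y))$ has even rank $2r$, where $r$ is the rank of $K$, and its non-zero eigenvalues have even algebraic multiplicity; $\lambda_1,\ldots,\lambda_r$ lists each non-zero eigenvalue with half of its algebraic multiplicity, completed by zeros if needed. *)

theory Defs
  imports "HOL-Probability.Probability" "HOL-Combinatorics.Cycles"
begin

section \<open>Complexified quaternions\<close>

datatype cquat = CQuat (qs: complex) (qx: complex) (qy: complex) (qz: complex)

lemma cquat_eq_iff: "p = q \<longleftrightarrow> qs p = qs q \<and> qx p = qx q \<and> qy p = qy q \<and> qz p = qz q"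
  by (cases p; cases q) simp

instantiation cquat :: ring_1
begin

definition "0 = CQuat 0 0 0 0"
definition "1 = CQuat 1 0 0 0"
definition "p + q = CQuat (qs p + qs q) (qx p + qx q) (qy p + qy q) (qz p + qz q)"
definition "p - q = CQuat (qs p - qs q) (qx p - qx q) (qy p - qy q) (qz p - qz q)"
definition "- q = CQuat (- qs q) (- qx q) (- qy q) (- qz q)"
definition "p * q = CQuat
  (qs p * qs q - qx p * qx q - qy p * qy q - qz p * qz q)
  (qs p * qx q + qx p * qs q + qy p * qz q - qz p * qy q)
  (qs p * qy q - qx p * qz q + qy p * qs q + qz p * qx q)
  (qs p * qz q + qx p * qy q - qy p * qx q + qz p * qs q)"

instance
  by standard
    (simp_all add: zero_cquat_def one_cquat_def plus_cquat_def minus_cquat_def uminus_cquat_def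
      times_cquat_def algebra_simps)

end

definition cquat_of_complex :: "complex \<Rightarrow> cquat" where
  "cquat_of_complex c = CQuat c 0 0 0"

text \<open>The coefficients are not complex-conjugated.\<close>
definition qconj :: "cquat \<Rightarrow> cquat" where
  "qconj q = CQuat (qs q) (- qx q) (- qy q) (- qz q)"

text \<open>The algebra isomorphism \<open>\<phi>\<close> onto the complex 2x2 matrices.\<close>
definition qmat :: "cquat \<Rightarrow> complex^2^2" where
  "qmat q = vector
     [vector [qs q + \<i> * qz q, \<i> * qx q - qy q],
      vector [\<i> * qx q + qy q, qs q - \<i> * qz q]]"

lemma qmat_units:
  "qmat (CQuat 0 1 0 0) = vector [vector [0, \<i>], vector [\<i>, 0]]"
  "qmat (CQuat 0 0 1 0) = vector [vector [0, -1], vector [1, 0]]"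
  "qmat (CQuat 0 0 0 1) = vector [vector [\<i>, 0], vector [0, - \<i>]]"
  by (simp_all add: qmat_def)

lemma qmat_mult: "qmat (p * q) = qmat p ** qmat q"
  by (simp add: qmat_def times_cquat_def vec_eq_iff forall_2 matrix_matrix_mult_def sum_2
      algebra_simps)


section \<open>Moore-Dyson determinants\<close>

text \<open>Matrices of size \<open>n\<close> are indexed by \<open>{..<n}\<close>. The list \<open>support \<sigma> m\<close> is
  \<open>[m, \<sigma> m, \<sigma> (\<sigma> m), \<dots>]\<close>, the cycle of \<open>\<sigma>\<close> written so that it starts at \<open>m\<close>; hence
  \<open>cycle_product X \<sigma> m\<close> is \<open>X m i\<^sub>2 * X i\<^sub>2 i\<^sub>3 * \<dots> * X i\<^sub>s m\<close>.\<close>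

definition cycle_product :: "(nat \<Rightarrow> nat \<Rightarrow> cquat) \<Rightarrow> (nat \<Rightarrow> nat) \<Rightarrow> nat \<Rightarrow> cquat" where
  "cycle_product X \<sigma> m = prod_list (map (\<lambda>i. X i (\<sigma> i)) (support \<sigma> m))"

text \<open>The largest elements of the cycles; fixed points count as cycles of length one.\<close>
definition cycle_maxima :: "nat \<Rightarrow> (nat \<Rightarrow> nat) \<Rightarrow> nat set" where
  "cycle_maxima n \<sigma> = {m. m < n \<and> (\<forall>j\<in>set (support \<sigma> m). j \<le> m)}"

definition DetM :: "nat \<Rightarrow> (nat \<Rightarrow> nat \<Rightarrow> cquat) \<Rightarrow> cquat" where
  "DetM n X = (\<Sum>\<sigma> | \<sigma> permutes {..<n}.
     (-1) ^ (n - card (cycle_maxima n \<sigma>)) *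
     prod_list (map (cycle_product X \<sigma>) (rev (sorted_list_of_set (cycle_maxima n \<sigma>)))))"

definition self_dual_kernel :: "'a set \<Rightarrow> ('a \<Rightarrow> 'a \<Rightarrow> cquat) \<Rightarrow> bool" where
  "self_dual_kernel \<Lambda> K \<longleftrightarrow> (\<forall>x\<in>\<Lambda>. \<forall>y\<in>\<Lambda>. K y x = qconj (K x y))"

text \<open>The determinant of (a scalar multiple of) a self-dual matrix is scalar, so that its
  scalar part \<open>qs\<close> is all of it and the Fredholm determinant is a complex number.\<close>

definition fredholm_integrand :: "('a \<Rightarrow> 'a \<Rightarrow> cquat) \<Rightarrow> nat \<Rightarrow> (nat \<Rightarrow> 'a) \<Rightarrow> complex" where
  "fredholm_integrand K n x = qs (DetM n (\<lambda>i j. K (x i) (x j)))"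

definition fredholm_term :: "'a measure \<Rightarrow> ('a \<Rightarrow> 'a \<Rightarrow> cquat) \<Rightarrow> nat \<Rightarrow> complex" where
  "fredholm_term \<mu> K n =
     (LINT x|Pi\<^sub>M {..<n} (\<lambda>_. \<mu>). fredholm_integrand K n x) / fact n"

definition fredholm_DetM :: "'a measure \<Rightarrow> ('a \<Rightarrow> 'a \<Rightarrow> cquat) \<Rightarrow> complex" where
  "fredholm_DetM \<mu> K = 1 + (\<Sum>n. fredholm_term \<mu> K (Suc n))"

definition fredholm_DetM_exists :: "'a measure \<Rightarrow> ('a \<Rightarrow> 'a \<Rightarrow> cquat) \<Rightarrow> bool" where
  "fredholm_DetM_exists \<mu> K \<longleftrightarrow>
     (\<forall>n\<ge>1. integrable (Pi\<^sub>M {..<n} (\<lambda>_. \<mu>)) (fredholm_integrand K n)) \<and>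
     summable (\<lambda>n. fredholm_term \<mu> K (Suc n))"


section \<open>Pfaffian random point fields\<close>

text \<open>\<open>\<Lambda>\<close> is a topological space, carried by a subset of a type and equipped with the
  subspace topology.\<close>

definition configurations :: "'a::topological_space set \<Rightarrow> 'a set set" where
  "configurations \<Lambda> =
     {\<xi>. \<xi> \<subseteq> \<Lambda> \<and> countable \<xi> \<and> (\<forall>C. compact C \<and> C \<subseteq> \<Lambda> \<longrightarrow> finite (\<xi> \<inter> C))}"

text \<open>The number \<open>#(A)\<close> of points in \<open>A\<close>, infinite if there are infinitely many.\<close>
definition npoints :: "'a set \<Rightarrow> 'a set \<Rightarrow> ennreal" where
  "npoints A \<xi> = emeasure (count_space UNIV) (\<xi> \<inter> A)"

definition configuration_space :: "'a::topological_space set \<Rightarrow> 'a set measure" where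
  "configuration_space \<Lambda> = sigma (configurations \<Lambda>)
     {{\<xi> \<in> configurations \<Lambda>. npoints A \<xi> = of_nat n} | A n. A \<in> sets (restrict_space borel \<Lambda>)}"

definition random_point_field :: "'a::topological_space set \<Rightarrow> 'a set measure \<Rightarrow> bool" where
  "random_point_field \<Lambda> P \<longleftrightarrow> prob_space P \<and> sets P = sets (configuration_space \<Lambda>)"

text \<open>\<open>c (c - 1) \<dots> (c - k + 1)\<close>; subtraction on \<^typ>\<open>ennreal\<close> is truncated, which is harmless
  since a factor is zero as soon as the count \<open>c\<close> is a natural number below \<open>k\<close>.\<close>
definition ennreal_ffact :: "nat \<Rightarrow> ennreal \<Rightarrow> ennreal" where
  "ennreal_ffact k c = (\<Prod>j<k. c - of_nat j)"

text \<open>\<open>A 0 ^ k 0 \<times> \<dots> \<times> A (m-1) ^ k (m-1)\<close>, as a set of tuples indexed by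
  \<open>{..< k 0 + \<dots> + k (m-1)}\<close>.\<close>
definition block_product :: "nat \<Rightarrow> (nat \<Rightarrow> 'a set) \<Rightarrow> (nat \<Rightarrow> nat) \<Rightarrow> (nat \<Rightarrow> 'a) set" where
  "block_product m A k = {x \<in> extensional {..<\<Sum>i<m. k i}.
     \<forall>i<m. \<forall>l<k i. x ((\<Sum>i'<i. k i') + l) \<in> A i}"

text \<open>Every compact subset of \<open>\<Lambda>\<^sup>k\<close> lies in a cube \<open>C\<^sup>k\<close> with \<open>C\<close> compact, so local
  integrability is tested on these cubes.\<close>
definition correlation_function ::
  "'a::topological_space set \<Rightarrow> 'a measure \<Rightarrow> 'a set measure \<Rightarrow> nat \<Rightarrow> ((nat \<Rightarrow> 'a) \<Rightarrow> real) \<Rightarrow> bool"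
where
  "correlation_function \<Lambda> \<mu> P k R \<longleftrightarrow>
     R \<in> borel_measurable (Pi\<^sub>M {..<k} (\<lambda>_. \<mu>)) \<and>
     (\<forall>x\<in>Pi\<^sub>E {..<k} (\<lambda>_. \<Lambda>). 0 \<le> R x) \<and>
     (\<forall>C. compact C \<and> C \<subseteq> \<Lambda> \<longrightarrow>
        (\<integral>\<^sup>+x. ennreal (R x) * indicator (Pi\<^sub>E {..<k} (\<lambda>_. C)) x \<partial>Pi\<^sub>M {..<k} (\<lambda>_. \<mu>)) < \<infinity>) \<and>
     (\<forall>m A \<kappa>. (\<forall>i<m. A i \<in> sets \<mu>) \<and> disjoint_family_on A {..<m} \<and> (\<Sum>i<m. \<kappa> i) = k \<longrightarrow>
        (\<integral>\<^sup>+\<xi>. (\<Prod>i<m. ennreal_ffact (\<kappa> i) (npoints (A i) \<xi>)) \<partial>P) =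
        (\<integral>\<^sup>+x. ennreal (R x) * indicator (block_product m A \<kappa>) x \<partial>Pi\<^sub>M {..<k} (\<lambda>_. \<mu>)))"

definition pfaffian_point_field ::
  "'a::topological_space set \<Rightarrow> 'a measure \<Rightarrow> 'a set measure \<Rightarrow> ('a \<Rightarrow> 'a \<Rightarrow> cquat) \<Rightarrow> bool"
where
  "pfaffian_point_field \<Lambda> \<mu> P K \<longleftrightarrow>
     random_point_field \<Lambda> P \<and> self_dual_kernel \<Lambda> K \<and>
     (\<forall>m\<ge>1. \<exists>R. correlation_function \<Lambda> \<mu> P m R \<and>
        (\<forall>x\<in>Pi\<^sub>E {..<m} (\<lambda>_. \<Lambda>).
           cquat_of_complex (of_real (R x)) = DetM m (\<lambda>i j. K (x i) (x j))))"


section \<open>Finite-rank kernels, their rank and eigenvalues\<close>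

definition square_integrable_quat :: "'a measure \<Rightarrow> ('a \<Rightarrow> cquat) \<Rightarrow> bool" where
  "square_integrable_quat \<mu> u \<longleftrightarrow> (\<forall>c\<in>{qs, qx, qy, qz}.
     (\<lambda>x. c (u x)) \<in> borel_measurable \<mu> \<and> integrable \<mu> (\<lambda>x. (cmod (c (u x)))\<^sup>2))"

text \<open>The representation has to hold at every point and not just almost everywhere:
  the correlation functions use the values of the kernel on the diagonal,
  which the integral operator alone need not see.\<close>
definition finite_rank_kernel :: "'a measure \<Rightarrow> ('a \<Rightarrow> 'a \<Rightarrow> cquat) \<Rightarrow> bool" where
  "finite_rank_kernel \<mu> K \<longleftrightarrow> (\<exists>(n::nat) u v.
     (\<forall>k<n. square_integrable_quat \<mu> (u k) \<and> square_integrable_quat \<mu> (v k)) \<and>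
     (\<forall>x\<in>space \<mu>. \<forall>y\<in>space \<mu>. K x y = (\<Sum>k<n. u k x * v k y)))"

text \<open>Elements of \<open>L\<^sup>2(\<Lambda>, \<mu>; \<complex>\<^sup>2)\<close> are represented by functions;
  identification modulo null functions is taken care of in \<open>ae_dim\<close>.\<close>

definition L2_fun :: "'a measure \<Rightarrow> ('a \<Rightarrow> complex^2) set" where
  "L2_fun \<mu> = {f \<in> borel_measurable \<mu>. integrable \<mu> (\<lambda>x. (norm (f x))\<^sup>2)}"

definition kernel_operator ::
  "'a measure \<Rightarrow> ('a \<Rightarrow> 'a \<Rightarrow> cquat) \<Rightarrow> ('a \<Rightarrow> complex^2) \<Rightarrow> 'a \<Rightarrow> complex^2" where
  "kernel_operator \<mu> K f x = (LINT y|\<mu>. qmat (K x y) *v f y)"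

definition ae_independent :: "'a measure \<Rightarrow> ('a \<Rightarrow> complex^2) set \<Rightarrow> bool" where
  "ae_independent \<mu> S \<longleftrightarrow> finite S \<and>
     (\<forall>c. (AE x in \<mu>. (\<Sum>f\<in>S. c f *s f x) = 0) \<longrightarrow> (\<forall>f\<in>S. c f = 0))"

text \<open>Complex dimension of a linear space \<open>V\<close> of functions modulo almost everywhere equality.\<close>
definition ae_dim :: "'a measure \<Rightarrow> ('a \<Rightarrow> complex^2) set \<Rightarrow> enat" where
  "ae_dim \<mu> V = (SUP S\<in>{S. S \<subseteq> V \<and> ae_independent \<mu> S}. enat (card S))"

text \<open>The integral operator of a self-dual kernel of finite rank \<open>r\<close> has (even) rank \<open>2r\<close>.\<close>
definition kernel_rank :: "'a measure \<Rightarrow> ('a \<Rightarrow> 'a \<Rightarrow> cquat) \<Rightarrow> nat" where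
  "kernel_rank \<mu> K = the_enat (ae_dim \<mu> (kernel_operator \<mu> K ` L2_fun \<mu>)) div 2"

definition generalized_eigenspace ::
  "'a measure \<Rightarrow> ('a \<Rightarrow> 'a \<Rightarrow> cquat) \<Rightarrow> complex \<Rightarrow> ('a \<Rightarrow> complex^2) set" where
  "generalized_eigenspace \<mu> K z = {f \<in> L2_fun \<mu>. \<exists>n. AE x in \<mu>.
     (((\<lambda>g x. kernel_operator \<mu> K g x - z *s g x) ^^ n) f) x = 0}"

definition algebraic_multiplicity :: "'a measure \<Rightarrow> ('a \<Rightarrow> 'a \<Rightarrow> cquat) \<Rightarrow> complex \<Rightarrow> enat" where
  "algebraic_multiplicity \<mu> K z = ae_dim \<mu> (generalized_eigenspace \<mu> K z)"

text \<open>\<open>eig 1, \<dots>, eig r\<close> lists each non-zero eigenvalue with half of its algebraic multiplicity;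
  the remaining entries are then zero. This determines the list up to its order.\<close>
definition eigenvalue_listing ::
  "'a measure \<Rightarrow> ('a \<Rightarrow> 'a \<Rightarrow> cquat) \<Rightarrow> (nat \<Rightarrow> complex) \<Rightarrow> bool" where
  "eigenvalue_listing \<mu> K eig \<longleftrightarrow> (\<forall>z. z \<noteq> 0 \<longrightarrow>
     algebraic_multiplicity \<mu> K z = enat (2 * card {k \<in> {1..kernel_rank \<mu> K}. eig k = z}))"

end

theory Submission
  imports Defs "Jordan_Normal_Form.Jordan_Normal_Form_Existence"
begin

text \<open>Write \<open>K(x,y) = \<Sum>\<^sub>k u\<^sub>k(x) v\<^sub>k(y)\<close> and let \<open>M\<close> be the Gram matrix of the integrals of
  \<open>v\<^sub>k u\<^sub>l\<close>. Integrating a Moore-Dyson determinant over \<open>\<Lambda>\<^sup>n\<close> factorizes along the cycles of each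
  permutation. By self-duality the integral of a cycle equals its own conjugate, hence is the
  scalar \<open>\<tau>\<^sub>s = 1/2 tr \<phi>(M)\<^sup>s\<close>, where \<open>s\<close> is the length of the cycle. So the coefficients
  \<open>e\<^sub>n = 1/n! \<integral> Det\<^sub>M K\<close> satisfy Newton's identities for half the power sums of the
  eigenvalues \<open>\<alpha>\<^sub>j\<close> of \<open>\<phi>(M)\<close>, that is, \<open>(\<Sum>\<^sub>n e\<^sub>n X\<^sup>n)\<^sup>2 = \<Prod>\<^sub>j (1 + \<alpha>\<^sub>j X)\<close>. As \<open>n! e\<^sub>n\<close> is
  a factorial moment, \<open>e\<^sub>n \<ge> 0\<close>; a power series with nonnegative coefficients whose square is a
  polynomial is itself a polynomial. Hence the non-zero \<open>\<alpha>\<^sub>j\<close> have even multiplicity, the number of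
  points is almost surely bounded, and \<open>E (1+z)\<^sup>N = \<Sum>\<^sub>n e\<^sub>n z\<^sup>n = \<Prod>\<^sub>k (1 + \<lambda>\<^sub>k z)\<close>. The operator
  with kernel \<open>\<phi>(K)\<close> has the same non-zero eigenvalues and algebraic multiplicities as \<open>\<phi>(M)\<close>,
  which is read off a Jordan basis of \<open>\<phi>(M)\<close>.\<close>


section \<open>Cycles of permutations\<close>

text \<open>The functions \<open>u\<close>, \<open>v\<close> of the expansion are arbitrary, so the
  Gram matrix need not be self-dual and its even multiplicities are not read off from a symmetry.
  Self-duality acts through the reversal of closed paths, and it has to act early: quaternions do
  not commute, and the ordered product in the Moore-Dyson determinant can be regrouped by cycle
  lengths once every cycle has been integrated to a scalar. The second obstacle is the factor 1/2.
  Half power sums determine a formal square root of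
  \<open>\<Prod>\<^sub>j (1 + \<alpha>\<^sub>j X)\<close>, in general an infinite series; positivity
  of the factorial moments makes it finite, and no exchange of limits remains. A Jordan basis is
  used because multiplicities are algebraic. The rank enters as a bound: the halved list of non-zero
  eigenvalues has at most \<open>r\<close> members, and the zeros that pad it contribute factors
  1.\<close>

definition cyc :: "('a \<Rightarrow> 'a) \<Rightarrow> 'a \<Rightarrow> 'a set" where
  "cyc p x = range (\<lambda>i. (p ^^ i) x)"

lemma cyc_self [simp]: "x \<in> cyc p x"
  unfolding cyc_def by (rule range_eqI[of _ _ 0]) simp

lemma cyc_nonempty [simp]: "cyc p x \<noteq> {}"
  by (simp add: cyc_def)

lemma cyc_step: "y \<in> cyc p x \<Longrightarrow> p y \<in> cyc p x"
proof -
  assume "y \<in> cyc p x"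
  then obtain i where "y = (p ^^ i) x" by (auto simp: cyc_def)
  then have "p y = (p ^^ Suc i) x" by simp
  then show ?thesis unfolding cyc_def by blast
qed

lemma cyc_least:
  assumes "x \<in> S" and "\<And>y. y \<in> S \<Longrightarrow> p y \<in> S"
  shows "cyc p x \<subseteq> S"
proof -
  have "(p ^^ i) x \<in> S" for i by (induction i) (use assms in auto)
  then show ?thesis by (auto simp: cyc_def)
qed

lemma cyc_subset: "p permutes S \<Longrightarrow> x \<in> S \<Longrightarrow> cyc p x \<subseteq> S"
  by (rule cyc_least) (auto simp: permutes_in_image)

lemma set_support: "permutation p \<Longrightarrow> set (support p x) = cyc p x"
  unfolding cyc_def by (rule support_set)

lemma cyc_eq:
  assumes "permutation p" and "y \<in> cyc p x"
  shows "cyc p y = cyc p x"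
proof -
  have "disjoint (range (cyc p))"
    using disjoint_support[OF assms(1)] set_support[OF assms(1)] by simp
  then show ?thesis
    using assms(2) cyc_self[of y p] unfolding disjoint_def by blast
qed

lemma cyc_cong:
  assumes "\<And>y. y \<in> cyc p x \<Longrightarrow> q y = p y"
  shows "cyc q x = cyc p x"
proof -
  have "(q ^^ i) x = (p ^^ i) x" for i
  proof (induction i)
    case (Suc i)
    have "(p ^^ i) x \<in> cyc p x" by (auto simp: cyc_def)
    then show ?case using Suc assms by simp
  qed simp
  then show ?thesis by (simp add: cyc_def)
qed

lemma permutation_if_permutes: "finite S \<Longrightarrow> p permutes S \<Longrightarrow> permutation p"
  unfolding permutation_permutes by blast

text \<open>Since \<open>q\<close> fixes \<open>a\<close>, composing with the transposition splices
  \<open>a\<close> into the cycle of \<open>b\<close> immediately before \<open>b\<close>: the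
  predecessor of \<open>b\<close> is sent to \<open>a\<close>, and \<open>a\<close> to
  \<open>b\<close>. Cycles that avoid \<open>b\<close> are left alone.\<close>

lemma cyc_transpose_insert:
  assumes "finite A" and "q permutes A" and "a \<notin> A" and "b \<in> A"
  defines "p \<equiv> Transposition.transpose a b \<circ> q"
  shows "cyc p a = insert a (cyc q b)"
    and "x \<in> A \<Longrightarrow> x \<notin> cyc q b \<Longrightarrow> cyc p x = cyc q x"
proof -
  have perm: "permutation q" by (rule permutation_if_permutes[OF assms(1,2)])
  have qa: "q a = a" by (rule permutes_not_in[OF assms(2,3)])
  have pa: "p a = b" using qa by (simp add: p_def)
  have py: "p y = (if q y = b then a else q y)" if "y \<in> A" for y
  proof -
    have "q y \<noteq> a" using that assms(2,3) by (metis permutes_in_image)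
    then show ?thesis by (simp add: p_def Transposition.transpose_def)
  qed
  have sub: "cyc q b \<subseteq> A" by (rule cyc_subset[OF assms(2,4)])
  show "cyc p a = insert a (cyc q b)"
  proof
    show "cyc p a \<subseteq> insert a (cyc q b)"
    proof (rule cyc_least)
      fix y assume y: "y \<in> insert a (cyc q b)"
      show "p y \<in> insert a (cyc q b)"
      proof (cases "y = a")
        case False
        then have "y \<in> cyc q b" using y by simp
        then have "y \<in> A" and "q y \<in> cyc q b" using sub cyc_step by auto
        then show ?thesis using py by simp
      qed (simp add: pa)
    qed simp
    \<comment> \<open>Intersecting with \<open>A\<close> keeps \<open>y\<close> away from
      \<open>a\<close>, so that \<open>p\<close> is described by \<open>q\<close>: either
      \<open>p y = q y\<close>, or \<open>q y = b\<close>, which is the image of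
      \<open>a\<close>.\<close>
    have "cyc q b \<subseteq> cyc p a \<inter> A"
    proof (rule cyc_least)
      show "b \<in> cyc p a \<inter> A" using pa cyc_step[of a p a] assms by simp
      fix y assume y: "y \<in> cyc p a \<inter> A"
      have "q y \<in> A" using y assms(2) by (simp add: permutes_in_image)
      moreover have "q y \<in> cyc p a"
      proof (cases "q y = b")
        case True then show ?thesis using pa cyc_step[of a p a] by simp
      next
        case False
        then have "p y = q y" using y py[of y] by simp
        then show ?thesis using y cyc_step[of y p a] by simp
      qed
      ultimately show "q y \<in> cyc p a \<inter> A" by simp
    qed
    then show "insert a (cyc q b) \<subseteq> cyc p a" by simp
  qed
  show "cyc p x = cyc q x" if x: "x \<in> A" "x \<notin> cyc q b"
  proof (rule cyc_cong)
    fix y assume y: "y \<in> cyc q x"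
    have "y \<in> A" using y x cyc_subset[OF assms(2)] by blast
    moreover have "q y \<noteq> b"
      using cyc_step[OF y] cyc_eq[OF perm, of b x] x(2) cyc_self[of x q] by metis
    ultimately show "p y = q y" using py by simp
  qed
qed

section \<open>Sums of multiplicative cycle weights over all permutations\<close>

definition cycle_weight :: "(nat \<Rightarrow> 'c::comm_ring_1) \<Rightarrow> 'a set \<Rightarrow> ('a \<Rightarrow> 'a) \<Rightarrow> 'c" where
  "cycle_weight f A p = (\<Prod>c\<in>cyc p ` A. f (card c))"

text \<open>The recursion contracts the marked point \<open>a\<close> out of its cycle and marks the point that
  followed it; \<open>k\<close> counts the points contracted so far.\<close>

definition marked_weight ::
  "(nat \<Rightarrow> 'c::comm_ring_1) \<Rightarrow> 'a set \<Rightarrow> 'a \<Rightarrow> nat \<Rightarrow> ('a \<Rightarrow> 'a) \<Rightarrow> 'c" where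
  "marked_weight f A a k p =
     f (k + card (cyc p a)) * (\<Prod>c\<in>cyc p ` insert a A - {cyc p a}. f (card c))"

lemma marked_weight_zero:
  "finite A \<Longrightarrow> marked_weight f A a 0 p = cycle_weight f (insert a A) p"
  unfolding marked_weight_def cycle_weight_def add_0
  by (rule prod.remove[symmetric]) auto

lemma marked_weight_fixed:
  assumes "finite A" and "q permutes A" and "a \<notin> A"
  shows "marked_weight f A a k q = f (Suc k) * cycle_weight f A q"
proof -
  have "q a = a" by (rule permutes_not_in[OF assms(2,3)])
  then have c: "cyc q a = {a}"
    using cyc_least[of a "{a}" q] cyc_self[of a q] by auto
  have "{a} \<notin> cyc q ` A" using cyc_subset[OF assms(2)] assms(3) by auto
  then have "cyc q ` insert a A - {cyc q a} = cyc q ` A" using c by auto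
  then show ?thesis using c by (simp add: marked_weight_def cycle_weight_def)
qed

text \<open>Contracting \<open>a\<close> shortens its cycle by one point while \<open>k\<close>
  grows by one, so the argument of \<open>f\<close> is unchanged; the other cycles stay the same by
  \<open>cyc_transpose_insert\<close>.\<close>

lemma marked_weight_insert:
  assumes "finite A" and "q permutes A" and "a \<notin> A" and "b \<in> A"
  shows "marked_weight f A a k (Transposition.transpose a b \<circ> q) = marked_weight f (A - {b}) b (Suc k) q"
proof -
  define p where "p = Transposition.transpose a b \<circ> q"
  have perm: "permutation q" by (rule permutation_if_permutes[OF assms(1,2)])
  note ins = cyc_transpose_insert[OF assms, folded p_def]
  have sub: "cyc q x \<subseteq> A" if "x \<in> A" for x by (rule cyc_subset[OF assms(2) that])
  have fin: "finite (cyc q b)" by (rule finite_subset[OF sub[OF assms(4)] assms(1)])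
  have card: "card (cyc p a) = Suc (card (cyc q b))"
  proof -
    have "a \<notin> cyc q b" using sub[OF assms(4)] assms(3) by blast
    then show ?thesis unfolding ins(1) using fin by (rule card_insert_disjoint[rotated])
  qed
  have permp: "permutation p"
    unfolding p_def by (intro permutation_compose permutation_swap_id perm)
  have ia: "insert b (A - {b}) = A" using assms by blast
  have pcl: "cyc p x = cyc p a" if "x \<in> cyc q b" for x
    by (rule cyc_eq[OF permp]) (use that ins(1) in simp)
  have "cyc p ` insert a A - {cyc p a} = cyc q ` A - {cyc q b}"
  proof (intro Set.set_eqI iffI)
    fix c assume "c \<in> cyc p ` insert a A - {cyc p a}"
    then obtain x where x: "x \<in> A" "c = cyc p x" "c \<noteq> cyc p a" by auto
    have nx: "x \<notin> cyc q b" using pcl x(2,3) by metis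
    then have "cyc q x \<noteq> cyc q b" using cyc_self[of x q] by metis
    moreover have "c = cyc q x" unfolding x(2) by (rule ins(2)[OF x(1) nx])
    ultimately show "c \<in> cyc q ` A - {cyc q b}" using x(1) by blast
  next
    fix c assume "c \<in> cyc q ` A - {cyc q b}"
    then obtain x where x: "x \<in> A" "c = cyc q x" "c \<noteq> cyc q b" by auto
    have nx: "x \<notin> cyc q b" using cyc_eq[OF perm] x(2,3) by metis
    have "c \<noteq> cyc p a" using x(2) sub[OF x(1)] assms(3) cyc_self[of a p] by blast
    moreover have "c = cyc p x" unfolding x(2) by (rule ins(2)[OF x(1) nx, symmetric])
    ultimately show "c \<in> cyc p ` insert a A - {cyc p a}" using x(1) by blast
  qed
  then show ?thesis
    unfolding p_def[symmetric] marked_weight_def ia by (simp only: card add_Suc add_Suc_right)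
qed

text \<open>Permutations of \<open>insert a A\<close> are split by the image \<open>b\<close> of
  \<open>a\<close>. For \<open>b = a\<close> the marked cycle closes with its \<open>k\<close>
  contracted points; otherwise \<open>a\<close> is contracted and \<open>b\<close> becomes the
  marked point.\<close>

lemma sum_marked_weight_rec:
  assumes "finite A" and "a \<notin> A"
  shows "(\<Sum>p | p permutes insert a A. marked_weight f A a k p) =
    f (Suc k) * (\<Sum>p | p permutes A. cycle_weight f A p) +
    (\<Sum>b\<in>A. \<Sum>p | p permutes insert b (A - {b}). marked_weight f (A - {b}) b (Suc k) p)"
proof -
  have "(\<Sum>p | p permutes insert a A. marked_weight f A a k p) =
    (\<Sum>b\<in>insert a A. \<Sum>q | q permutes A. marked_weight f A a k (Transposition.transpose a b \<circ> q))"
    by (rule sum_over_permutations_insert[OF assms])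
  also have "\<dots> = (\<Sum>q | q permutes A. marked_weight f A a k q) +
    (\<Sum>b\<in>A. \<Sum>q | q permutes A. marked_weight f A a k (Transposition.transpose a b \<circ> q))"
    using assms by simp
  also have "(\<Sum>q | q permutes A. marked_weight f A a k q) =
      f (Suc k) * (\<Sum>p | p permutes A. cycle_weight f A p)"
    unfolding sum_distrib_left using assms by (intro sum.cong refl marked_weight_fixed) auto
  also have "(\<Sum>b\<in>A. \<Sum>q | q permutes A. marked_weight f A a k (Transposition.transpose a b \<circ> q)) =
    (\<Sum>b\<in>A. \<Sum>p | p permutes insert b (A - {b}). marked_weight f (A - {b}) b (Suc k) p)"
    using assms by (intro sum.cong refl marked_weight_insert) (auto simp: insert_absorb)
  finally show ?thesis .
qed

text \<open>Newton's identities: if \<open>f s = (-1)\<^bsup>s-1\<^esup> p\<^sub>s\<close> for power sums \<open>p\<^sub>s\<close>, then these are the elementary symmetric polynomials.\<close>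

fun cycle_coeff :: "(nat \<Rightarrow> 'c::field_char_0) \<Rightarrow> nat \<Rightarrow> 'c" where
  "cycle_coeff f 0 = 1"
| "cycle_coeff f (Suc n) = (\<Sum>j\<le>n. f (Suc j) * cycle_coeff f (n - j)) / of_nat (Suc n)"

text \<open>The contraction turns cycle weights into marked weights, so an induction on cycle
  weights alone does not close; both sums are carried along together.\<close>

theorem sum_cycle_weight:
  fixes f :: "nat \<Rightarrow> 'c::field_char_0"
  assumes "finite A"
  shows "(\<Sum>p | p permutes A. cycle_weight f A p) = fact (card A) * cycle_coeff f (card A)"
proof -
  \<comment> \<open>The value of the marked sum with \<open>n\<close> unmarked points: if the marked
    cycle takes up \<open>j\<close> of them, there are \<open>n! / (n-j)!\<close> ordered choices,
    and the rest contributes \<open>(n-j)!\<close> times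
    \<open>cycle_coeff f (n - j)\<close>.\<close>
  define S where "S n k = fact n * (\<Sum>j\<le>n. f (Suc (k + j)) * cycle_coeff f (n - j))" for n k
  have W_Suc: "fact (Suc n) * cycle_coeff f (Suc n) = S n 0" for n
    by (simp add: S_def field_simps del: of_nat_Suc)
  have S_Suc: "S (Suc n) k = f (Suc k) * (fact (Suc n) * cycle_coeff f (Suc n)) +
      of_nat (Suc n) * S n (Suc k)" for n k
    unfolding S_def sum.atMost_Suc_shift by (simp add: algebra_simps del: cycle_coeff.simps)
  have "(\<forall>A :: 'a set. finite A \<and> card A = n \<longrightarrow>
          (\<Sum>p | p permutes A. cycle_weight f A p) = fact n * cycle_coeff f n) \<and>
        (\<forall>(A :: 'a set) a k. finite A \<and> card A = n \<and> a \<notin> A \<longrightarrow>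
          (\<Sum>p | p permutes insert a A. marked_weight f A a k p) = S n k)" for n
  proof (induction n)
    case 0
    show ?case
    proof (intro conjI allI impI)
      fix A :: "'a set" assume "finite A \<and> card A = 0"
      then have "A = {}" by auto
      then show "(\<Sum>p | p permutes A. cycle_weight f A p) = fact 0 * cycle_coeff f 0"
        by (simp add: cycle_weight_def)
    next
      fix A :: "'a set" and a k assume "finite A \<and> card A = 0 \<and> a \<notin> A"
      then have "A = {}" by auto
      then show "(\<Sum>p | p permutes insert a A. marked_weight f A a k p) = S 0 k"
        using sum_marked_weight_rec[of A a f k] by (simp add: cycle_weight_def S_def)
    qed
  next
    case (Suc n)
    have W: "(\<Sum>p | p permutes A. cycle_weight f A p) = fact (Suc n) * cycle_coeff f (Suc n)"
      if A: "finite A" "card A = Suc n" for A :: "'a set"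
    proof -
      obtain a B where B: "A = insert a B" "a \<notin> B" "card B = n" "finite B"
        using A by (metis card_Suc_eq finite_insert)
      then have "(\<Sum>p | p permutes A. cycle_weight f A p) = S n 0"
        using Suc by (simp add: marked_weight_zero[symmetric])
      then show ?thesis using W_Suc by simp
    qed
    have "(\<Sum>p | p permutes insert a A. marked_weight f A a k p) = S (Suc n) k"
      if A: "finite A" "card A = Suc n" "a \<notin> A" for A :: "'a set" and a k
    proof -
      have "(\<Sum>p | p permutes insert b (A - {b}). marked_weight f (A - {b}) b (Suc k) p) = S n (Suc k)"
        if "b \<in> A" for b
        using Suc.IH[THEN conjunct2, rule_format, of "A - {b}" b "Suc k"] A that by simp
      then show ?thesis
        using W[OF A(1,2)] A unfolding sum_marked_weight_rec[OF A(1,3)] S_Suc by simp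
    qed
    then show ?case using W by blast
  qed
  then show ?thesis using assms by blast
qed

text \<open>Each cycle has exactly one largest element. This links the ordered product in
  \<open>DetM\<close>, indexed by maxima, to products over the set of cycles and to a partition of
  the integration variables.\<close>

lemma cycle_maxima_cycles:
  assumes p: "p permutes {..<n}"
  shows "inj_on (cyc p) (cycle_maxima n p)"
    and "cyc p ` {..<n} = cyc p ` cycle_maxima n p"
    and "x \<in> cycle_maxima n p \<Longrightarrow> y \<in> cycle_maxima n p \<Longrightarrow> x \<noteq> y \<Longrightarrow>
      set (support p x) \<inter> set (support p y) = {}"
    and "(\<Union>m\<in>cycle_maxima n p. set (support p m)) = {..<n}"
proof -
  have perm: "permutation p" by (rule permutation_if_permutes[OF finite_lessThan p])
  let ?M = "cycle_maxima n p"
  have M: "?M = {m. m < n \<and> (\<forall>j\<in>cyc p m. j \<le> m)}"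
    unfolding cycle_maxima_def set_support[OF perm] ..
  have finM: "finite ?M" unfolding M by simp
  have sub: "cyc p x \<subseteq> {..<n}" if "x < n" for x by (rule cyc_subset[OF p]) (use that in simp)
  have fin: "finite (cyc p x)" if "x < n" for x by (rule finite_subset[OF sub[OF that]]) simp
  show inj: "inj_on (cyc p) ?M"
  proof (rule inj_onI)
    fix x y assume "x \<in> ?M" "y \<in> ?M" "cyc p x = cyc p y"
    then show "x = y" using cyc_self[of x p] cyc_self[of y p] unfolding M
      by (metis (mono_tags, lifting) antisym mem_Collect_eq)
  qed
  show im: "cyc p ` {..<n} = cyc p ` ?M"
  proof
    show "cyc p ` {..<n} \<subseteq> cyc p ` ?M"
    proof
      fix c assume "c \<in> cyc p ` {..<n}"
      then obtain x where x: "x < n" "c = cyc p x" by auto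
      let ?m = "Max (cyc p x)"
      have m: "?m \<in> cyc p x" using fin[OF x(1)] by (intro Max_in) auto
      then have "cyc p ?m = cyc p x" using cyc_eq[OF perm] by blast
      moreover have "?m \<in> ?M" unfolding M using m sub[OF x(1)] calculation fin[OF x(1)] by auto
      ultimately show "c \<in> cyc p ` ?M" using x by (metis image_eqI)
    qed
  qed (auto simp: M)
  have disj: "cyc p x \<inter> cyc p y = {}" if "x \<in> ?M" "y \<in> ?M" "x \<noteq> y" for x y
  proof (rule ccontr)
    assume "\<not> ?thesis"
    then obtain z where "z \<in> cyc p x" "z \<in> cyc p y" by auto
    then have "cyc p x = cyc p y" using cyc_eq[OF perm] by metis
    then show False using inj that by (auto dest: inj_onD)
  qed
  then show "set (support p x) \<inter> set (support p y) = {}" if "x \<in> ?M" "y \<in> ?M" "x \<noteq> y" for x y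
    unfolding set_support[OF perm] using that by blast
  show "(\<Union>m\<in>?M. set (support p m)) = {..<n}"
    unfolding set_support[OF perm]
  proof (intro equalityI subsetI)
    fix x assume "x \<in> {..<n}"
    then have "cyc p x \<in> cyc p ` ?M" using im by (metis image_eqI)
    then show "x \<in> (\<Union>m\<in>?M. cyc p m)" using cyc_self[of x p] by auto
  next
    fix x assume "x \<in> (\<Union>m\<in>?M. cyc p m)"
    then obtain m where "m \<in> ?M" "x \<in> cyc p m" by auto
    then show "x \<in> {..<n}" using sub[of m] by (auto simp: M)
  qed
qed

text \<open>The exponent \<open>n - r\<close> of the determinant is the sum of \<open>s - 1\<close>
  over the cycle lengths \<open>s\<close>, so its sign distributes over the cycles.\<close>

lemma cycle_weight_eq_cycle_maxima:
  fixes \<tau> :: "nat \<Rightarrow> 'c::comm_ring_1"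
  assumes p: "p permutes {..<n}"
  shows "cycle_weight (\<lambda>s. (-1) ^ (s - 1) * \<tau> s) {..<n} p =
    (-1) ^ (n - card (cycle_maxima n p)) * (\<Prod>m\<in>cycle_maxima n p. \<tau> (length (support p m)))"
proof -
  have perm: "permutation p" by (rule permutation_if_permutes[OF finite_lessThan p])
  let ?M = "cycle_maxima n p"
  note cycles = cycle_maxima_cycles[OF p]
  have finM: "finite ?M" by (simp add: cycle_maxima_def)
  have len: "length (support p m) = card (cyc p m)" for m
    using distinct_card[OF cycle_of_permutation[OF perm, of m]] set_support[OF perm, of m] by simp
  have "card (\<Union>m\<in>?M. set (support p m)) = (\<Sum>m\<in>?M. card (set (support p m)))"
  proof (rule card_UN_disjoint[OF finM])
    show "\<forall>m\<in>?M. finite (set (support p m))" by simp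
    show "\<forall>i\<in>?M. \<forall>j\<in>?M. i \<noteq> j \<longrightarrow> set (support p i) \<inter> set (support p j) = {}"
      using cycles(3) by blast
  qed
  then have "(\<Sum>m\<in>?M. card (cyc p m)) = n"
    using cycles(4) by (simp only: set_support[OF perm] card_lessThan)
  moreover have "1 \<le> card (cyc p m)" for m
    using least_power_of_permutation(2)[OF perm, of m] len[of m] by simp
  ultimately have exp: "(\<Sum>m\<in>?M. card (cyc p m) - 1) = n - card ?M"
    by (simp add: sum_subtractf_nat)
  have "cycle_weight (\<lambda>s. (-1) ^ (s - 1) * \<tau> s) {..<n} p =
      (\<Prod>m\<in>?M. (-1) ^ (card (cyc p m) - 1) * \<tau> (card (cyc p m)))"
    unfolding cycle_weight_def cycles(2) by (simp add: prod.reindex[OF cycles(1)])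
  also have "\<dots> = (-1) ^ (n - card ?M) * (\<Prod>m\<in>?M. \<tau> (card (cyc p m)))"
    by (simp add: prod.distrib power_sum[symmetric] exp[simplified])
  finally show ?thesis unfolding len .
qed


section \<open>Square roots of polynomials with nonnegative coefficients\<close>

text \<open>Coefficient \<open>n\<close> of the differential equation expresses coefficient
  \<open>n + 1\<close> of the series by earlier ones. Series can thus be compared through their
  logarithmic derivatives without a formal logarithm.\<close>

lemma fps_log_deriv_unique:
  fixes F G L :: "'c::field_char_0 fps"
  assumes "fps_deriv F = L * F" and "fps_deriv G = L * G" and "fps_nth F 0 = fps_nth G 0"
  shows "F = G"
proof -
  have rec: "fps_nth H (Suc n) = (\<Sum>i=0..n. fps_nth L i * fps_nth H (n - i)) / of_nat (Suc n)"
    if "fps_deriv H = L * H" for H n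
    using arg_cong[OF that, of "\<lambda>X. fps_nth X n"]
    by (simp add: fps_mult_nth eq_divide_eq mult.commute[of "of_nat _"] del: of_nat_Suc)
  have "fps_nth F n = fps_nth G n" for n
  proof (induction n rule: less_induct)
    case (less n)
    show ?case
    proof (cases n)
      case (Suc m)
      have "(\<Sum>i=0..m. fps_nth L i * fps_nth F (m - i)) = (\<Sum>i=0..m. fps_nth L i * fps_nth G (m - i))"
        using less Suc by (intro sum.cong refl) simp
      then show ?thesis using rec[OF assms(1)] rec[OF assms(2)] Suc by simp
    qed (use assms in simp)
  qed
  then show ?thesis by (rule fps_ext)
qed

text \<open>The defining recursion of \<open>cycle_coeff\<close>, read coefficientwise.\<close>

lemma fps_deriv_cycle_coeff:
  "fps_deriv (Abs_fps (cycle_coeff f)) = Abs_fps (\<lambda>n. f (Suc n)) * Abs_fps (cycle_coeff f)"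
  by (rule fps_ext) (simp add: fps_mult_nth atLeast0AtMost del: of_nat_Suc)

text \<open>Each factor contributes the geometric series of
  \<open>\<alpha> / (1 + \<alpha> X)\<close> to the logarithmic derivative; \<open>y\<close> below
  is this expansion with the denominator cleared.\<close>

lemma fps_deriv_prod_linear:
  fixes \<alpha> :: "nat \<Rightarrow> 'c::field_char_0"
  shows "fps_deriv (\<Prod>j<N. 1 + fps_const (\<alpha> j) * fps_X) =
    Abs_fps (\<lambda>n. (-1) ^ n * (\<Sum>j<N. \<alpha> j ^ Suc n)) * (\<Prod>j<N. 1 + fps_const (\<alpha> j) * fps_X)"
proof (induction N)
  case 0
  then show ?case by (simp add: fps_eq_iff fps_mult_nth)
next
  case (Suc N)
  let ?y = "1 + fps_const (\<alpha> N) * fps_X"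
  let ?l = "Abs_fps (\<lambda>n. (-1) ^ n * \<alpha> N ^ Suc n)"
  let ?L = "\<lambda>N. Abs_fps (\<lambda>n. (-1) ^ n * (\<Sum>j<N. \<alpha> j ^ Suc n))"
  have y: "fps_const (\<alpha> N) = ?l * ?y"
  proof -
    have "?l * ?y = ?l + fps_const (\<alpha> N) * (?l * fps_X)" by (simp add: algebra_simps)
    also have "\<dots> = fps_const (\<alpha> N)"
    proof (rule fps_ext)
      fix n show "fps_nth (?l + fps_const (\<alpha> N) * (?l * fps_X)) n = fps_nth (fps_const (\<alpha> N)) n"
        by (cases n) simp_all
    qed
    finally show ?thesis by simp
  qed
  have L: "?L (Suc N) = ?L N + ?l"
    by (rule fps_ext) (simp add: algebra_simps)
  have "fps_deriv (\<Prod>j<Suc N. 1 + fps_const (\<alpha> j) * fps_X) =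
     ?L N * (\<Prod>j<N. 1 + fps_const (\<alpha> j) * fps_X) * ?y + (\<Prod>j<N. 1 + fps_const (\<alpha> j) * fps_X) * fps_const (\<alpha> N)"
    using Suc by (simp add: algebra_simps)
  also have "\<dots> = (?L N + ?l) * ((\<Prod>j<N. 1 + fps_const (\<alpha> j) * fps_X) * ?y)"
    by (subst y) (simp add: algebra_simps)
  finally show ?case unfolding L by (simp add: mult.commute)
qed

text \<open>Squaring doubles a logarithmic derivative, which turns the half power sums
  \<open>\<tau>\<close> into the power sums that belong to the product.\<close>

lemma square_cycle_coeff:
  fixes \<alpha> :: "nat \<Rightarrow> 'c::field_char_0"
  assumes \<tau>: "\<And>s. s \<ge> 1 \<Longrightarrow> 2 * \<tau> s = (\<Sum>j<N. \<alpha> j ^ s)"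
  shows "(Abs_fps (cycle_coeff (\<lambda>s. (-1) ^ (s - 1) * \<tau> s)))\<^sup>2 = (\<Prod>j<N. 1 + fps_const (\<alpha> j) * fps_X)"
    (is "?G\<^sup>2 = ?P")
proof (rule fps_log_deriv_unique)
  let ?L = "Abs_fps (\<lambda>n. (-1) ^ n * (\<Sum>j<N. \<alpha> j ^ Suc n))"
  show "fps_deriv ?P = ?L * ?P" by (rule fps_deriv_prod_linear)
  have "?L = 2 * Abs_fps (\<lambda>n. (-1) ^ (Suc n - 1) * \<tau> (Suc n))"
  proof (rule fps_ext)
    fix n
    show "fps_nth ?L n = fps_nth (2 * Abs_fps (\<lambda>n. (-1) ^ (Suc n - 1) * \<tau> (Suc n))) n"
      using \<tau>[of "Suc n"] by (simp add: mult_ac)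
  qed
  then show "fps_deriv (?G\<^sup>2) = ?L * ?G\<^sup>2"
    using fps_deriv_cycle_coeff[of "\<lambda>s. (-1) ^ (s - 1) * \<tau> s"]
    by (simp add: power2_eq_square algebra_simps)
  have "fps_nth (\<Prod>j<N. 1 + fps_const (\<alpha> j) * fps_X) 0 = 1"
    by (induction N) simp_all
  then show "fps_nth (?G\<^sup>2) 0 = fps_nth ?P 0"
    by (simp add: power2_eq_square)
qed

section \<open>From power series to polynomials and multiplicities of roots\<close>

lemma fps_of_poly_prod_linear:
  "(\<Prod>j\<in>J. 1 + fps_const (\<alpha> j) * fps_X) = fps_of_poly (\<Prod>j\<in>J. [:1, \<alpha> j:])"
  by (simp add: fps_of_poly_prod fps_of_poly_pCons)

text \<open>The square of a power series with nonnegative coefficients has positive coefficient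
  \<open>e\<^sub>m\<^sup>2\<close> at index \<open>2 m\<close>, so it can be a polynomial only if the series is one.\<close>

lemma nonneg_sqrt_of_poly:
  fixes e :: "nat \<Rightarrow> real" and p :: "complex poly"
  assumes "\<And>n. e n \<ge> 0" and sq: "(Abs_fps (\<lambda>n. complex_of_real (e n)))\<^sup>2 = fps_of_poly p"
    and m: "2 * m > degree p"
  shows "e m = 0"
proof -
  have "0 = fps_nth ((Abs_fps (\<lambda>n. complex_of_real (e n)))\<^sup>2) (2 * m)"
    using sq m by (simp add: coeff_eq_0)
  also have "\<dots> = complex_of_real (\<Sum>i=0..2*m. e i * e (2 * m - i))"
    by (simp add: power2_eq_square fps_mult_nth)
  finally have s: "(\<Sum>i=0..2*m. e i * e (2 * m - i)) = 0" by (metis of_real_eq_0_iff)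
  have "e m * e (2 * m - m) \<le> (\<Sum>i=0..2*m. e i * e (2 * m - i))"
    using assms(1) by (intro member_le_sum) auto
  then have "e m * e m \<le> 0" using s by simp
  then show ?thesis by (simp add: mult_le_0_iff assms(1) antisym)
qed

text \<open>The factor \<open>1 + \<alpha> X\<close> has the simple root \<open>-1/\<alpha>\<close>
  if \<open>\<alpha>\<close> is non-zero and no root otherwise, so multiplicities of values become
  orders of roots.\<close>

lemma order_prod_linear:
  fixes \<alpha> :: "nat \<Rightarrow> complex"
  assumes "z \<noteq> 0" and "finite J"
  shows "order (- inverse z) (\<Prod>j\<in>J. [:1, \<alpha> j:]) = card {j\<in>J. \<alpha> j = z}"
  using assms(2)
proof (induction J rule: finite_induct)
  case empty
  then show ?case by (simp add: order_0I)
next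
  case (insert x F)
  have nz: "(\<Prod>j\<in>F. [:1, \<alpha> j:]) \<noteq> 0" using insert by (simp add: prod_zero_iff)
  have o: "order (- inverse z) [:1, \<alpha> x:] = (if \<alpha> x = z then 1 else 0)"
  proof (cases "\<alpha> x = z")
    case True
    have "order (- inverse z) (Polynomial.smult z [:- (- inverse z), 1:]) =
        order (- inverse z) [:- (- inverse z), 1:]"
      by (rule order_smult[OF assms(1)])
    then show ?thesis using True order_power_n_n[of "- inverse z" 1] assms(1) by simp
  next
    case False
    then have "poly [:1, \<alpha> x:] (- inverse z) \<noteq> 0" using assms(1) by (simp add: field_simps)
    then show ?thesis using False by (simp add: order_0I)
  qed
  have "{j\<in>insert x F. \<alpha> j = z} = (if \<alpha> x = z then insert x {j\<in>F. \<alpha> j = z} else {j\<in>F. \<alpha> j = z})"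
    by auto
  then have c: "card {j\<in>insert x F. \<alpha> j = z} = (if \<alpha> x = z then 1 else 0) + card {j\<in>F. \<alpha> j = z}"
    using insert by simp
  have "order (- inverse z) (\<Prod>j\<in>insert x F. [:1, \<alpha> j:]) =
      order (- inverse z) ([:1, \<alpha> x:] * (\<Prod>j\<in>F. [:1, \<alpha> j:]))"
    using insert by simp
  also have "\<dots> = order (- inverse z) [:1, \<alpha> x:] + order (- inverse z) (\<Prod>j\<in>F. [:1, \<alpha> j:])"
    by (rule order_mult, rule no_zero_divisors) (use nz in simp_all)
  finally show ?case using insert.IH o c by simp
qed

text \<open>Zeros drop out because \<open>h 0 = 1\<close>. \<open>Z\<close> may exceed the set of
  values, so that products over two different lists can be compared factor by factor over one common
  \<open>Z\<close>.\<close>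

lemma prod_by_multiplicity:
  fixes \<alpha> :: "nat \<Rightarrow> complex" and h :: "complex \<Rightarrow> 'c::comm_monoid_mult"
  assumes "finite J" and "h 0 = 1" and Z: "finite Z" "\<alpha> ` J - {0} \<subseteq> Z" "0 \<notin> Z"
  shows "(\<Prod>j\<in>J. h (\<alpha> j)) = (\<Prod>z\<in>Z. h z ^ card {j\<in>J. \<alpha> j = z})"
proof -
  have "(\<Prod>j\<in>J. h (\<alpha> j)) = (\<Prod>j\<in>{j\<in>J. \<alpha> j \<noteq> 0}. h (\<alpha> j))"
    using assms by (intro prod.mono_neutral_right) auto
  also have "\<dots> = (\<Prod>z\<in>Z. \<Prod>j\<in>{j\<in>{j\<in>J. \<alpha> j \<noteq> 0}. \<alpha> j = z}. h (\<alpha> j))"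
    using assms by (intro prod.group[symmetric]) auto
  also have "\<dots> = (\<Prod>z\<in>Z. \<Prod>j\<in>{j\<in>J. \<alpha> j = z}. h z)"
  proof (rule prod.cong[OF refl])
    fix z assume "z \<in> Z"
    then have "{j\<in>{j\<in>J. \<alpha> j \<noteq> 0}. \<alpha> j = z} = {j\<in>J. \<alpha> j = z}" using Z by auto
    then show "(\<Prod>j\<in>{j\<in>{j\<in>J. \<alpha> j \<noteq> 0}. \<alpha> j = z}. h (\<alpha> j)) = (\<Prod>j\<in>{j\<in>J. \<alpha> j = z}. h z)"
      by simp
  qed
  also have "\<dots> = (\<Prod>z\<in>Z. h z ^ card {j\<in>J. \<alpha> j = z})" by simp
  finally show ?thesis .
qed

text \<open>The non-zero values with halved multiplicities form a multiset of half the size, which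
  fits into \<open>r\<close> places; the remaining places hold zeros, which the counts for
  \<open>z \<noteq> 0\<close> do not see.\<close>

lemma exists_halved_listing:
  fixes \<alpha> :: "nat \<Rightarrow> complex"
  assumes "finite J" and even: "\<And>z. z \<noteq> 0 \<Longrightarrow> even (card {j\<in>J. \<alpha> j = z})"
    and r: "card {j\<in>J. \<alpha> j \<noteq> 0} div 2 \<le> r"
  shows "\<exists>eig. \<forall>z. z \<noteq> 0 \<longrightarrow> card {j\<in>J. \<alpha> j = z} = 2 * card {k \<in> {1..r}. eig k = z}"
proof -
  define Z where "Z = \<alpha> ` J - {0}"
  define m where "m z = card {j\<in>J. \<alpha> j = z} div 2" for z
  define B where "B = (\<Sum>z\<in>Z. replicate_mset (m z) z)"
  have fZ: "finite Z" using assms by (simp add: Z_def)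
  have count: "count B z = (if z \<in> Z then m z else 0)" for z
  proof -
    have "count B z = (\<Sum>y\<in>Z. if y = z then m y else 0)"
      unfolding B_def count_sum by (intro sum.cong) auto
    then show ?thesis using fZ by simp
  qed
  obtain xs where xs: "mset xs = B" using ex_mset by blast
  have "2 * size B = (\<Sum>z\<in>Z. 2 * m z)"
    unfolding B_def by (simp add: size_multiset_sum sum_distrib_left)
  also have "\<dots> = (\<Sum>z\<in>Z. card {j\<in>J. \<alpha> j = z})"
    using even by (intro sum.cong) (auto simp: m_def Z_def)
  also have "\<dots> = card (\<Union>z\<in>Z. {j\<in>J. \<alpha> j = z})"
    using fZ assms by (subst card_UN_disjoint) auto
  also have "(\<Union>z\<in>Z. {j\<in>J. \<alpha> j = z}) = {j\<in>J. \<alpha> j \<noteq> 0}"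
    by (auto simp: Z_def)
  finally have "length xs \<le> r" using r xs by (metis nonzero_mult_div_cancel_left size_mset zero_neq_numeral)
  define eig where "eig k = (if k - 1 < length xs then xs ! (k - 1) else 0)" for k
  have "card {j\<in>J. \<alpha> j = z} = 2 * card {k \<in> {1..r}. eig k = z}" if z: "z \<noteq> 0" for z
  proof -
    have "{k \<in> {1..r}. eig k = z} = Suc ` {i. i < length xs \<and> xs ! i = z}"
    proof (intro Set.set_eqI iffI)
      fix k assume "k \<in> {k \<in> {1..r}. eig k = z}"
      then show "k \<in> Suc ` {i. i < length xs \<and> xs ! i = z}"
        using z by (intro image_eqI[of _ _ "k - 1"]) (auto simp: eig_def split: if_splits)
    qed (use \<open>length xs \<le> r\<close> in \<open>auto simp: eig_def\<close>)
    then have "card {k \<in> {1..r}. eig k = z} = card {i. i < length xs \<and> xs ! i = z}"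
      by (simp add: card_image)
    also have "{i. i < length xs \<and> xs ! i = z} = {i. i < length xs \<and> z = xs ! i}" by auto
    also have "card \<dots> = count B z"
      by (simp add: xs[symmetric] count_mset length_filter_conv_card count_list_eq_length_filter)
    also have "2 * \<dots> = card {j\<in>J. \<alpha> j = z}"
    proof (cases "z \<in> Z")
      case True then show ?thesis using even[OF z] by (simp add: count m_def)
    next
      case False
      then have "{j\<in>J. \<alpha> j = z} = {}" using z by (auto simp: Z_def)
      then show ?thesis using False by (simp only: count card.empty if_False mult_0_right)
    qed
    finally show ?thesis by simp
  qed
  then show ?thesis by blast
qed

text \<open>The coefficients \<open>e\<close> form a polynomial \<open>g\<close> with
  \<open>g\<^sup>2 = P\<close>. Roots of a square have even order, and a halved listing provides a
  second square root \<open>H\<close> of \<open>P\<close>.\<close>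

theorem eigenvalue_product_eq_cycle_series:
  fixes \<alpha> :: "nat \<Rightarrow> complex" and e :: "nat \<Rightarrow> real"
  assumes \<tau>: "\<And>s. s \<ge> 1 \<Longrightarrow> 2 * \<tau> s = (\<Sum>j<N. \<alpha> j ^ s)"
    and e: "\<And>n. cycle_coeff (\<lambda>s. (-1) ^ (s - 1) * \<tau> s) n = of_real (e n)" "\<And>n. e n \<ge> 0"
  shows "\<And>m. m > N \<Longrightarrow> e m = 0"
    and "\<And>z. z \<noteq> 0 \<Longrightarrow> even (card {j\<in>{..<N}. \<alpha> j = z})"
    and "\<And>r eig w. (\<And>z. z \<noteq> 0 \<Longrightarrow> card {j\<in>{..<N}. \<alpha> j = z} = 2 * card {k \<in> {1..r::nat}. eig k = z}) \<Longrightarrow>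
      (\<Prod>k=1..r. 1 + w * eig k) = (\<Sum>m\<le>N. of_real (e m) * w ^ m)"
proof -
  define P where "P = (\<Prod>j<N. [:1, \<alpha> j:])"
  have sq: "(Abs_fps (\<lambda>n. complex_of_real (e n)))\<^sup>2 = fps_of_poly P"
  proof -
    have "cycle_coeff (\<lambda>s. (-1) ^ (s - 1) * \<tau> s) = (\<lambda>n. complex_of_real (e n))"
      by (rule ext) (rule e(1))
    then show ?thesis
      using square_cycle_coeff[OF \<tau>] by (simp only: fps_of_poly_prod_linear P_def)
  qed
  have degP: "degree P \<le> N"
    unfolding P_def
    by (rule order.trans[OF degree_prod_sum_le]) (auto intro: order.trans[OF sum_mono[where g = "\<lambda>_. 1"]])
  show e0: "e m = 0" if "m > N" for m
    using nonneg_sqrt_of_poly[OF e(2) sq, of m] that degP by simp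
  define g where "g = (\<Sum>m\<le>N. monom (complex_of_real (e m)) m)"
  have cg: "coeff g m = of_real (e m)" for m
    using e0[of m] by (simp add: g_def coeff_sum not_le)
  have "fps_of_poly g = Abs_fps (\<lambda>n. complex_of_real (e n))"
    by (rule fps_ext) (simp add: cg)
  then have "fps_of_poly (g\<^sup>2) = fps_of_poly P" using sq by (simp add: fps_of_poly_power)
  then have gP: "g\<^sup>2 = P" by (simp add: fps_of_poly_eq_iff)
  have P0: "P \<noteq> 0" unfolding P_def by simp
  show "even (card {j\<in>{..<N}. \<alpha> j = z})" if "z \<noteq> 0" for z
  proof -
    have "card {j\<in>{..<N}. \<alpha> j = z} = order (- inverse z) P"
      using order_prod_linear[OF that, of "{..<N}" \<alpha>] by (simp add: P_def)
    also have "\<dots> = order (- inverse z) g + order (- inverse z) g"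
      unfolding gP[symmetric] power2_eq_square using P0 gP by (intro order_mult) (auto simp: power2_eq_square)
    finally show ?thesis by simp
  qed
  fix r :: nat and eig w
  assume eig: "\<And>z. z \<noteq> 0 \<Longrightarrow> card {j\<in>{..<N}. \<alpha> j = z} = 2 * card {k \<in> {1..r}. eig k = z}"
  define H where "H = (\<Prod>k=1..r. [:1, eig k:])"
  define Z where "Z = (\<alpha> ` {..<N} \<union> eig ` {1..r}) - {0}"
  have "P = (\<Prod>z\<in>Z. [:1, z:] ^ card {j\<in>{..<N}. \<alpha> j = z})"
    unfolding P_def by (rule prod_by_multiplicity) (auto simp: Z_def)
  also have "\<dots> = (\<Prod>z\<in>Z. [:1, z:] ^ card {k\<in>{1..r}. eig k = z})\<^sup>2"
    unfolding prod_power_distrib power_mult[symmetric]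
  proof (rule prod.cong[OF refl])
    fix z assume "z \<in> Z"
    then have "z \<noteq> 0" by (simp add: Z_def)
    from eig[OF this] show "[:1, z:] ^ card {j\<in>{..<N}. \<alpha> j = z} = [:1, z:] ^ (card {k\<in>{1..r}. eig k = z} * 2)"
      by (simp only: mult.commute)
  qed
  also have "(\<Prod>z\<in>Z. [:1, z:] ^ card {k\<in>{1..r}. eig k = z}) = H"
    unfolding H_def by (rule prod_by_multiplicity[symmetric]) (auto simp: Z_def)
  \<comment> \<open>Square roots of \<open>P\<close> differ at most by a sign; both \<open>g\<close>
    and \<open>H\<close> take the value 1 at 0, which excludes \<open>g = - H\<close>.\<close>
  finally have "(g - H) * (g + H) = 0" using gP by (simp add: power2_eq_square algebra_simps)
  moreover have "g + H \<noteq> 0"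
  proof
    assume "g + H = 0"
    then have "poly g 0 + poly H 0 = 0" by (metis poly_add poly_0)
    moreover have "poly H 0 = 1" by (simp add: H_def poly_prod)
    moreover have "poly g 0 = 1" using cg[of 0] e(1)[of 0] by (simp add: poly_0_coeff_0)
    ultimately show False by simp
  qed
  ultimately have "g = H" by simp
  then have "poly g w = (\<Prod>k=1..r. 1 + w * eig k)" by (simp add: H_def poly_prod)
  then show "(\<Prod>k=1..r. 1 + w * eig k) = (\<Sum>m\<le>N. of_real (e m) * w ^ m)"
    by (simp add: g_def poly_sum poly_monom)
qed


section \<open>Jordan form in coordinates\<close>

text \<open>Matrices are functions of which only the entries below \<open>N\<close> count, over a
  semiring that need not commute: the same operations serve the quaternion Gram matrix and its
  complex Jordan form.\<close>

definition mmul :: "nat \<Rightarrow> (nat \<Rightarrow> nat \<Rightarrow> 'r::semiring_1) \<Rightarrow> (nat \<Rightarrow> nat \<Rightarrow> 'r) \<Rightarrow> nat \<Rightarrow> nat \<Rightarrow> 'r" where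
  "mmul N A B i j = (\<Sum>k<N. A i k * B k j)"

definition mdelta :: "nat \<Rightarrow> nat \<Rightarrow> 'r::semiring_1" where
  "mdelta i j = (if i = j then 1 else 0)"

primrec mpow :: "nat \<Rightarrow> (nat \<Rightarrow> nat \<Rightarrow> 'r::semiring_1) \<Rightarrow> nat \<Rightarrow> nat \<Rightarrow> nat \<Rightarrow> 'r" where
  "mpow N A 0 = mdelta"
| "mpow N A (Suc s) = mmul N A (mpow N A s)"

lemma mmul_assoc: "mmul N (mmul N A B) C = mmul N A (mmul N B C)"
proof (intro ext)
  fix i j
  have "mmul N (mmul N A B) C i j = (\<Sum>k<N. \<Sum>l<N. A i l * B l k * C k j)"
    by (simp add: mmul_def sum_distrib_right)
  also have "\<dots> = (\<Sum>l<N. \<Sum>k<N. A i l * B l k * C k j)" by (rule sum.swap)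
  also have "\<dots> = mmul N A (mmul N B C) i j"
    by (simp add: mmul_def sum_distrib_left mult.assoc)
  finally show "mmul N (mmul N A B) C i j = mmul N A (mmul N B C) i j" .
qed

lemma mmul_cong:
  assumes "\<And>k. k < N \<Longrightarrow> A i k = A' i k" and "\<And>k. k < N \<Longrightarrow> B k j = B' k j"
  shows "mmul N A B i j = mmul N A' B' i j"
  unfolding mmul_def using assms by (intro sum.cong) auto

lemma mmul_mdelta_left: "i < N \<Longrightarrow> mmul N mdelta B i j = B i j"
proof -
  assume "i < N"
  have "mmul N mdelta B i j = (\<Sum>k<N. if k = i then B k j else 0)"
    unfolding mmul_def mdelta_def by (intro sum.cong) auto
  then show ?thesis using \<open>i < N\<close> by simp
qed

lemma mmul_mdelta_right: "j < N \<Longrightarrow> mmul N B mdelta i j = B i j"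
proof -
  assume "j < N"
  have "mmul N B mdelta i j = (\<Sum>k<N. if k = j then B i k else 0)"
    unfolding mmul_def mdelta_def by (intro sum.cong) auto
  then show ?thesis using \<open>j < N\<close> by simp
qed

text \<open>\<open>\<epsilon> j\<close> is the superdiagonal entry in column \<open>j\<close> and
  couples the indices \<open>j - 1\<close> and \<open>j\<close>; \<open>\<epsilon> 0\<close> is
  never read.\<close>

definition bidiag :: "(nat \<Rightarrow> 'r) \<Rightarrow> (nat \<Rightarrow> 'r) \<Rightarrow> nat \<Rightarrow> nat \<Rightarrow> 'r::semiring_1" where
  "bidiag \<alpha> \<epsilon> i j = (if j = i then \<alpha> j else if j = Suc i then \<epsilon> j else 0)"

lemma jordan_matrix_Cons:
  "jordan_matrix ((n, a) # n_as) = four_block_mat (jordan_block n a)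
     (0\<^sub>m n (sum_list (map fst n_as))) (0\<^sub>m (sum_list (map fst n_as)) n) (jordan_matrix n_as)"
  using jordan_matrix_dim[of n_as]
  by (simp add: jordan_matrix_def Let_def)

text \<open>An off-diagonal entry can be non-zero only inside one Jordan block, where the diagonal
  is constant. Block sizes are forgotten; this coupling of equal eigenvalues is what later arguments
  use.\<close>

lemma jordan_matrix_entries:
  assumes "i < sum_list (map fst n_as)" and "j < sum_list (map fst n_as)"
    and "jordan_matrix n_as $$ (i, j) \<noteq> 0"
  shows "j = i \<or> (j = Suc i \<and> jordan_matrix n_as $$ (i, i) = jordan_matrix n_as $$ (j, j))"
  using assms
proof (induction n_as arbitrary: i j)
  case Nil
  then show ?case by simp
next
  case (Cons na n_as)
  obtain n a where na: "na = (n, a)" by force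
  have idx: "jordan_matrix (na # n_as) $$ (i, j) =
      (if i < n then if j < n then (if i = j then a else if Suc i = j then 1 else 0) else 0
       else if j < n then 0 else jordan_matrix n_as $$ (i - n, j - n))"
    if "i < n + sum_list (map fst n_as)" "j < n + sum_list (map fst n_as)" for i j
    using that unfolding na jordan_matrix_Cons by auto
  have b: "i < n + sum_list (map fst n_as)" "j < n + sum_list (map fst n_as)"
    using Cons.prems na by auto
  show ?case
  proof (cases "i < n")
    case True
    then show ?thesis
      using Cons.prems(3) idx[OF b] idx[OF b(1) b(1)] idx[OF b(2) b(2)] by (auto split: if_splits)
  next
    case False
    have jn: "\<not> j < n" using False Cons.prems(3) idx[OF b] by auto
    have "j - n = i - n \<or> j - n = Suc (i - n) \<and>
        jordan_matrix n_as $$ (i - n, i - n) = jordan_matrix n_as $$ (j - n, j - n)"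
      using False jn b Cons.prems(3) idx[OF b] by (intro Cons.IH) auto
    then show ?thesis
      using False jn idx[OF b(1) b(1)] idx[OF b(2) b(2)] by auto
  qed
qed

text \<open>The characteristic polynomial splits over the complex numbers, so a Jordan form exists.
  Its bidiagonal shape and the equality of coupled eigenvalues are all that is recorded.\<close>

lemma jordan_data:
  fixes a :: "nat \<Rightarrow> nat \<Rightarrow> complex"
  obtains \<alpha> \<epsilon> :: "nat \<Rightarrow> complex" and P Q :: "nat \<Rightarrow> nat \<Rightarrow> complex" where
    "\<And>i j. i < N \<Longrightarrow> j < N \<Longrightarrow> mmul N P Q i j = mdelta i j"
    "\<And>i j. i < N \<Longrightarrow> j < N \<Longrightarrow> mmul N Q P i j = mdelta i j"
    "\<And>i j. i < N \<Longrightarrow> j < N \<Longrightarrow> a i j = mmul N P (mmul N (bidiag \<alpha> \<epsilon>) Q) i j"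
    "\<And>j. Suc j < N \<Longrightarrow> \<epsilon> (Suc j) \<noteq> 0 \<Longrightarrow> \<alpha> j = \<alpha> (Suc j)"
proof -
  define A where "A = mat N N (\<lambda>(i, j). a i j)"
  have A: "A \<in> carrier_mat N N" by (simp add: A_def)
  obtain as where "char_poly A = (\<Prod>a\<leftarrow>as. [:- a, 1:])"
    using char_poly_factorized[OF A] by blast
  then obtain n_as where "jordan_nf A n_as" using jordan_nf_exists[OF A] by blast
  then obtain P Q where sim: "similar_mat_wit A (jordan_matrix n_as) P Q"
    by (auto simp: jordan_nf_def similar_mat_def)
  define J where "J = jordan_matrix n_as"
  note w = similar_mat_witD2[OF A sim, folded J_def]
  have dim: "sum_list (map fst n_as) = N"
    using carrier_matD(1)[OF w(5)] jordan_matrix_dim(1)[of n_as] by (simp add: J_def)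
  define \<alpha> where "\<alpha> i = J $$ (i, i)" for i
  define \<epsilon> where "\<epsilon> j = J $$ (j - 1, j)" for j
  define fn where "fn (X :: complex mat) i j = X $$ (i, j)" for X i j
  have prod: "fn (X * Y) i j = mmul N (fn X) (fn Y) i j"
    if "X \<in> carrier_mat N N" "Y \<in> carrier_mat N N" "i < N" "j < N" for X Y i j
    using that by (simp add: fn_def mmul_def scalar_prod_def lessThan_atLeast0)
  have J: "fn J i j = bidiag \<alpha> \<epsilon> i j" if "i < N" "j < N" for i j
    using jordan_matrix_entries[of i n_as j] that dim
    by (auto simp: fn_def bidiag_def \<alpha>_def \<epsilon>_def J_def)
  have one: "fn (1\<^sub>m N) i j = mdelta i j" if "i < N" "j < N" for i j
    using that by (simp add: fn_def mdelta_def)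
  show thesis
  proof (rule that[of "fn P" "fn Q" \<alpha> \<epsilon>])
    show "mmul N (fn P) (fn Q) i j = mdelta i j" if "i < N" "j < N" for i j
      using prod[OF w(6,7) that] w(1) one[OF that] by simp
    show "mmul N (fn Q) (fn P) i j = mdelta i j" if "i < N" "j < N" for i j
      using prod[OF w(7,6) that] w(2) one[OF that] by simp
    show "a i j = mmul N (fn P) (mmul N (bidiag \<alpha> \<epsilon>) (fn Q)) i j" if "i < N" "j < N" for i j
    proof -
      have "a i j = fn A i j" using that by (simp add: fn_def A_def)
      also have "A = P * (J * Q)" using w(3) assoc_mult_mat[OF w(6,5,7)] by simp
      also have "fn (P * (J * Q)) i j = mmul N (fn P) (fn (J * Q)) i j"
        by (rule prod) (use w that in auto)
      also have "\<dots> = mmul N (fn P) (mmul N (bidiag \<alpha> \<epsilon>) (fn Q)) i j"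
      proof (rule mmul_cong[OF refl])
        fix k assume k: "k < N"
        have "fn (J * Q) k j = mmul N (fn J) (fn Q) k j" by (rule prod) (use w that k in auto)
        also have "\<dots> = mmul N (bidiag \<alpha> \<epsilon>) (fn Q) k j"
          by (rule mmul_cong) (use k J in auto)
        finally show "fn (J * Q) k j = mmul N (bidiag \<alpha> \<epsilon>) (fn Q) k j" .
      qed
      finally show ?thesis .
    qed
    show "\<alpha> j = \<alpha> (Suc j)" if "Suc j < N" "\<epsilon> (Suc j) \<noteq> 0" for j
      using jordan_matrix_entries[of j n_as "Suc j"] that dim
      by (simp add: \<alpha>_def \<epsilon>_def J_def)
  qed
qed

lemma trace_conjugate:
  fixes P Q X :: "nat \<Rightarrow> nat \<Rightarrow> 'r::comm_semiring_1"
  assumes "\<And>i j. i < N \<Longrightarrow> j < N \<Longrightarrow> mmul N Q P i j = mdelta i j"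
  shows "(\<Sum>i<N. mmul N P (mmul N X Q) i i) = (\<Sum>i<N. X i i)"
proof -
  have swap: "(\<Sum>i<N. mmul N A B i i) = (\<Sum>i<N. mmul N B A i i)" for A B :: "nat \<Rightarrow> nat \<Rightarrow> 'r"
    unfolding mmul_def by (subst sum.swap) (simp add: mult.commute)
  have "(\<Sum>i<N. mmul N P (mmul N X Q) i i) = (\<Sum>i<N. mmul N X (mmul N Q P) i i)"
    by (subst swap) (simp add: mmul_assoc)
  also have "\<dots> = (\<Sum>i<N. mmul N X mdelta i i)"
    by (intro sum.cong refl mmul_cong) (use assms in auto)
  finally show ?thesis by (simp add: mmul_mdelta_right)
qed

lemma mpow_bidiag_upper:
  "j < i \<Longrightarrow> mpow N (bidiag \<alpha> \<epsilon>) s i j = 0"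
  "i < N \<Longrightarrow> mpow N (bidiag \<alpha> \<epsilon>) s i i = \<alpha> i ^ s"
proof (induction s arbitrary: i j)
  case 0
  { case 1 then show ?case by (simp add: mdelta_def) }
  { case 2 then show ?case by (simp add: mdelta_def) }
next
  case (Suc s)
  { case 1
    have "bidiag \<alpha> \<epsilon> i k * mpow N (bidiag \<alpha> \<epsilon>) s k j = 0" for k
    proof (cases "k < i")
      case True
      then show ?thesis by (simp add: bidiag_def)
    next
      case False
      then show ?thesis using 1 Suc(1)[of j k] by simp
    qed
    then show ?case by (simp add: mmul_def) }
  { case 2
    have "mmul N (bidiag \<alpha> \<epsilon>) (mpow N (bidiag \<alpha> \<epsilon>) s) i i =
        (\<Sum>k<N. if k = i then \<alpha> i * mpow N (bidiag \<alpha> \<epsilon>) s i i else 0)"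
      unfolding mmul_def by (intro sum.cong) (auto simp: bidiag_def Suc(1))
    then show ?case using 2 Suc(2)[of i] by simp }
qed

lemma trace_mpow:
  fixes a :: "nat \<Rightarrow> nat \<Rightarrow> 'r::comm_semiring_1"
  assumes PQ: "\<And>i j. i < N \<Longrightarrow> j < N \<Longrightarrow> mmul N P Q i j = mdelta i j"
    and QP: "\<And>i j. i < N \<Longrightarrow> j < N \<Longrightarrow> mmul N Q P i j = mdelta i j"
    and a: "\<And>i j. i < N \<Longrightarrow> j < N \<Longrightarrow> a i j = mmul N P (mmul N (bidiag \<alpha> \<epsilon>) Q) i j"
  shows "(\<Sum>i<N. mpow N a s i i) = (\<Sum>i<N. \<alpha> i ^ s)"
proof -
  let ?J = "bidiag \<alpha> \<epsilon>"
  have pow: "i < N \<Longrightarrow> j < N \<Longrightarrow> mpow N a s i j = mmul N P (mmul N (mpow N ?J s) Q) i j" for i j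
  proof (induction s arbitrary: i j)
    case 0
    have "mmul N P (mmul N mdelta Q) i j = mmul N P Q i j"
      by (rule mmul_cong) (simp_all add: mmul_mdelta_left)
    then show ?case using PQ 0 by simp
  next
    case (Suc s)
    have "mpow N a (Suc s) i j = mmul N (mmul N P (mmul N ?J Q)) (mmul N P (mmul N (mpow N ?J s) Q)) i j"
      unfolding mpow.simps by (rule mmul_cong) (use Suc a in auto)
    also have "\<dots> = mmul N (mmul N P ?J) (mmul N (mmul N Q P) (mmul N (mpow N ?J s) Q)) i j"
      by (simp add: mmul_assoc)
    also have "\<dots> = mmul N (mmul N P ?J) (mmul N (mpow N ?J s) Q) i j"
    proof (rule mmul_cong[OF refl])
      fix k assume k: "k < N"
      have "mmul N (mmul N Q P) (mmul N (mpow N ?J s) Q) k j = mmul N mdelta (mmul N (mpow N ?J s) Q) k j"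
        by (rule mmul_cong) (use QP k in auto)
      then show "mmul N (mmul N Q P) (mmul N (mpow N ?J s) Q) k j = mmul N (mpow N ?J s) Q k j"
        using k by (simp add: mmul_mdelta_left)
    qed
    finally show ?case by (simp add: mmul_assoc)
  qed
  then have "(\<Sum>i<N. mpow N a s i i) = (\<Sum>i<N. mmul N P (mmul N (mpow N ?J s) Q) i i)" by simp
  also have "\<dots> = (\<Sum>i<N. mpow N ?J s i i)" by (rule trace_conjugate) (rule QP)
  finally show ?thesis by (simp add: mpow_bidiag_upper(2))
qed


section \<open>Integrals of quaternion-valued functions\<close>

text \<open>Numbering the coordinates turns statements about all four into bounded sums; past index
  3 the list lookup says nothing, hence the conditions \<open>l < 4\<close>.\<close>

definition qcomp :: "nat \<Rightarrow> cquat \<Rightarrow> complex" where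
  "qcomp l q = [qs q, qx q, qy q, qz q] ! l"

definition qunit :: "nat \<Rightarrow> cquat" where
  "qunit l = [CQuat 1 0 0 0, CQuat 0 1 0 0, CQuat 0 0 1 0, CQuat 0 0 0 1] ! l"

lemma all_less_4: "(\<forall>l<4. P l) \<longleftrightarrow> P 0 \<and> P 1 \<and> P 2 \<and> P (3::nat)"
  by (simp add: numeral_eq_Suc All_less_Suc) blast

lemma sum_less_4: "(\<Sum>l<4. f l) = f 0 + f 1 + f 2 + f (3::nat)"
  by (simp add: numeral_eq_Suc)

lemma qcomp_simps [simp]:
  "qcomp 0 q = qs q" "qcomp 1 q = qx q" "qcomp (Suc 0) q = qx q" "qcomp 2 q = qy q" "qcomp 3 q = qz q"
  by (simp_all add: qcomp_def)

lemma qunit_simps [simp]: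
  "qunit 0 = CQuat 1 0 0 0" "qunit 1 = CQuat 0 1 0 0" "qunit (Suc 0) = CQuat 0 1 0 0"
  "qunit 2 = CQuat 0 0 1 0" "qunit 3 = CQuat 0 0 0 1"
  by (simp_all add: qunit_def)

lemma cquat_sel_simps [simp]:
  "qs (p + q) = qs p + qs q" "qx (p + q) = qx p + qx q"
  "qy (p + q) = qy p + qy q" "qz (p + q) = qz p + qz q"
  "qs (- p) = - qs p" "qx (- p) = - qx p" "qy (- p) = - qy p" "qz (- p) = - qz p"
  "qs 0 = 0" "qx 0 = 0" "qy 0 = 0" "qz 0 = 0"
  "qs 1 = 1" "qx 1 = 0" "qy 1 = 0" "qz 1 = 0"
  "qs (cquat_of_complex c) = c" "qx (cquat_of_complex c) = 0"
  "qy (cquat_of_complex c) = 0" "qz (cquat_of_complex c) = 0"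
  "qs (cquat_of_complex c * p) = c * qs p" "qx (cquat_of_complex c * p) = c * qx p"
  "qy (cquat_of_complex c * p) = c * qy p" "qz (cquat_of_complex c * p) = c * qz p"
  by (simp_all add: plus_cquat_def uminus_cquat_def zero_cquat_def one_cquat_def cquat_of_complex_def times_cquat_def)

lemma qs_sum: "qs (sum f A) = (\<Sum>x\<in>A. qs (f x))"
  by (induction A rule: infinite_finite_induct) simp_all

lemma qs_mult_commute: "qs (p * q) = qs (q * p)"
  by (simp add: times_cquat_def algebra_simps)

lemma cquat_of_complex_mult: "cquat_of_complex (a * b) = cquat_of_complex a * cquat_of_complex b"
  by (simp add: cquat_of_complex_def times_cquat_def)

lemma cquat_of_complex_0 [simp]: "cquat_of_complex 0 = 0"
  by (simp add: cquat_of_complex_def zero_cquat_def)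

lemma cquat_of_complex_1 [simp]: "cquat_of_complex 1 = 1"
  by (simp add: cquat_of_complex_def one_cquat_def)

lemma cquat_of_complex_commute: "q * cquat_of_complex c = cquat_of_complex c * q"
  by (simp add: cquat_of_complex_def times_cquat_def mult.commute)

lemma qconj_simps:
  "qconj (p + q) = qconj p + qconj q" "qconj 0 = 0" "qconj (p * q) = qconj q * qconj p"
  "qconj (cquat_of_complex c * p) = cquat_of_complex c * qconj p"
  by (simp_all add: qconj_def plus_cquat_def zero_cquat_def times_cquat_def cquat_of_complex_def
      algebra_simps)

lemma scalar_if_qconj_eq: "qconj q = q \<Longrightarrow> q = cquat_of_complex (qs q)"
  by (cases q) (simp add: qconj_def cquat_of_complex_def)

lemma qcomp_add: "l < 4 \<Longrightarrow> qcomp l (p + q) = qcomp l p + qcomp l q"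
  using all_less_4[of "\<lambda>l. qcomp l (p + q) = qcomp l p + qcomp l q"] by simp

lemma qcomp_scale: "l < 4 \<Longrightarrow> qcomp l (cquat_of_complex c * q) = c * qcomp l q"
  using all_less_4[of "\<lambda>l. qcomp l (cquat_of_complex c * q) = c * qcomp l q"] by simp

lemma cquat_expand: "q = (\<Sum>l<4. cquat_of_complex (qcomp l q) * qunit l)"
  unfolding sum_less_4
  by (simp add: cquat_eq_iff)

section \<open>Componentwise integration of quaternions\<close>

definition qintegrable :: "'b measure \<Rightarrow> ('b \<Rightarrow> cquat) \<Rightarrow> bool" where
  "qintegrable M F \<longleftrightarrow> (\<forall>l<4. integrable M (\<lambda>x. qcomp l (F x)))"

definition qint :: "'b measure \<Rightarrow> ('b \<Rightarrow> cquat) \<Rightarrow> cquat" where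
  "qint M F = (\<Sum>l<4. cquat_of_complex (LINT x|M. qcomp l (F x)) * qunit l)"

lemma sel_qint:
  "qs (qint M F) = (LINT x|M. qs (F x))" "qx (qint M F) = (LINT x|M. qx (F x))"
  "qy (qint M F) = (LINT x|M. qy (F x))" "qz (qint M F) = (LINT x|M. qz (F x))"
  unfolding qint_def sum_less_4 by simp_all

lemma qcomp_qint: "l < 4 \<Longrightarrow> qcomp l (qint M F) = (LINT x|M. qcomp l (F x))"
proof -
  have "\<forall>l<4. qcomp l (qint M F) = (LINT x|M. qcomp l (F x))"
    unfolding all_less_4 qint_def sum_less_4 by simp
  then show "l < 4 \<Longrightarrow> ?thesis" by blast
qed

lemma cquat_eqI: "(\<And>l. l < 4 \<Longrightarrow> qcomp l p = qcomp l q) \<Longrightarrow> p = q"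
  using cquat_expand[of p] cquat_expand[of q] by simp

lemma qint_cong:
  "(\<And>x. x \<in> space M \<Longrightarrow> F x = G x) \<Longrightarrow> qint M F = qint M G"
  unfolding qint_def by (intro sum.cong refl arg_cong2[where f="(*)"] arg_cong[where f=cquat_of_complex] Bochner_Integration.integral_cong) auto

lemma qintegrable_scale:
  "integrable M h \<Longrightarrow> qintegrable M (\<lambda>x. cquat_of_complex (h x) * q)"
  by (simp add: qintegrable_def qcomp_scale)

lemma qint_scale:
  "integrable M h \<Longrightarrow> qint M (\<lambda>x. cquat_of_complex (h x) * q) = cquat_of_complex (integral\<^sup>L M h) * q"
  by (rule cquat_eqI) (simp add: qcomp_qint qcomp_scale)

lemma qcomp_sum: "l < 4 \<Longrightarrow> qcomp l (sum f A) = (\<Sum>x\<in>A. qcomp l (f x))"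
proof -
  assume l: "l < 4"
  have "qcomp l 0 = 0" using l all_less_4[of "\<lambda>l. qcomp l 0 = 0"] by simp
  then show ?thesis
    by (induction A rule: infinite_finite_induct) (simp_all add: qcomp_add[OF l])
qed

lemma qintegrable_sum:
  "(\<And>i. i \<in> A \<Longrightarrow> qintegrable M (F i)) \<Longrightarrow> qintegrable M (\<lambda>x. \<Sum>i\<in>A. F i x)"
  by (simp add: qintegrable_def qcomp_sum)

lemma qint_sum:
  "(\<And>i. i \<in> A \<Longrightarrow> qintegrable M (F i)) \<Longrightarrow> qint M (\<lambda>x. \<Sum>i\<in>A. F i x) = (\<Sum>i\<in>A. qint M (F i))"
  by (rule cquat_eqI)
    (simp add: qcomp_qint qcomp_sum qintegrable_def Bochner_Integration.integral_sum)

lemma qint_qconj: "qint M (\<lambda>x. qconj (F x)) = qconj (qint M F)"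
proof (rule cquat_eqI)
  fix l :: nat assume "l < 4"
  have "\<forall>l<4. qcomp l (qint M (\<lambda>x. qconj (F x))) = qcomp l (qconj (qint M F))"
    by (simp add: all_less_4 sel_qint qconj_def)
  then show "qcomp l (qint M (\<lambda>x. qconj (F x))) = qcomp l (qconj (qint M F))"
    using \<open>l < 4\<close> by blast
qed

text \<open>Products are expanded in the basis \<open>1, i, j, k\<close>, so that only complex integrands occur.\<close>

lemma cquat_mult_const_expand:
  "p * c * q = (\<Sum>l<4. \<Sum>m<4. cquat_of_complex (qcomp l p * qcomp m q) * (qunit l * c * qunit m))"
proof -
  have s: "(cquat_of_complex a * x) * c * (cquat_of_complex b * y) = cquat_of_complex (a * b) * (x * c * y)"
    for a b x y
    by (simp add: cquat_eq_iff times_cquat_def cquat_of_complex_def algebra_simps)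
  have "p * c * q = (\<Sum>l<4. cquat_of_complex (qcomp l p) * qunit l) * c *
      (\<Sum>m<4. cquat_of_complex (qcomp m q) * qunit m)"
    using cquat_expand[of p] cquat_expand[of q] by simp
  then show ?thesis by (simp only: sum_distrib_left sum_distrib_right s) (rule sum.swap)
qed

lemma cquat_mult_expand:
  "p * q = (\<Sum>l<4. \<Sum>m<4. cquat_of_complex (qcomp l p * qcomp m q) * (qunit l * qunit m))"
  using cquat_mult_const_expand[of p 1 q] by simp

lemma cquat_scale_middle:
  "p * (cquat_of_complex g * e) * q = p * e * q * cquat_of_complex g"
  by (simp add: cquat_eq_iff times_cquat_def cquat_of_complex_def algebra_simps)

lemma cquat_expand_middle:
  "p * c * q = (\<Sum>l<4. p * qunit l * q * cquat_of_complex (qcomp l c))"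
  using arg_cong[OF cquat_expand[of c], of "\<lambda>c. p * c * q"]
  by (simp only: sum_distrib_left sum_distrib_right cquat_scale_middle)

text \<open>The constant \<open>c\<close> cannot be moved from its place, so the outer factors are
  expanded in the basis. Integrability is asked of products of components, which is what two
  square-integrable factors provide.\<close>

lemma qint_sandwich:
  assumes "\<And>l m. l < 4 \<Longrightarrow> m < 4 \<Longrightarrow> integrable M (\<lambda>x. qcomp l (F x) * qcomp m (G x))"
  shows "qintegrable M (\<lambda>x. F x * c * G x)"
    and "qint M (\<lambda>x. F x * c * G x) = (\<Sum>l<4. \<Sum>m<4.
      cquat_of_complex (LINT x|M. qcomp l (F x) * qcomp m (G x)) * (qunit l * c * qunit m))"
proof -
  show "qintegrable M (\<lambda>x. F x * c * G x)"
    unfolding cquat_mult_const_expand[of "F _" c "G _"]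
    by (intro qintegrable_sum qintegrable_scale assms) auto
  show "qint M (\<lambda>x. F x * c * G x) = (\<Sum>l<4. \<Sum>m<4.
      cquat_of_complex (LINT x|M. qcomp l (F x) * qcomp m (G x)) * (qunit l * c * qunit m))"
  proof -
    let ?f = "\<lambda>l m x. cquat_of_complex (qcomp l (F x) * qcomp m (G x)) * (qunit l * c * qunit m)"
    have i: "qintegrable M (?f l m)" if "l < 4" "m < 4" for l m
      by (rule qintegrable_scale) (rule assms[OF that])
    have "qint M (\<lambda>x. F x * c * G x) = qint M (\<lambda>x. \<Sum>l<4. \<Sum>m<4. ?f l m x)"
      unfolding cquat_mult_const_expand[of "F _" c "G _"] ..
    also have "\<dots> = (\<Sum>l<4. qint M (\<lambda>x. \<Sum>m<4. ?f l m x))"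
      by (rule qint_sum) (intro qintegrable_sum i, auto)
    also have "\<dots> = (\<Sum>l<4. \<Sum>m<4. qint M (?f l m))"
      by (intro sum.cong refl qint_sum i) auto
    also have "\<dots> = (\<Sum>l<4. \<Sum>m<4.
        cquat_of_complex (LINT x|M. qcomp l (F x) * qcomp m (G x)) * (qunit l * c * qunit m))"
      by (intro sum.cong refl qint_scale assms) auto
    finally show ?thesis .
  qed
qed

lemma integrable_mult_square_integrable:
  fixes f g :: "'b \<Rightarrow> complex"
  assumes "f \<in> borel_measurable M" "g \<in> borel_measurable M"
    and "integrable M (\<lambda>x. (cmod (f x))\<^sup>2)" "integrable M (\<lambda>x. (cmod (g x))\<^sup>2)"
  shows "integrable M (\<lambda>x. f x * g x)"
proof (rule Bochner_Integration.integrable_bound)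
  show "integrable M (\<lambda>x. (cmod (f x))\<^sup>2 + (cmod (g x))\<^sup>2)"
    using assms by simp
  show "AE x in M. norm (f x * g x) \<le> norm ((cmod (f x))\<^sup>2 + (cmod (g x))\<^sup>2)"
  proof (rule AE_I2)
    fix x
    have "2 * (cmod (f x) * cmod (g x)) \<le> (cmod (f x))\<^sup>2 + (cmod (g x))\<^sup>2"
      using sum_squares_bound[of "cmod (f x)" "cmod (g x)"] by simp
    moreover have "0 \<le> cmod (f x) * cmod (g x)" by simp
    ultimately have "cmod (f x) * cmod (g x) \<le> (cmod (f x))\<^sup>2 + (cmod (g x))\<^sup>2" by linarith
    then show "norm (f x * g x) \<le> norm ((cmod (f x))\<^sup>2 + (cmod (g x))\<^sup>2)"
      by (simp add: norm_mult)
  qed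
qed (use assms in measurable)

lemma square_integrable_qcomp:
  assumes "square_integrable_quat \<mu> u" and "l < 4"
  shows "(\<lambda>x. qcomp l (u x)) \<in> borel_measurable \<mu>" and "integrable \<mu> (\<lambda>x. (cmod (qcomp l (u x)))\<^sup>2)"
proof -
  have "\<forall>l<4. (\<lambda>x. qcomp l (u x)) \<in> borel_measurable \<mu> \<and> integrable \<mu> (\<lambda>x. (cmod (qcomp l (u x)))\<^sup>2)"
    unfolding all_less_4 using assms(1) by (simp add: square_integrable_quat_def)
  then show "(\<lambda>x. qcomp l (u x)) \<in> borel_measurable \<mu>" and "integrable \<mu> (\<lambda>x. (cmod (qcomp l (u x)))\<^sup>2)"
    using assms(2) by auto
qed

lemma integrable_qcomp_mult:
  assumes "square_integrable_quat \<mu> u" "square_integrable_quat \<mu> v" "l < 4" "m < 4"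
  shows "integrable \<mu> (\<lambda>x. qcomp l (u x) * qcomp m (v x))"
  by (intro integrable_mult_square_integrable square_integrable_qcomp assms)

text \<open>Fubini's theorem. Dependence on separate coordinates is expressed as invariance under
  \<open>restrict\<close>, so that one function on tuples can be integrated over different index
  sets.\<close>

lemma integral_mult_disjoint:
  fixes f g :: "('i \<Rightarrow> 'a) \<Rightarrow> complex"
  assumes sf: "sigma_finite_measure \<mu>" and fin: "finite I" "finite J" and IJ: "I \<inter> J = {}"
    and dep: "\<And>x. f (restrict x I) = f x" "\<And>x. g (restrict x J) = g x"
    and f: "integrable (Pi\<^sub>M I (\<lambda>_. \<mu>)) f" and g: "integrable (Pi\<^sub>M J (\<lambda>_. \<mu>)) g"
  shows "integrable (Pi\<^sub>M (I \<union> J) (\<lambda>_. \<mu>)) (\<lambda>x. f x * g x)"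
    and "(LINT x|Pi\<^sub>M (I \<union> J) (\<lambda>_. \<mu>). f x * g x) =
      (LINT x|Pi\<^sub>M I (\<lambda>_. \<mu>). f x) * (LINT x|Pi\<^sub>M J (\<lambda>_. \<mu>). g x)"
proof -
  interpret product_sigma_finite "\<lambda>_::'i. \<mu>" by (simp add: product_sigma_finite_def sf)
  let ?P = "\<lambda>I. Pi\<^sub>M I (\<lambda>_. \<mu>)"
  interpret I: sigma_finite_measure "?P I" by (rule sigma_finite) fact
  interpret J: sigma_finite_measure "?P J" by (rule sigma_finite) fact
  interpret IJ: pair_sigma_finite "?P I" "?P J" ..
  have m[measurable]: "f \<in> borel_measurable (?P I)" "g \<in> borel_measurable (?P J)"
    using f g by auto
  have "integrable (?P I) (\<lambda>x. (LINT y|?P J. norm (f x * g y)))"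
    using f by (simp add: norm_mult)
  then have fg: "integrable (?P I \<Otimes>\<^sub>M ?P J) (\<lambda>(x, y). f x * g y)"
    using g by (intro IJ.Fubini_integrable) (auto simp: norm_mult)
  have merge: "f (merge I J (x, y)) = f x" "g (merge I J (x, y)) = g y" for x y
    using dep(1)[of "merge I J (x, y)"] dep(2)[of "merge I J (x, y)"] dep(1)[of x] dep(2)[of y] IJ
    by (simp_all add: Int_commute)
  have restr: "(\<lambda>x. restrict x I) \<in> measurable (?P (I \<union> J)) (?P I)"
    "(\<lambda>x. restrict x J) \<in> measurable (?P (I \<union> J)) (?P J)"
    by (auto intro: measurable_restrict_subset)
  have meas: "(\<lambda>x. f x * g x) \<in> borel_measurable (?P (I \<union> J))"
    using measurable_compose[OF restr(1) m(1)] measurable_compose[OF restr(2) m(2)]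
    by (simp add: dep)
  have eq: "(\<lambda>z. f (merge I J z) * g (merge I J z)) = (\<lambda>(x, y). f x * g y)"
    by (auto simp: merge)
  have "integrable (distr (?P I \<Otimes>\<^sub>M ?P J) (?P (I \<union> J)) (merge I J)) (\<lambda>x. f x * g x)"
    by (subst integrable_distr_eq) (use fg eq meas in auto)
  then show *: "integrable (?P (I \<union> J)) (\<lambda>x. f x * g x)"
    by (simp add: distr_merge[OF IJ fin])
  show "(LINT x|?P (I \<union> J). f x * g x) = (LINT x|?P I. f x) * (LINT x|?P J. g x)"
    by (subst product_integral_fold[OF IJ fin *]) (simp add: merge)
qed

lemma qint_mult_disjoint:
  assumes sf: "sigma_finite_measure \<mu>" and fin: "finite I" "finite J" and IJ: "I \<inter> J = {}"
    and dep: "\<And>x. F (restrict x I) = F x" "\<And>x. G (restrict x J) = G x"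
    and F: "qintegrable (Pi\<^sub>M I (\<lambda>_. \<mu>)) F" and G: "qintegrable (Pi\<^sub>M J (\<lambda>_. \<mu>)) G"
  shows "qintegrable (Pi\<^sub>M (I \<union> J) (\<lambda>_. \<mu>)) (\<lambda>x. F x * G x)"
    and "qint (Pi\<^sub>M (I \<union> J) (\<lambda>_. \<mu>)) (\<lambda>x. F x * G x) =
      qint (Pi\<^sub>M I (\<lambda>_. \<mu>)) F * qint (Pi\<^sub>M J (\<lambda>_. \<mu>)) G"
proof -
  have FG: "integrable (Pi\<^sub>M I (\<lambda>_. \<mu>)) (\<lambda>x. qcomp l (F x))" "integrable (Pi\<^sub>M J (\<lambda>_. \<mu>)) (\<lambda>x. qcomp l (G x))"
    if "l < 4" for l
    using F G that by (auto simp: qintegrable_def)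
  note dis = integral_mult_disjoint[OF sf fin IJ _ _ FG]
  have i: "integrable (Pi\<^sub>M (I \<union> J) (\<lambda>_. \<mu>)) (\<lambda>x. qcomp l (F x) * qcomp m (G x))"
    if "l < 4" "m < 4" for l m by (rule dis(1)) (simp_all add: dep that)
  have e: "(LINT x|Pi\<^sub>M (I \<union> J) (\<lambda>_. \<mu>). qcomp l (F x) * qcomp m (G x)) =
      qcomp l (qint (Pi\<^sub>M I (\<lambda>_. \<mu>)) F) * qcomp m (qint (Pi\<^sub>M J (\<lambda>_. \<mu>)) G)"
    if "l < 4" "m < 4" for l m
    using dis(2)[of l m] by (simp add: dep that qcomp_qint)
  show "qintegrable (Pi\<^sub>M (I \<union> J) (\<lambda>_. \<mu>)) (\<lambda>x. F x * G x)"
    using qint_sandwich(1)[of "Pi\<^sub>M (I \<union> J) (\<lambda>_. \<mu>)" F G 1, OF i] by simp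
  show "qint (Pi\<^sub>M (I \<union> J) (\<lambda>_. \<mu>)) (\<lambda>x. F x * G x) =
      qint (Pi\<^sub>M I (\<lambda>_. \<mu>)) F * qint (Pi\<^sub>M J (\<lambda>_. \<mu>)) G"
    using qint_sandwich(2)[of "Pi\<^sub>M (I \<union> J) (\<lambda>_. \<mu>)" F G 1, OF i]
    unfolding cquat_mult_expand[of "qint (Pi\<^sub>M I (\<lambda>_. \<mu>)) F"] by (simp add: e)
qed

text \<open>\<open>F\<close> and \<open>H\<close> share variables and enclose \<open>G\<close>, so
  they cannot be split apart. Expanding \<open>G\<close> in the basis leaves complex coefficients,
  which can be moved aside for Fubini; summing up again puts the integral of \<open>G\<close> back
  into the middle.\<close>

lemma qint_sandwich_disjoint:
  assumes sf: "sigma_finite_measure \<mu>" and fin: "finite I" "finite J" and IJ: "I \<inter> J = {}"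
    and dep: "\<And>x. F (restrict x I) = F x" "\<And>x. H (restrict x I) = H x" "\<And>x. G (restrict x J) = G x"
    and FH: "\<And>l m. l < 4 \<Longrightarrow> m < 4 \<Longrightarrow> integrable (Pi\<^sub>M I (\<lambda>_. \<mu>)) (\<lambda>x. qcomp l (F x) * qcomp m (H x))"
    and G: "qintegrable (Pi\<^sub>M J (\<lambda>_. \<mu>)) G"
  shows "qintegrable (Pi\<^sub>M (I \<union> J) (\<lambda>_. \<mu>)) (\<lambda>x. F x * G x * H x)"
    and "qint (Pi\<^sub>M (I \<union> J) (\<lambda>_. \<mu>)) (\<lambda>x. F x * G x * H x) =
      qint (Pi\<^sub>M I (\<lambda>_. \<mu>)) (\<lambda>x. F x * qint (Pi\<^sub>M J (\<lambda>_. \<mu>)) G * H x)"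
proof -
  have exp: "F x * G x * H x = (\<Sum>l<4. F x * qunit l * H x * cquat_of_complex (qcomp l (G x)))" for x
    by (rule cquat_expand_middle)
  let ?c = "qint (Pi\<^sub>M J (\<lambda>_. \<mu>)) G"
  have Gl: "qintegrable (Pi\<^sub>M J (\<lambda>_. \<mu>)) (\<lambda>x. cquat_of_complex (qcomp l (G x)))"
    and Gi: "qint (Pi\<^sub>M J (\<lambda>_. \<mu>)) (\<lambda>x. cquat_of_complex (qcomp l (G x))) = cquat_of_complex (qcomp l ?c)"
    if "l < 4" for l
    using G qintegrable_scale[of _ "\<lambda>x. qcomp l (G x)" 1] qint_scale[of _ "\<lambda>x. qcomp l (G x)" 1] that
    by (simp_all add: qintegrable_def qcomp_qint)
  note FlH = qint_sandwich[of "Pi\<^sub>M I (\<lambda>_. \<mu>)" F H, OF FH]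
  note dis = qint_mult_disjoint[OF sf fin IJ _ _ FlH(1) Gl]
  have i: "qintegrable (Pi\<^sub>M (I \<union> J) (\<lambda>_. \<mu>)) (\<lambda>x. F x * qunit l * H x * cquat_of_complex (qcomp l (G x)))"
    if "l < 4" for l by (rule dis(1)) (simp_all add: dep that)
  have e: "qint (Pi\<^sub>M (I \<union> J) (\<lambda>_. \<mu>)) (\<lambda>x. F x * qunit l * H x * cquat_of_complex (qcomp l (G x))) =
      qint (Pi\<^sub>M I (\<lambda>_. \<mu>)) (\<lambda>x. F x * qunit l * H x) * cquat_of_complex (qcomp l ?c)"
    if "l < 4" for l
    by (rule trans[OF dis(2)]) (simp_all add: dep that Gi)
  show "qintegrable (Pi\<^sub>M (I \<union> J) (\<lambda>_. \<mu>)) (\<lambda>x. F x * G x * H x)"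
    unfolding exp by (intro qintegrable_sum i) simp
  have "qint (Pi\<^sub>M (I \<union> J) (\<lambda>_. \<mu>)) (\<lambda>x. F x * G x * H x) =
    (\<Sum>l<4. qint (Pi\<^sub>M I (\<lambda>_. \<mu>)) (\<lambda>x. F x * qunit l * H x) * cquat_of_complex (qcomp l ?c))"
    unfolding exp by (subst qint_sum) (simp_all add: i e)
  also have "\<dots> = (\<Sum>l<4. \<Sum>m<4. \<Sum>m'<4. cquat_of_complex (LINT x|Pi\<^sub>M I (\<lambda>_. \<mu>). qcomp m (F x) * qcomp m' (H x)) *
      (qunit m * qunit l * qunit m' * cquat_of_complex (qcomp l ?c)))"
    by (simp only: FlH(2) sum_distrib_right) (simp only: mult.assoc)
  also have "\<dots> = (\<Sum>m<4. \<Sum>l<4. \<Sum>m'<4. cquat_of_complex (LINT x|Pi\<^sub>M I (\<lambda>_. \<mu>). qcomp m (F x) * qcomp m' (H x)) *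
      (qunit m * qunit l * qunit m' * cquat_of_complex (qcomp l ?c)))"
    by (rule sum.swap)
  also have "\<dots> = (\<Sum>m<4. \<Sum>m'<4. \<Sum>l<4. cquat_of_complex (LINT x|Pi\<^sub>M I (\<lambda>_. \<mu>). qcomp m (F x) * qcomp m' (H x)) *
      (qunit m * qunit l * qunit m' * cquat_of_complex (qcomp l ?c)))"
    by (rule sum.cong[OF refl]) (rule sum.swap)
  also have "\<dots> = qint (Pi\<^sub>M I (\<lambda>_. \<mu>)) (\<lambda>x. F x * ?c * H x)"
    by (simp only: FlH(2) cquat_expand_middle[of "qunit _" ?c "qunit _"] sum_distrib_left)
  finally show "qint (Pi\<^sub>M (I \<union> J) (\<lambda>_. \<mu>)) (\<lambda>x. F x * G x * H x) =
      qint (Pi\<^sub>M I (\<lambda>_. \<mu>)) (\<lambda>x. F x * ?c * H x)" .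
qed

lemma qint_singleton:
  fixes i :: 'i
  assumes sf: "sigma_finite_measure \<mu>" and F: "qintegrable \<mu> F"
  shows "qintegrable (Pi\<^sub>M {i} (\<lambda>_. \<mu>)) (\<lambda>x. F (x i))"
    and "qint (Pi\<^sub>M {i} (\<lambda>_. \<mu>)) (\<lambda>x. F (x i)) = qint \<mu> F"
proof -
  interpret product_sigma_finite "\<lambda>_::'i. \<mu>" by (simp add: product_sigma_finite_def sf)
  have m: "integrable \<mu> (\<lambda>x. qcomp l (F x))" if "l < 4" for l
    using F that by (simp add: qintegrable_def)
  have "integrable (Pi\<^sub>M {i} (\<lambda>_. \<mu>)) (\<lambda>x. qcomp l (F (x i)))" if "l < 4" for l
    by (rule integrable_distr[of "\<lambda>x. x i" _ \<mu>]) (simp_all add: distr_singleton m[OF that])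
  then show "qintegrable (Pi\<^sub>M {i} (\<lambda>_. \<mu>)) (\<lambda>x. F (x i))" by (simp add: qintegrable_def)
  show "qint (Pi\<^sub>M {i} (\<lambda>_. \<mu>)) (\<lambda>x. F (x i)) = qint \<mu> F"
    using m by (intro cquat_eqI) (simp add: qcomp_qint product_integral_singleton[of "\<lambda>x. qcomp _ (F x)" i])
qed


section \<open>Moore-Dyson determinants of finite-rank kernels\<close>

text \<open>Self-duality is asked of the whole sum on \<open>space \<mu>\<close>; no relation
  between the individual \<open>u k\<close> and \<open>v k\<close> is presupposed.\<close>

locale quat_expansion = sigma_finite_measure \<mu> for \<mu> :: "'a measure" +
  fixes n :: nat and u v :: "nat \<Rightarrow> 'a \<Rightarrow> cquat"
  assumes u: "\<And>k. k < n \<Longrightarrow> square_integrable_quat \<mu> (u k)"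
    and v: "\<And>k. k < n \<Longrightarrow> square_integrable_quat \<mu> (v k)"
    and self_dual: "\<And>x y. x \<in> space \<mu> \<Longrightarrow> y \<in> space \<mu> \<Longrightarrow>
      (\<Sum>k<n. u k y * v k x) = qconj (\<Sum>k<n. u k x * v k y)"
begin

definition ker :: "'a \<Rightarrow> 'a \<Rightarrow> cquat" where
  "ker x y = (\<Sum>k<n. u k x * v k y)"

definition gram :: "nat \<Rightarrow> nat \<Rightarrow> cquat" where
  "gram k l = qint \<mu> (\<lambda>x. v k x * u l x)"

text \<open>The integral of a cycle of length \<open>s + 1\<close>: its base point keeps
  \<open>u k\<close> and \<open>v l\<close> at the two ends, and the \<open>s\<close> other points
  contribute the power of the Gram matrix.\<close>

definition cycle_int :: "nat \<Rightarrow> cquat" where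
  "cycle_int s = (\<Sum>k<n. \<Sum>l<n. qint \<mu> (\<lambda>x. u k x * mpow n gram s k l * v l x))"

text \<open>Half the trace of the power \<open>M\<^sup>s\<close> of the Gram matrix \<open>M\<close>, read as a complex matrix of size
  \<open>2 n\<close>.\<close>

definition half_trace :: "nat \<Rightarrow> complex" where
  "half_trace s = qs (\<Sum>k<n. mpow n gram s k k)"

text \<open>The kernel along a path splits as \<open>u\<^sub>k(x\<^sub>a) (v\<^sub>k u\<^sub>j)(x\<^sub>b) \<dots> v\<^sub>l(x\<^sub>c)\<close>; a chain collects the
  factors at the interior points.\<close>

primrec chain :: "('i \<Rightarrow> 'a) \<Rightarrow> 'i list \<Rightarrow> nat \<Rightarrow> nat \<Rightarrow> cquat" where
  "chain x [] = mdelta"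
| "chain x (a # l) = mmul n (\<lambda>k k'. v k (x a) * u k' (x a)) (chain x l)"

primrec path :: "('i \<Rightarrow> 'a) \<Rightarrow> 'i \<Rightarrow> 'i list \<Rightarrow> 'i \<Rightarrow> cquat" where
  "path x a [] c = ker (x a) (x c)"
| "path x a (b # l) c = ker (x a) (x b) * path x b l c"

lemma vu_integrable:
  assumes "k < n" "l < n"
  shows "qintegrable \<mu> (\<lambda>x. v k x * u l x)"
  using qint_sandwich(1)[of \<mu> "v k" "u l" 1, OF integrable_qcomp_mult] u v assms by simp

lemma chain_restrict: "chain (restrict x (set l)) l = chain x l"
proof -
  have "set l \<subseteq> S \<Longrightarrow> chain (restrict x S) l = chain x l" for S
    by (induction l) auto
  then show ?thesis by simp
qed

text \<open>Distinct points are independent variables, so integrating the factors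
  \<open>v k (x a) * u j (x a)\<close> point by point builds a matrix power. The empty chain is a
  constant on a one-point product space.\<close>

lemma qint_chain:
  fixes l :: "'i list"
  assumes "distinct l" "k < n" "k' < n"
  shows "qintegrable (Pi\<^sub>M (set l) (\<lambda>_. \<mu>)) (\<lambda>x. chain x l k k') \<and>
    qint (Pi\<^sub>M (set l) (\<lambda>_. \<mu>)) (\<lambda>x. chain x l k k') = mpow n gram (length l) k k'"
  using assms
proof (induction l arbitrary: k)
  case Nil
  have "qintegrable (Pi\<^sub>M {} (\<lambda>_::'i. \<mu>)) (\<lambda>x. q)" for q
    by (simp add: qintegrable_def PiM_empty integrable_count_space)
  moreover have "qint (Pi\<^sub>M {} (\<lambda>_::'i. \<mu>)) (\<lambda>x. q) = q" for q
    by (rule cquat_eqI) (simp add: qcomp_qint PiM_empty lebesgue_integral_count_space_finite)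
  ultimately show ?case by simp
next
  case (Cons a l)
  have fin: "finite {a}" "finite (set l)" and dis: "{a} \<inter> set l = {}" using Cons.prems by auto
  have s: "qintegrable (Pi\<^sub>M {a} (\<lambda>_. \<mu>)) (\<lambda>x. v k (x a) * u j (x a))"
    "qint (Pi\<^sub>M {a} (\<lambda>_. \<mu>)) (\<lambda>x. v k (x a) * u j (x a)) = gram k j" if "j < n" for j
    using qint_singleton[OF sigma_finite_measure_axioms vu_integrable[OF Cons.prems(2) that], of a]
    by (simp_all add: gram_def)
  have IH: "qintegrable (Pi\<^sub>M (set l) (\<lambda>_. \<mu>)) (\<lambda>x. chain x l j k')"
    "qint (Pi\<^sub>M (set l) (\<lambda>_. \<mu>)) (\<lambda>x. chain x l j k') = mpow n gram (length l) j k'" if "j < n" for j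
    using Cons that by auto
  note m = qint_mult_disjoint[OF sigma_finite_measure_axioms fin dis _ _ s(1) IH(1), unfolded s(2) IH(2)]
  have p: "qintegrable (Pi\<^sub>M (set (a # l)) (\<lambda>_. \<mu>)) (\<lambda>x. v k (x a) * u j (x a) * chain x l j k')"
    "qint (Pi\<^sub>M (set (a # l)) (\<lambda>_. \<mu>)) (\<lambda>x. v k (x a) * u j (x a) * chain x l j k') =
      gram k j * mpow n gram (length l) j k'" if "j < n" for j
    using m[of j j] that by (simp_all add: chain_restrict s(2) IH(2))
  have "qintegrable (Pi\<^sub>M (set (a # l)) (\<lambda>_. \<mu>)) (\<lambda>x. chain x (a # l) k k')"
    unfolding chain.simps mmul_def by (intro qintegrable_sum p(1)) auto
  moreover have "qint (Pi\<^sub>M (set (a # l)) (\<lambda>_. \<mu>)) (\<lambda>x. chain x (a # l) k k') =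
      (\<Sum>j<n. gram k j * mpow n gram (length l) j k')"
    unfolding chain.simps mmul_def
    by (subst qint_sum) (use p in \<open>auto intro!: sum.cong\<close>)
  ultimately show ?case by (simp add: mmul_def)
qed

lemma path_eq_chain:
  "path x a l c = (\<Sum>k<n. \<Sum>k'<n. u k (x a) * chain x l k k' * v k' (x c))"
proof (induction l arbitrary: a)
  case Nil
  have "(\<Sum>k'<n. u k (x a) * mdelta k k' * v k' (x c)) = u k (x a) * v k (x c)" if "k < n" for k
  proof -
    have "(\<Sum>k'<n. u k (x a) * mdelta k k' * v k' (x c)) =
      (\<Sum>k'<n. if k' = k then u k (x a) * v k (x c) else 0)"
      by (intro sum.cong) (auto simp: mdelta_def)
    then show ?thesis using that by simp
  qed
  then show ?case by (simp add: ker_def)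
next
  case (Cons b l)
  have "path x a (b # l) c =
    (\<Sum>k<n. \<Sum>j<n. \<Sum>k'<n. u k (x a) * (v k (x b) * u j (x b) * chain x l j k') * v k' (x c))"
    by (simp only: path.simps Cons ker_def sum_product) (simp add: sum_distrib_left mult.assoc)
  also have "\<dots> = (\<Sum>k<n. \<Sum>k'<n. \<Sum>j<n. u k (x a) * (v k (x b) * u j (x b) * chain x l j k') * v k' (x c))"
    by (rule sum.cong[OF refl]) (rule sum.swap)
  also have "\<dots> = (\<Sum>k<n. \<Sum>k'<n. u k (x a) * chain x (b # l) k k' * v k' (x c))"
    by (simp add: mmul_def sum_distrib_left sum_distrib_right)
  finally show ?case .
qed

lemma uv_integrable_singleton:
  assumes "k < n" "k' < n" "l < 4" "m < 4"
  shows "integrable (Pi\<^sub>M {a} (\<lambda>_. \<mu>)) (\<lambda>x. qcomp l (u k (x a)) * qcomp m (v k' (x a)))"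
proof -
  interpret product_sigma_finite "\<lambda>_. \<mu>"
    by (simp add: product_sigma_finite_def sigma_finite_measure_axioms)
  show ?thesis
    by (rule integrable_distr[of "\<lambda>x. x a" _ \<mu> "\<lambda>y. qcomp l (u k y) * qcomp m (v k' y)"])
      (simp_all add: distr_singleton integrable_qcomp_mult u v assms)
qed

text \<open>In a closed path the base point occurs in the first and in the last factor; the chain
  through the other points is integrated inside this sandwich, and only its length matters.\<close>

lemma qint_path:
  assumes "distinct (a # l)"
  shows "qintegrable (Pi\<^sub>M (set (a # l)) (\<lambda>_. \<mu>)) (\<lambda>x. path x a l a)"
    and "qint (Pi\<^sub>M (set (a # l)) (\<lambda>_. \<mu>)) (\<lambda>x. path x a l a) = cycle_int (length l)"
proof -
  have fin: "finite {a}" "finite (set l)" and dis: "{a} \<inter> set l = {}" and l: "distinct l"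
    using assms by auto
  have c: "qintegrable (Pi\<^sub>M (set l) (\<lambda>_. \<mu>)) (\<lambda>x. chain x l k k')"
    "qint (Pi\<^sub>M (set l) (\<lambda>_. \<mu>)) (\<lambda>x. chain x l k k') = mpow n gram (length l) k k'"
    if "k < n" "k' < n" for k k'
    using qint_chain[OF l that] by auto
  have i: "qintegrable (Pi\<^sub>M (set (a # l)) (\<lambda>_. \<mu>)) (\<lambda>x. u k (x a) * chain x l k k' * v k' (x a))"
    and e: "qint (Pi\<^sub>M (set (a # l)) (\<lambda>_. \<mu>)) (\<lambda>x. u k (x a) * chain x l k k' * v k' (x a)) =
      qint \<mu> (\<lambda>x. u k x * mpow n gram (length l) k k' * v k' x)"
    if "k < n" "k' < n" for k k'
  proof -
    have "qintegrable \<mu> (\<lambda>x. u k x * mpow n gram (length l) k k' * v k' x)"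
      by (rule qint_sandwich(1)) (intro integrable_qcomp_mult u v that)
    note s = qint_singleton(2)[OF sigma_finite_measure_axioms this, of a]
    note sw = qint_sandwich_disjoint[OF sigma_finite_measure_axioms fin dis,
        of "\<lambda>x. u k (x a)" "\<lambda>x. v k' (x a)" "\<lambda>x. chain x l k k'"]
    have U: "{a} \<union> set l = set (a # l)" by simp
    show "qintegrable (Pi\<^sub>M (set (a # l)) (\<lambda>_. \<mu>)) (\<lambda>x. u k (x a) * chain x l k k' * v k' (x a))"
      unfolding U[symmetric]
      by (rule sw(1)) (simp_all add: chain_restrict uv_integrable_singleton that c)
    show "qint (Pi\<^sub>M (set (a # l)) (\<lambda>_. \<mu>)) (\<lambda>x. u k (x a) * chain x l k k' * v k' (x a)) =
      qint \<mu> (\<lambda>x. u k x * mpow n gram (length l) k k' * v k' x)"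
    proof -
      have "qint (Pi\<^sub>M ({a} \<union> set l) (\<lambda>_. \<mu>)) (\<lambda>x. u k (x a) * chain x l k k' * v k' (x a)) =
        qint (Pi\<^sub>M {a} (\<lambda>_. \<mu>)) (\<lambda>x. u k (x a) * qint (Pi\<^sub>M (set l) (\<lambda>_. \<mu>)) (\<lambda>x. chain x l k k') * v k' (x a))"
        by (rule sw(2)) (simp_all add: chain_restrict uv_integrable_singleton that c(1))
      then show ?thesis unfolding U c(2)[OF that] s .
    qed
  qed
  show "qintegrable (Pi\<^sub>M (set (a # l)) (\<lambda>_. \<mu>)) (\<lambda>x. path x a l a)"
    unfolding path_eq_chain by (intro qintegrable_sum i) auto
  have "qint (Pi\<^sub>M (set (a # l)) (\<lambda>_. \<mu>)) (\<lambda>x. path x a l a) =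
    (\<Sum>k<n. qint (Pi\<^sub>M (set (a # l)) (\<lambda>_. \<mu>)) (\<lambda>x. \<Sum>k'<n. u k (x a) * chain x l k k' * v k' (x a)))"
    unfolding path_eq_chain by (rule qint_sum) (intro qintegrable_sum i, auto)
  also have "\<dots> = (\<Sum>k<n. \<Sum>k'<n. qint (Pi\<^sub>M (set (a # l)) (\<lambda>_. \<mu>)) (\<lambda>x. u k (x a) * chain x l k k' * v k' (x a)))"
    by (intro sum.cong refl qint_sum i) auto
  also have "\<dots> = cycle_int (length l)"
    unfolding cycle_int_def by (intro sum.cong refl e) auto
  finally show "qint (Pi\<^sub>M (set (a # l)) (\<lambda>_. \<mu>)) (\<lambda>x. path x a l a) = cycle_int (length l)" .
qed

lemma path_snoc: "path x a (l @ [b]) c = path x a l b * ker (x b) (x c)"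
  by (induction l arbitrary: a) (simp_all add: mult.assoc)

lemma qconj_ker: "x \<in> space \<mu> \<Longrightarrow> y \<in> space \<mu> \<Longrightarrow> qconj (ker x y) = ker y x"
  unfolding ker_def by (rule self_dual[symmetric])

lemma qconj_path:
  assumes "x a \<in> space \<mu>" "x c \<in> space \<mu>" "\<And>i. i \<in> set l \<Longrightarrow> x i \<in> space \<mu>"
  shows "qconj (path x a l c) = path x c (rev l) a"
  using assms
  by (induction l arbitrary: a)
    (simp_all add: path_snoc qconj_simps qconj_ker)

text \<open>Reversing a cycle conjugates its weight, so the integral of a cycle is scalar.\<close>

lemma cycle_int_scalar: "cycle_int s = cquat_of_complex (half_trace (Suc s))"
proof -
  obtain l where l: "distinct ((0::nat) # l)" "length l = s"
    by (rule that[of "[1..<Suc s]"]) auto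
  have l': "distinct (0 # rev l)" using l(1) by simp
  have "qconj (cycle_int s) = qconj (qint (Pi\<^sub>M (set (0 # l)) (\<lambda>_. \<mu>)) (\<lambda>x. path x 0 l 0))"
    unfolding qint_path(2)[OF l(1)] l(2) ..
  also have "\<dots> = qint (Pi\<^sub>M (set (0 # l)) (\<lambda>_. \<mu>)) (\<lambda>x. path x 0 (rev l) 0)"
    unfolding qint_qconj[symmetric]
    by (intro qint_cong qconj_path) (auto simp: space_PiM PiE_iff)
  also have "set (0 # l) = set (0 # rev l)" by simp
  also have "qint (Pi\<^sub>M (set (0 # rev l)) (\<lambda>_. \<mu>)) (\<lambda>x. path x 0 (rev l) 0) = cycle_int s"
    unfolding qint_path(2)[OF l'] using l(2) by simp
  finally have sc: "cycle_int s = cquat_of_complex (qs (cycle_int s))"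
    by (rule scalar_if_qconj_eq)
  \<comment> \<open>Only the scalar part is invariant under cyclic rotation of a quaternion product.
    Moving \<open>v l\<close> in front of \<open>u k\<close> under \<open>qs\<close> suffices, as
    the integral is already known to be scalar.\<close>
  have t: "qs (qint \<mu> (\<lambda>x. u k x * c * v l x)) = qs (c * gram l k)" if "k < n" "l < n" for k l c
  proof -
    have "qs (qint \<mu> (\<lambda>x. u k x * c * v l x)) = qs (qint \<mu> (\<lambda>x. 1 * c * (v l x * u k x)))"
      unfolding sel_qint
    proof (rule Bochner_Integration.integral_cong[OF refl])
      fix x
      show "qs (u k x * c * v l x) = qs (1 * c * (v l x * u k x))"
        using qs_mult_commute[of "u k x" "c * v l x"] by (simp add: mult.assoc)
    qed
    also have "qint \<mu> (\<lambda>x. 1 * c * (v l x * u k x)) = c * gram l k"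
    proof -
      have i: "integrable \<mu> (\<lambda>x. qcomp l' 1 * qcomp m (v l x * u k x))" if "m < 4" for l' m
        using vu_integrable[OF \<open>l < n\<close> \<open>k < n\<close>] that by (simp add: qintegrable_def)
      have "qint \<mu> (\<lambda>x. 1 * c * (v l x * u k x)) = 1 * c * gram l k"
        unfolding gram_def cquat_mult_const_expand[of 1 c "qint \<mu> (\<lambda>x. v l x * u k x)"]
        by (subst qint_sandwich(2)) (simp_all add: i qcomp_qint)
      then show ?thesis by simp
    qed
    finally show ?thesis .
  qed
  have "qs (cycle_int s) = (\<Sum>k<n. \<Sum>l<n. qs (mpow n gram s k l * gram l k))"
    unfolding cycle_int_def qs_sum by (intro sum.cong refl t) auto
  also have "\<dots> = (\<Sum>l<n. \<Sum>k<n. qs (gram l k * mpow n gram s k l))"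
    by (subst sum.swap) (simp only: qs_mult_commute[of "mpow _ _ _ _ _"])
  also have "\<dots> = half_trace (Suc s)"
    by (simp add: half_trace_def qs_sum mmul_def)
  finally show ?thesis using sc by simp
qed

lemma prod_list_support:
  "prod_list (map (\<lambda>i. ker (x i) (x (p i))) (map (\<lambda>i. (p ^^ i) m) [0..<Suc s])) =
    path x m (map (\<lambda>i. (p ^^ i) (p m)) [0..<s]) ((p ^^ Suc s) m)"
proof (induction s arbitrary: m)
  case 0
  then show ?case by simp
next
  case (Suc s)
  have sh: "map (\<lambda>i. (p ^^ i) m) [0..<Suc t] = m # map (\<lambda>i. (p ^^ i) (p m)) [0..<t]" for t m
    by (simp add: upt_conv_Cons map_Suc_upt[symmetric] funpow_swap1 del: upt_Suc)
  show ?case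
    unfolding sh[of m "Suc s"] sh[of "p m" s] list.map prod_list.Cons path.simps
    using Suc[of "p m"] unfolding sh[of "p m" s] list.map prod_list.Cons
    by (simp add: funpow_swap1)
qed

lemma support_Cons:
  assumes "permutation p"
  obtains l where "support p m = m # l"
    "\<And>x. cycle_product (\<lambda>i j. ker (x i) (x j)) p m = path x m l m"
proof -
  obtain s where s: "least_power p m = Suc s"
    using least_power_of_permutation(2)[OF assms, of m] gr0_conv_Suc by auto
  have sh: "map (\<lambda>i. (p ^^ i) m) [0..<Suc s] = m # map (\<lambda>i. (p ^^ i) (p m)) [0..<s]"
    by (simp add: upt_conv_Cons map_Suc_upt[symmetric] funpow_swap1 del: upt_Suc)
  have "(p ^^ Suc s) m = m" using least_power_of_permutation(1)[OF assms, of m] s by simp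
  then have "cycle_product (\<lambda>i j. ker (x i) (x j)) p m = path x m (map (\<lambda>i. (p ^^ i) (p m)) [0..<s]) m" for x
    unfolding cycle_product_def s prod_list_support by simp
  then show thesis using that[of "map (\<lambda>i. (p ^^ i) (p m)) [0..<s]"] s sh by simp
qed

lemma qint_cycle_product:
  assumes "permutation p"
  shows "qintegrable (Pi\<^sub>M (set (support p m)) (\<lambda>_. \<mu>)) (\<lambda>x. cycle_product (\<lambda>i j. ker (x i) (x j)) p m)"
    and "qint (Pi\<^sub>M (set (support p m)) (\<lambda>_. \<mu>)) (\<lambda>x. cycle_product (\<lambda>i j. ker (x i) (x j)) p m) =
      cquat_of_complex (half_trace (length (support p m)))"
proof -
  obtain l where l: "support p m = m # l" "\<And>x. cycle_product (\<lambda>i j. ker (x i) (x j)) p m = path x m l m"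
    using support_Cons[OF assms, of m] by metis
  have "distinct (m # l)" using cycle_of_permutation[OF assms, of m] l(1) by simp
  note P = qint_path[OF this]
  show "qintegrable (Pi\<^sub>M (set (support p m)) (\<lambda>_. \<mu>)) (\<lambda>x. cycle_product (\<lambda>i j. ker (x i) (x j)) p m)"
    unfolding l by (rule P(1))
  show "qint (Pi\<^sub>M (set (support p m)) (\<lambda>_. \<mu>)) (\<lambda>x. cycle_product (\<lambda>i j. ker (x i) (x j)) p m) =
      cquat_of_complex (half_trace (length (support p m)))"
    unfolding l P(2) cycle_int_scalar by simp
qed

lemma cycle_product_restrict:
  assumes "permutation p" "set (support p m) \<subseteq> S"
  shows "cycle_product (\<lambda>i j. ker (restrict x S i) (restrict x S j)) p m =
    cycle_product (\<lambda>i j. ker (x i) (x j)) p m"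
proof -
  have "p i \<in> S" if "i \<in> set (support p m)" for i
    using cyc_step[of i p m] that assms set_support[OF assms(1)] by blast
  then show ?thesis
    unfolding cycle_product_def using assms(2)
    by (intro arg_cong[where f=prod_list] map_cong refl) auto
qed

text \<open>Different cycles use disjoint sets of variables, so the integral factorizes in the order
  of the list; as each factor integrates to a scalar, that order disappears from the result.\<close>

lemma qint_prod_list_cycles:
  fixes p :: "nat \<Rightarrow> nat"
  assumes "permutation p" and "distinct L"
    and "\<And>m m'. m \<in> set L \<Longrightarrow> m' \<in> set L \<Longrightarrow> m \<noteq> m' \<Longrightarrow> set (support p m) \<inter> set (support p m') = {}"
  defines "C \<equiv> \<lambda>m (x :: nat \<Rightarrow> 'a). cycle_product (\<lambda>i j. ker (x i) (x j)) p m"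
  shows "qintegrable (Pi\<^sub>M (\<Union>m\<in>set L. set (support p m)) (\<lambda>_. \<mu>)) (\<lambda>x. prod_list (map (\<lambda>m. C m x) L)) \<and>
    qint (Pi\<^sub>M (\<Union>m\<in>set L. set (support p m)) (\<lambda>_. \<mu>)) (\<lambda>x. prod_list (map (\<lambda>m. C m x) L)) =
      cquat_of_complex (\<Prod>m\<in>set L. half_trace (length (support p m)))"
  using assms(2,3)
proof (induction L)
  case Nil
  have "qintegrable (Pi\<^sub>M {} (\<lambda>_::nat. \<mu>)) (\<lambda>x. 1)"
    by (simp add: qintegrable_def PiM_empty integrable_count_space)
  moreover have "qint (Pi\<^sub>M {} (\<lambda>_::nat. \<mu>)) (\<lambda>x. 1) = 1"
    by (rule cquat_eqI) (simp add: qcomp_qint PiM_empty lebesgue_integral_count_space_finite)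
  ultimately show ?case by simp
next
  case (Cons m L)
  let ?I = "set (support p m)" and ?J = "\<Union>m\<in>set L. set (support p m)"
  let ?H = "\<lambda>x. prod_list (map (\<lambda>m. C m x) L)"
  have IJ: "?I \<inter> ?J = {}"
  proof -
    have "?I \<inter> set (support p m') = {}" if "m' \<in> set L" for m'
      using Cons.prems that by (intro Cons.prems(2)) auto
    then show ?thesis by blast
  qed
  have IH: "qintegrable (Pi\<^sub>M ?J (\<lambda>_. \<mu>)) ?H"
    "qint (Pi\<^sub>M ?J (\<lambda>_. \<mu>)) ?H = cquat_of_complex (\<Prod>m\<in>set L. half_trace (length (support p m)))"
    using Cons.IH Cons.prems by auto
  have dep: "C m (restrict x ?I) = C m x" "?H (restrict x ?J) = ?H x" for x
  proof -
    show "C m (restrict x ?I) = C m x"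
      unfolding C_def by (rule cycle_product_restrict[OF assms(1)]) simp
    have "C m' (restrict x ?J) = C m' x" if "m' \<in> set L" for m'
      unfolding C_def by (rule cycle_product_restrict[OF assms(1)]) (use that in blast)
    then show "?H (restrict x ?J) = ?H x"
      by (intro arg_cong[where f=prod_list] map_cong refl)
  qed
  have q: "qintegrable (Pi\<^sub>M ?I (\<lambda>_. \<mu>)) (C m)"
    "qint (Pi\<^sub>M ?I (\<lambda>_. \<mu>)) (C m) = cquat_of_complex (half_trace (length (support p m)))"
    unfolding C_def by (rule qint_cycle_product[OF assms(1)])+
  have fin: "finite ?I" "finite ?J" by auto
  have M: "qintegrable (Pi\<^sub>M (?I \<union> ?J) (\<lambda>_. \<mu>)) (\<lambda>x. C m x * ?H x)"
    "qint (Pi\<^sub>M (?I \<union> ?J) (\<lambda>_. \<mu>)) (\<lambda>x. C m x * ?H x) = qint (Pi\<^sub>M ?I (\<lambda>_. \<mu>)) (C m) * qint (Pi\<^sub>M ?J (\<lambda>_. \<mu>)) ?H"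
    by (rule qint_mult_disjoint[OF sigma_finite_measure_axioms fin IJ dep q(1) IH(1)])+
  have P: "(\<Prod>m\<in>set (m # L). half_trace (length (support p m))) =
      half_trace (length (support p m)) * (\<Prod>m\<in>set L. half_trace (length (support p m)))"
    using Cons.prems(1) by simp
  have U: "(\<Union>m\<in>set (m # L). set (support p m)) = ?I \<union> ?J" by simp
  show ?case
    unfolding U P list.map prod_list.Cons cquat_of_complex_mult using M q(2) IH(2) by simp
qed

theorem integral_fredholm_integrand:
  shows "integrable (Pi\<^sub>M {..<N} (\<lambda>_. \<mu>)) (fredholm_integrand ker N)"
    and "(LINT x|Pi\<^sub>M {..<N} (\<lambda>_. \<mu>). fredholm_integrand ker N x) =
      fact N * cycle_coeff (\<lambda>s. (-1) ^ (s - 1) * half_trace s) N"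
proof -
  define t where "t p x = (-1) ^ (N - card (cycle_maxima N p)) *
    qs (prod_list (map (cycle_product (\<lambda>i j. ker (x i) (x j)) p) (rev (sorted_list_of_set (cycle_maxima N p)))))"
    for p x
  have sgn: "qs ((-1) ^ k * q) = (-1) ^ k * qs q" for k q
    by (cases "even k") simp_all
  have f: "fredholm_integrand ker N x = (\<Sum>p | p permutes {..<N}. t p x)" for x
    by (simp add: fredholm_integrand_def DetM_def qs_sum sgn t_def)
  have t: "integrable (Pi\<^sub>M {..<N} (\<lambda>_. \<mu>)) (t p)"
    "(LINT x|Pi\<^sub>M {..<N} (\<lambda>_. \<mu>). t p x) = cycle_weight (\<lambda>s. (-1) ^ (s - 1) * half_trace s) {..<N} p"
    if p: "p permutes {..<N}" for p
  proof -
    have perm: "permutation p" by (rule permutation_if_permutes[OF finite_lessThan p])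
    let ?L = "rev (sorted_list_of_set (cycle_maxima N p))"
    have fin: "finite (cycle_maxima N p)" by (simp add: cycle_maxima_def)
    have L: "distinct ?L" "set ?L = cycle_maxima N p" using fin by auto
    let ?G = "\<lambda>x. prod_list (map (cycle_product (\<lambda>i j. ker (x i) (x j)) p) ?L)"
    have "qintegrable (Pi\<^sub>M (\<Union>m\<in>set ?L. set (support p m)) (\<lambda>_. \<mu>)) ?G \<and>
        qint (Pi\<^sub>M (\<Union>m\<in>set ?L. set (support p m)) (\<lambda>_. \<mu>)) ?G =
          cquat_of_complex (\<Prod>m\<in>set ?L. half_trace (length (support p m)))"
    proof (rule qint_prod_list_cycles[OF perm L(1)])
      fix m m' assume "m \<in> set ?L" "m' \<in> set ?L" "m \<noteq> m'"
      then show "set (support p m) \<inter> set (support p m') = {}"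
        unfolding L(2) by (rule cycle_maxima_cycles(3)[OF p])
    qed
    note Q = this[unfolded L(2) cycle_maxima_cycles(4)[OF p]]
    show "integrable (Pi\<^sub>M {..<N} (\<lambda>_. \<mu>)) (t p)"
      unfolding t_def
      using conjunct1[OF Q, unfolded qintegrable_def, rule_format, of 0]
      by (intro integrable_mult_right) (simp only: qcomp_simps zero_less_numeral)
    show "(LINT x|Pi\<^sub>M {..<N} (\<lambda>_. \<mu>). t p x) = cycle_weight (\<lambda>s. (-1) ^ (s - 1) * half_trace s) {..<N} p"
      unfolding cycle_weight_eq_cycle_maxima[OF p] t_def
      using arg_cong[OF conjunct2[OF Q], of qs]
      by (simp only: sel_qint cquat_sel_simps integral_mult_right_zero)
  qed
  show "integrable (Pi\<^sub>M {..<N} (\<lambda>_. \<mu>)) (fredholm_integrand ker N)"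
    unfolding f[abs_def] by (rule Bochner_Integration.integrable_sum) (rule t(1), simp)
  have "(LINT x|Pi\<^sub>M {..<N} (\<lambda>_. \<mu>). fredholm_integrand ker N x) =
    (\<Sum>p | p permutes {..<N}. cycle_weight (\<lambda>s. (-1) ^ (s - 1) * half_trace s) {..<N} p)"
    unfolding f by (subst Bochner_Integration.integral_sum) (simp_all add: t)
  also have "\<dots> = fact N * cycle_coeff (\<lambda>s. (-1) ^ (s - 1) * half_trace s) N"
    using sum_cycle_weight[of "{..<N}"] by simp
  finally show "(LINT x|Pi\<^sub>M {..<N} (\<lambda>_. \<mu>). fredholm_integrand ker N x) =
      fact N * cycle_coeff (\<lambda>s. (-1) ^ (s - 1) * half_trace s) N" .
qed

end


section \<open>Spectra of finite-rank operators\<close>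

text \<open>Gaussian elimination: if equation \<open>i\<close> has a non-zero coefficient, the
  unknown \<open>t\<close> carrying it is the pivot and is removed from the other equations.\<close>

lemma nontrivial_homogeneous_solution:
  fixes a :: "'s \<Rightarrow> 'i \<Rightarrow> 'c::field"
  assumes "finite I" and "finite S" and "card I < card S"
  shows "\<exists>c. (\<exists>s\<in>S. c s \<noteq> 0) \<and> (\<forall>i\<in>I. (\<Sum>s\<in>S. c s * a s i) = 0)"
  using assms
proof (induction I arbitrary: S a rule: finite_induct)
  case empty
  then obtain s where "s \<in> S" by fastforce
  then show ?case by (intro exI[of _ "\<lambda>_. 1"]) auto
next
  case (insert i I)
  show ?case
  proof (cases "\<forall>s\<in>S. a s i = 0")
    case True
    obtain c where "\<exists>s\<in>S. c s \<noteq> 0" "\<forall>i\<in>I. (\<Sum>s\<in>S. c s * a s i) = 0"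
      using insert.IH[of S a] insert.prems insert.hyps by auto
    then show ?thesis using True by (intro exI[of _ c]) auto
  next
    case False
    then obtain t where t: "t \<in> S" "a t i \<noteq> 0" by auto
    define b where "b s j = a s j - a s i / a t i * a t j" for s j
    have "card I < card (S - {t})" using insert.prems insert.hyps t by simp
    then obtain c where c: "\<exists>s\<in>S - {t}. c s \<noteq> 0" "\<forall>j\<in>I. (\<Sum>s\<in>S - {t}. c s * b s j) = 0"
      using insert.IH[of "S - {t}" b] insert.prems by auto
    \<comment> \<open>The value at the pivot is chosen to solve equation \<open>i\<close>; with it,
      the original sums become those of the reduced system.\<close>
    define d where "d s = (if s = t then - (\<Sum>s\<in>S - {t}. c s * a s i) / a t i else c s)" for s
    have sum: "(\<Sum>s\<in>S. d s * a s j) = (\<Sum>s\<in>S - {t}. c s * b s j)" for j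
    proof -
      have "(\<Sum>s\<in>S. d s * a s j) = d t * a t j + (\<Sum>s\<in>S - {t}. c s * a s j)"
        using t insert.prems by (simp add: sum.remove d_def)
      then show ?thesis
        by (simp add: d_def b_def right_diff_distrib sum_subtractf sum_distrib_right sum_divide_distrib
            mult.assoc)
    qed
    have "b s i = 0" for s using t by (simp add: b_def)
    then have "(\<Sum>s\<in>S. d s * a s i) = 0" unfolding sum by simp
    moreover have "\<forall>j\<in>I. (\<Sum>s\<in>S. d s * a s j) = 0" unfolding sum by (rule c(2))
    moreover have "\<exists>s\<in>S. d s \<noteq> 0" using c(1) by (auto simp: d_def)
    ultimately show ?thesis by auto
  qed
qed

text \<open>Back substitution from the last index: once \<open>c (Suc k)\<close> vanishes, equation
  \<open>k\<close> reads \<open>\<alpha> k * c k = 0\<close>. Where \<open>\<alpha> k\<close> is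
  zero this says nothing, and \<open>zero\<close> steps in.\<close>

lemma bidiag_kernel:
  fixes c :: "nat \<Rightarrow> 'c::field"
  assumes eq: "\<And>k. k < N \<Longrightarrow> \<alpha> k * c k + (if Suc k < N then \<epsilon> (Suc k) * c (Suc k) else 0) = 0"
    and zero: "\<And>k. k < N \<Longrightarrow> \<alpha> k = 0 \<Longrightarrow> c k = 0"
  shows "k < N \<Longrightarrow> c k = 0"
proof (induction "N - k" arbitrary: k rule: less_induct)
  case less
  have "(if Suc k < N then \<epsilon> (Suc k) * c (Suc k) else 0) = 0"
    using less.hyps[of "Suc k"] less.prems by simp
  then have "\<alpha> k * c k = 0" using eq[OF less.prems] by simp
  then show ?case using zero[OF less.prems] by auto
qed

lemma mmul_bidiag:
  "k < N \<Longrightarrow> mmul N (bidiag \<alpha> \<epsilon>) B k j =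
    \<alpha> k * B k j + (if Suc k < N then \<epsilon> (Suc k) * B (Suc k) j else 0)"
proof -
  assume k: "k < N"
  have "mmul N (bidiag \<alpha> \<epsilon>) B k j =
    (\<Sum>i<N. (if i = k then \<alpha> k * B k j else 0) + (if i = Suc k then \<epsilon> (Suc k) * B (Suc k) j else 0))"
    unfolding mmul_def bidiag_def by (intro sum.cong) auto
  then show ?thesis using k by (simp add: sum.distrib)
qed

lemma mmul_bidiag_right:
  "j < N \<Longrightarrow> mmul N B (bidiag \<alpha> \<epsilon>) i j =
    B i j * \<alpha> j + (if j = 0 then 0 else B i (j - 1) * \<epsilon> j)"
proof -
  assume j: "j < N"
  have "mmul N B (bidiag \<alpha> \<epsilon>) i j =
    (\<Sum>k<N. (if k = j then B i j * \<alpha> j else 0) + (if k = j - 1 then if j = 0 then 0 else B i (j - 1) * \<epsilon> j else 0))"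
    unfolding mmul_def bidiag_def by (intro sum.cong) auto
  then show ?thesis using j by (auto simp: sum.distrib)
qed

section \<open>Independence and dimension modulo null functions\<close>

lemma ae_dim_ge: "S \<subseteq> V \<Longrightarrow> ae_independent \<mu> S \<Longrightarrow> enat (card S) \<le> ae_dim \<mu> V"
  unfolding ae_dim_def by (rule SUP_upper) simp

lemma ae_dim_le:
  "(\<And>S. S \<subseteq> V \<Longrightarrow> ae_independent \<mu> S \<Longrightarrow> card S \<le> d) \<Longrightarrow> ae_dim \<mu> V \<le> enat d"
  unfolding ae_dim_def by (rule SUP_least) simp

text \<open>Independence is defined for sets, so an indexed family must be injective before
  cardinalities can be compared; two equal members would satisfy a relation with coefficients 1 and
  -1.\<close>

lemma ae_independent_image:
  assumes fin: "finite I"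
    and ind: "\<And>c. (AE x in \<mu>. (\<Sum>j\<in>I. c j *s G j x) = 0) \<Longrightarrow> \<forall>j\<in>I. c j = 0"
  shows "inj_on G I" and "ae_independent \<mu> (G ` I)"
proof -
  show inj: "inj_on G I"
  proof (rule inj_onI, rule ccontr)
    fix i j assume ij: "i \<in> I" "j \<in> I" "G i = G j" "i \<noteq> j"
    define c :: "_ \<Rightarrow> complex" where "c k = (if k = i then 1 else 0) - (if k = j then 1 else 0)" for k
    have "(\<Sum>k\<in>I. c k *s G k x) = 0" for x
    proof -
      have "(\<Sum>k\<in>I. c k *s G k x) =
        (\<Sum>k\<in>I. (if k = i then G i x else 0) - (if k = j then G j x else 0))"
        by (intro sum.cong) (auto simp: c_def vector_ssub_ldistrib)
      then show ?thesis using ij fin by (simp add: sum_subtractf)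
    qed
    then have "\<forall>k\<in>I. c k = 0" by (intro ind) simp
    then show False using ij by (auto simp: c_def)
  qed
  show "ae_independent \<mu> (G ` I)"
    unfolding ae_independent_def
  proof (intro conjI allI impI)
    show "finite (G ` I)" using fin by simp
    fix c assume "AE x in \<mu>. (\<Sum>f\<in>G ` I. c f *s f x) = 0"
    then have "AE x in \<mu>. (\<Sum>j\<in>I. c (G j) *s G j x) = 0" by (simp add: sum.reindex[OF inj])
    from ind[OF this] show "\<forall>f\<in>G ` I. c f = 0" by simp
  qed
qed

lemma vector_scalar_sum_right: "c *s (\<Sum>s\<in>S. f s) = (\<Sum>s\<in>S. c *s (f s :: complex^2))"
  by (induction S rule: infinite_finite_induct) (simp_all add: vector_add_ldistrib)

lemma vector_scalar_sum_left: "(\<Sum>s\<in>S. f s) *s (w :: complex^2) = (\<Sum>s\<in>S. f s *s w)"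
  by (induction S rule: infinite_finite_induct) (simp_all add: vector_sadd_rdistrib)

lemma bounded_linear_vector_scalar: "bounded_linear (\<lambda>x::complex^2. c *s x)"
  unfolding linear_conv_bounded_linear[symmetric]
proof (rule linearI)
  show "c *s (r *\<^sub>R b) = r *\<^sub>R (c *s b)" for r and b :: "complex^2"
    unfolding Finite_Cartesian_Product.vec_eq_iff by simp
qed (simp add: vector_add_ldistrib)

lemma square_integrable_bounded_linear:
  fixes f :: "'b \<Rightarrow> 'c::{real_normed_vector, second_countable_topology}"
    and h :: "'c \<Rightarrow> 'd::{real_normed_vector, second_countable_topology}"
  assumes h: "bounded_linear h" and f: "f \<in> borel_measurable M" "integrable M (\<lambda>x. (norm (f x))\<^sup>2)"
  shows "(\<lambda>x. h (f x)) \<in> borel_measurable M" and "integrable M (\<lambda>x. (norm (h (f x)))\<^sup>2)"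
proof -
  have "h \<in> borel_measurable borel"
    by (intro borel_measurable_continuous_onI linear_continuous_on h)
  then show m: "(\<lambda>x. h (f x)) \<in> borel_measurable M" by (rule measurable_compose[OF f(1)])
  obtain B where B: "\<And>c. norm (h c) \<le> norm c * B" using bounded_linear.bounded[OF h] by blast
  show "integrable M (\<lambda>x. (norm (h (f x)))\<^sup>2)"
  proof (rule Bochner_Integration.integrable_bound)
    show "integrable M (\<lambda>x. (norm (f x))\<^sup>2 * B\<^sup>2)" using f by simp
    show "AE x in M. norm ((norm (h (f x)))\<^sup>2) \<le> norm ((norm (f x))\<^sup>2 * B\<^sup>2)"
      using B by (intro AE_I2) (simp add: power_mult_distrib[symmetric] power_mono)
  qed (use m in measurable)
qed

lemma square_integrable_norm_add:
  fixes f g :: "'b \<Rightarrow> 'c::{real_normed_vector, second_countable_topology}"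
  assumes [measurable]: "f \<in> borel_measurable M" "g \<in> borel_measurable M"
    and "integrable M (\<lambda>x. (norm (f x))\<^sup>2)" "integrable M (\<lambda>x. (norm (g x))\<^sup>2)"
  shows "integrable M (\<lambda>x. (norm (f x + g x))\<^sup>2)"
proof (rule Bochner_Integration.integrable_bound)
  show "integrable M (\<lambda>x. 2 * (norm (f x))\<^sup>2 + 2 * (norm (g x))\<^sup>2)"
    using assms by simp
  show "AE x in M. norm ((norm (f x + g x))\<^sup>2) \<le> norm (2 * (norm (f x))\<^sup>2 + 2 * (norm (g x))\<^sup>2)"
  proof (rule AE_I2)
    fix x
    have "(norm (f x + g x))\<^sup>2 \<le> (norm (f x) + norm (g x))\<^sup>2"
      by (intro power_mono norm_triangle_ineq) simp
    also have "\<dots> \<le> 2 * (norm (f x))\<^sup>2 + 2 * (norm (g x))\<^sup>2"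
      using sum_squares_bound[of "norm (f x)" "norm (g x)"] by (simp add: power2_sum)
    finally show "norm ((norm (f x + g x))\<^sup>2) \<le> norm (2 * (norm (f x))\<^sup>2 + 2 * (norm (g x))\<^sup>2)"
      by simp
  qed
qed measurable

lemma L2_fun_scale: "f \<in> L2_fun \<mu> \<Longrightarrow> (\<lambda>x. c *s f x) \<in> L2_fun \<mu>"
  using square_integrable_bounded_linear[OF bounded_linear_vector_scalar, of f \<mu> c]
  by (simp add: L2_fun_def)

lemma L2_fun_add: "f \<in> L2_fun \<mu> \<Longrightarrow> g \<in> L2_fun \<mu> \<Longrightarrow> (\<lambda>x. f x + g x) \<in> L2_fun \<mu>"
  by (simp add: L2_fun_def square_integrable_norm_add borel_measurable_add)

lemma L2_fun_sum: "(\<And>s. s \<in> S \<Longrightarrow> F s \<in> L2_fun \<mu>) \<Longrightarrow> (\<lambda>x. \<Sum>s\<in>S. c s *s F s x) \<in> L2_fun \<mu>"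
proof (induction S rule: infinite_finite_induct)
  case (insert s S)
  then show ?case using L2_fun_add[OF L2_fun_scale[of "F s" \<mu> "c s"]] by simp
qed (simp_all add: L2_fun_def)

lemma L2_fun_cong: "(\<And>x. x \<in> space \<mu> \<Longrightarrow> f x = g x) \<Longrightarrow> f \<in> L2_fun \<mu> \<longleftrightarrow> g \<in> L2_fun \<mu>"
  unfolding L2_fun_def
  by (auto cong: measurable_cong Bochner_Integration.integrable_cong)

text \<open>An operator \<open>T = \<Sum>\<^sub>p U\<^sub>p \<otimes> V\<^sub>p\<close> on \<open>L\<^sup>2\<close>, with a Jordan decomposition \<open>P J Q\<close> of the matrix
  \<open>V\<^sub>p(U\<^sub>q)\<close>. For \<open>z \<noteq> 0\<close> the functions \<open>F\<^sub>j\<close> with \<open>\<alpha>\<^sub>j = z\<close> form a basis of the generalized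
  eigenspace, and the functionals \<open>\<psi>\<^sub>k\<close> are coordinates on it.\<close>

locale finite_rank_operator =
  fixes \<mu> :: "'a measure" and N :: nat and U :: "nat \<Rightarrow> 'a \<Rightarrow> complex^2"
    and V :: "nat \<Rightarrow> ('a \<Rightarrow> complex^2) \<Rightarrow> complex" and T :: "('a \<Rightarrow> complex^2) \<Rightarrow> 'a \<Rightarrow> complex^2"
    and P Q :: "nat \<Rightarrow> nat \<Rightarrow> complex" and \<alpha> \<epsilon> :: "nat \<Rightarrow> complex"
  assumes U: "\<And>p. p < N \<Longrightarrow> U p \<in> L2_fun \<mu>"
    and V_lin: "\<And>p f g a b. f \<in> L2_fun \<mu> \<Longrightarrow> g \<in> L2_fun \<mu> \<Longrightarrow> p < N \<Longrightarrow>
      V p (\<lambda>x. a *s f x + b *s g x) = a * V p f + b * V p g"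
    and V_cong: "\<And>p f g. f \<in> L2_fun \<mu> \<Longrightarrow> g \<in> L2_fun \<mu> \<Longrightarrow> p < N \<Longrightarrow>
      AE x in \<mu>. f x = g x \<Longrightarrow> V p f = V p g"
    and T: "\<And>f x. f \<in> L2_fun \<mu> \<Longrightarrow> x \<in> space \<mu> \<Longrightarrow> T f x = (\<Sum>p<N. V p f *s U p x)"
    and PQ: "\<And>i j. i < N \<Longrightarrow> j < N \<Longrightarrow> mmul N P Q i j = mdelta i j"
    and QP: "\<And>i j. i < N \<Longrightarrow> j < N \<Longrightarrow> mmul N Q P i j = mdelta i j"
    and VU: "\<And>i j. i < N \<Longrightarrow> j < N \<Longrightarrow> V i (U j) = mmul N P (mmul N (bidiag \<alpha> \<epsilon>) Q) i j"
    and \<epsilon>: "\<And>j. Suc j < N \<Longrightarrow> \<epsilon> (Suc j) \<noteq> 0 \<Longrightarrow> \<alpha> j = \<alpha> (Suc j)"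
begin

abbreviation "L2 \<equiv> L2_fun \<mu>"

definition \<psi> :: "nat \<Rightarrow> ('a \<Rightarrow> complex^2) \<Rightarrow> complex" where
  "\<psi> k f = (\<Sum>p<N. Q k p * V p f)"

definition F :: "nat \<Rightarrow> 'a \<Rightarrow> complex^2" where
  "F j x = (\<Sum>q<N. P q j *s U q x)"

definition D :: "complex \<Rightarrow> ('a \<Rightarrow> complex^2) \<Rightarrow> 'a \<Rightarrow> complex^2" where
  "D z g = (\<lambda>x. T g x - z *s g x)"

lemma D_apply: "D z g x = T g x - z *s g x"
  by (simp add: D_def)

lemma zero_L2 [simp]: "(\<lambda>x. 0) \<in> L2"
  by (simp add: L2_fun_def)

lemma V_zero: "p < N \<Longrightarrow> V p (\<lambda>x. 0) = 0"
  using V_lin[OF zero_L2 zero_L2, of p 0 0] by simp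

lemma V_sum:
  assumes "p < N" and "\<And>s. s \<in> S \<Longrightarrow> f s \<in> L2"
  shows "V p (\<lambda>x. \<Sum>s\<in>S. c s *s f s x) = (\<Sum>s\<in>S. c s * V p (f s))"
  using assms(2)
proof (induction S rule: infinite_finite_induct)
  case (insert s S)
  have "V p (\<lambda>x. c s *s f s x + 1 *s (\<Sum>s\<in>S. c s *s f s x)) =
      c s * V p (f s) + 1 * V p (\<lambda>x. \<Sum>s\<in>S. c s *s f s x)"
    using insert.prems assms(1) by (intro V_lin L2_fun_sum) auto
  then show ?case using insert by simp
qed (simp_all add: V_zero assms)

lemma V_eq_0: "f \<in> L2 \<Longrightarrow> p < N \<Longrightarrow> AE x in \<mu>. f x = 0 \<Longrightarrow> V p f = 0"
  using V_cong[of f "\<lambda>x. 0" p] V_zero[of p] by simp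

lemma \<psi>_sum:
  assumes "\<And>s. s \<in> S \<Longrightarrow> f s \<in> L2"
  shows "\<psi> k (\<lambda>x. \<Sum>s\<in>S. c s *s f s x) = (\<Sum>s\<in>S. c s * \<psi> k (f s))"
proof -
  have "\<psi> k (\<lambda>x. \<Sum>s\<in>S. c s *s f s x) = (\<Sum>p<N. \<Sum>s\<in>S. Q k p * (c s * V p (f s)))"
    unfolding \<psi>_def by (simp add: V_sum assms sum_distrib_left)
  also have "\<dots> = (\<Sum>s\<in>S. \<Sum>p<N. Q k p * (c s * V p (f s)))" by (rule sum.swap)
  finally show ?thesis by (simp add: \<psi>_def sum_distrib_left mult.left_commute)
qed

lemma \<psi>_zero: "f \<in> L2 \<Longrightarrow> AE x in \<mu>. f x = 0 \<Longrightarrow> \<psi> k f = 0"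
  unfolding \<psi>_def by (simp add: V_eq_0)

text \<open>\<open>P\<close> inverts \<open>Q\<close>, so the \<open>V p\<close> are recovered from
  the \<open>\<psi> k\<close>; in particular \<open>T f\<close> vanishes on
  \<open>space \<mu>\<close> once all \<open>\<psi> k f\<close> do.\<close>

lemma V_from_\<psi>: "p < N \<Longrightarrow> V p f = (\<Sum>k<N. P p k * \<psi> k f)"
proof -
  assume p: "p < N"
  have "(\<Sum>k<N. P p k * \<psi> k f) = mmul N P (mmul N Q (\<lambda>p _. V p f)) p 0"
    by (simp add: mmul_def \<psi>_def)
  also have "\<dots> = mmul N (mmul N P Q) (\<lambda>p _. V p f) p 0" by (simp add: mmul_assoc)
  also have "\<dots> = mmul N mdelta (\<lambda>p _. V p f) p 0" by (rule mmul_cong) (use PQ p in auto)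
  finally show ?thesis using p by (simp add: mmul_mdelta_left)
qed

lemma T_L2: "f \<in> L2 \<Longrightarrow> T f \<in> L2"
  using L2_fun_cong[of \<mu> "T f", OF T] L2_fun_sum[of "{..<N}" U] U by auto

text \<open>The values \<open>V p (T f)\<close> arise from the \<open>V p f\<close> by the matrix
  \<open>P J Q\<close>; multiplying by \<open>Q\<close> leaves \<open>J\<close>, so
  \<open>\<psi>\<close> intertwines \<open>T\<close> with the Jordan matrix.\<close>

lemma \<psi>_T:
  assumes f: "f \<in> L2" and k: "k < N"
  shows "\<psi> k (T f) = \<alpha> k * \<psi> k f + (if Suc k < N then \<epsilon> (Suc k) * \<psi> (Suc k) f else 0)"
proof -
  let ?v = "\<lambda>p (_::nat). V p f" and ?J = "bidiag \<alpha> \<epsilon>"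
  have VT: "V p (T f) = mmul N (mmul N P (mmul N ?J Q)) ?v p 0" if "p < N" for p
  proof -
    have "V p (T f) = V p (\<lambda>x. \<Sum>q<N. V q f *s U q x)"
      by (rule V_cong) (use that f U in \<open>auto intro!: T_L2 L2_fun_sum simp: T\<close>)
    also have "\<dots> = (\<Sum>q<N. V q f * V p (U q))" by (rule V_sum) (use that U in auto)
    finally show ?thesis using that VU by (simp add: mmul_def[of N _ ?v] mult.commute)
  qed
  have "\<psi> k (T f) = mmul N Q (mmul N (mmul N P (mmul N ?J Q)) ?v) k 0"
    unfolding \<psi>_def mmul_def[of N Q] by (simp add: VT)
  also have "\<dots> = mmul N (mmul N Q P) (mmul N (mmul N ?J Q) ?v) k 0" by (simp add: mmul_assoc)
  also have "\<dots> = mmul N mdelta (mmul N (mmul N ?J Q) ?v) k 0" by (rule mmul_cong) (use QP k in auto)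
  also have "\<dots> = mmul N ?J (mmul N Q ?v) k 0" using k by (simp add: mmul_mdelta_left mmul_assoc)
  also have "mmul N Q ?v = (\<lambda>k _. \<psi> k f)" by (simp add: mmul_def \<psi>_def fun_eq_iff)
  finally show ?thesis using k by (simp add: mmul_bidiag)
qed

lemma F_L2: "F j \<in> L2"
  unfolding F_def[abs_def] by (intro L2_fun_sum U) auto

text \<open>The pairing is the Jordan matrix rather than the identity. Independence of the
  \<open>F j\<close> is therefore obtained for the indices with
  \<open>\<alpha> j \<noteq> 0\<close>, where this matrix is invertible.\<close>

lemma \<psi>_F:
  assumes "k < N" "j < N"
  shows "\<psi> k (F j) = bidiag \<alpha> \<epsilon> k j"
proof -
  let ?J = "bidiag \<alpha> \<epsilon>"
  have V: "V p (F j) = mmul N P ?J p j" if "p < N" for p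
  proof -
    have "V p (F j) = (\<Sum>q<N. P q j * V p (U q))"
      unfolding F_def[abs_def] by (rule V_sum) (use that U in auto)
    also have "\<dots> = mmul N (mmul N P (mmul N ?J Q)) P p j"
      using VU that by (simp add: mmul_def[of N _ P] mult.commute)
    also have "\<dots> = mmul N (mmul N P ?J) (mmul N Q P) p j" by (simp add: mmul_assoc)
    also have "\<dots> = mmul N (mmul N P ?J) mdelta p j" by (rule mmul_cong) (use QP assms in auto)
    finally show ?thesis using assms by (simp add: mmul_mdelta_right)
  qed
  have "\<psi> k (F j) = mmul N Q (mmul N P ?J) k j" unfolding \<psi>_def mmul_def[of N Q] by (simp add: V)
  also have "\<dots> = mmul N (mmul N Q P) ?J k j" by (simp add: mmul_assoc)
  also have "\<dots> = mmul N mdelta ?J k j" by (rule mmul_cong) (use QP assms in auto)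
  finally show ?thesis using assms by (simp add: mmul_mdelta_left)
qed

text \<open>The columns of \<open>P\<close> are Jordan chains of the matrix, and \<open>F\<close>
  carries them over to \<open>T\<close>.\<close>

lemma T_F:
  assumes "j < N" "x \<in> space \<mu>"
  shows "T (F j) x = \<alpha> j *s F j x + (if j = 0 then 0 else \<epsilon> j *s F (j - 1) x)"
proof -
  have "V p (F j) = P p j * \<alpha> j + (if j = 0 then 0 else P p (j - 1) * \<epsilon> j)" if "p < N" for p
  proof -
    have "V p (F j) = mmul N P (bidiag \<alpha> \<epsilon>) p j"
      unfolding V_from_\<psi>[OF that] mmul_def by (intro sum.cong refl) (simp add: \<psi>_F assms)
    then show ?thesis using assms by (simp add: mmul_bidiag_right)
  qed
  then have "T (F j) x = (\<Sum>p<N. (P p j * \<alpha> j + (if j = 0 then 0 else P p (j - 1) * \<epsilon> j)) *s U p x)"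
    unfolding T[OF F_L2 assms(2)] by simp
  also have "\<dots> = (\<Sum>p<N. \<alpha> j *s (P p j *s U p x) + (if j = 0 then 0 else \<epsilon> j *s (P p (j - 1) *s U p x)))"
    by (intro sum.cong refl) (auto simp: algebra_simps)
  also have "\<dots> = \<alpha> j *s F j x + (if j = 0 then 0 else \<epsilon> j *s F (j - 1) x)"
    by (auto simp: F_def sum.distrib vector_scalar_sum_right)
  finally show ?thesis .
qed

lemma bidiag_sum:
  "k < N \<Longrightarrow> (\<Sum>j<N. c j * bidiag \<alpha> \<epsilon> k j) =
    \<alpha> k * c k + (if Suc k < N then \<epsilon> (Suc k) * c (Suc k) else 0)"
  using mmul_bidiag[of k N \<alpha> \<epsilon> "\<lambda>j _. c j" 0] by (simp add: mmul_def mult.commute)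

abbreviation "nonzero \<equiv> {j\<in>{..<N}. \<alpha> j \<noteq> 0}"

lemma \<psi>_sum_F:
  assumes "k < N" and "\<And>j. j < N \<Longrightarrow> \<alpha> j = 0 \<Longrightarrow> c j = 0"
  shows "\<psi> k (\<lambda>x. \<Sum>j\<in>nonzero. c j *s F j x) =
    \<alpha> k * c k + (if Suc k < N then \<epsilon> (Suc k) * c (Suc k) else 0)"
proof -
  have "\<psi> k (\<lambda>x. \<Sum>j\<in>nonzero. c j *s F j x) = (\<Sum>j\<in>nonzero. c j * bidiag \<alpha> \<epsilon> k j)"
    by (subst \<psi>_sum) (simp_all add: F_L2 \<psi>_F assms(1))
  also have "\<dots> = (\<Sum>j<N. c j * bidiag \<alpha> \<epsilon> k j)"
    using assms(2) by (intro sum.mono_neutral_left) auto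
  finally show ?thesis using assms(1) by (simp add: bidiag_sum)
qed

lemma F_independent:
  assumes ae: "AE x in \<mu>. (\<Sum>j\<in>nonzero. c j *s F j x) = 0"
  shows "\<forall>j\<in>nonzero. c j = 0"
proof -
  \<comment> \<open>Extending \<open>c\<close> by zero where \<open>\<alpha>\<close> vanishes
    supplies the second premise of \<open>bidiag_kernel\<close>.\<close>
  define c' where "c' j = (if \<alpha> j = 0 then 0 else c j)" for j
  have eq: "(\<Sum>j\<in>nonzero. c' j *s F j x) = (\<Sum>j\<in>nonzero. c j *s F j x)" for x
    by (intro sum.cong) (auto simp: c'_def)
  have "\<alpha> k * c' k + (if Suc k < N then \<epsilon> (Suc k) * c' (Suc k) else 0) = 0" if "k < N" for k
  proof -
    have "\<alpha> k * c' k + (if Suc k < N then \<epsilon> (Suc k) * c' (Suc k) else 0) =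
        \<psi> k (\<lambda>x. \<Sum>j\<in>nonzero. c' j *s F j x)"
      by (rule \<psi>_sum_F[symmetric, OF that]) (simp add: c'_def)
    also have "\<dots> = 0"
    proof (rule \<psi>_zero)
      show "(\<lambda>x. \<Sum>j\<in>nonzero. c' j *s F j x) \<in> L2" by (intro L2_fun_sum F_L2)
      show "AE x in \<mu>. (\<Sum>j\<in>nonzero. c' j *s F j x) = 0" unfolding eq by (rule ae)
    qed
    finally show ?thesis .
  qed
  then have c': "c' k = 0" if "k < N" for k
    by (rule bidiag_kernel[OF _ _ that]) (simp_all add: c'_def)
  show ?thesis
  proof
    fix j assume "j \<in> nonzero"
    then show "c j = 0" using c'[of j] by (simp add: c'_def)
  qed
qed

lemma T_sum:
  assumes "\<And>s. s \<in> S \<Longrightarrow> f s \<in> L2" and "x \<in> space \<mu>"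
  shows "T (\<lambda>x. \<Sum>s\<in>S. c s *s f s x) x = (\<Sum>s\<in>S. c s *s T (f s) x)"
proof -
  have "T (\<lambda>x. \<Sum>s\<in>S. c s *s f s x) x = (\<Sum>p<N. \<Sum>s\<in>S. c s *s (V p (f s) *s U p x))"
    by (subst T) (simp_all add: assms L2_fun_sum V_sum vector_scalar_sum_left)
  also have "\<dots> = (\<Sum>s\<in>S. \<Sum>p<N. c s *s (V p (f s) *s U p x))" by (rule sum.swap)
  also have "\<dots> = (\<Sum>s\<in>S. c s *s T (f s) x)"
    by (intro sum.cong refl) (simp add: T assms vector_scalar_sum_right)
  finally show ?thesis .
qed

text \<open>Applying \<open>\<psi>\<close> yields \<open>J (J c') = 0\<close>, so back substitution
  is used twice. For the first pass \<open>J c'\<close> has to vanish where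
  \<open>\<alpha> k = 0\<close>: there it is \<open>\<epsilon> (Suc k) * c' (Suc k)\<close>, and a
  non-zero \<open>\<epsilon> (Suc k)\<close> forces \<open>\<alpha> (Suc k) = 0\<close> as
  well.\<close>

lemma TF_independent:
  assumes ae: "AE x in \<mu>. (\<Sum>j\<in>nonzero. c j *s T (F j) x) = 0"
  shows "\<forall>j\<in>nonzero. c j = 0"
proof -
  define c' where "c' j = (if \<alpha> j = 0 then 0 else c j)" for j
  define h where "h = (\<lambda>x. \<Sum>j\<in>nonzero. c' j *s F j x)"
  have h: "h \<in> L2" unfolding h_def by (intro L2_fun_sum F_L2)
  have Th_eq: "T h x = (\<Sum>j\<in>nonzero. c j *s T (F j) x)" if "x \<in> space \<mu>" for x
    unfolding h_def T_sum[of nonzero F, OF F_L2 that] by (intro sum.cong) (auto simp: c'_def)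
  have "AE x in \<mu>. T h x = 0" using ae AE_space by eventually_elim (simp add: Th_eq)
  then have Th: "\<psi> k (T h) = 0" for k by (rule \<psi>_zero[OF T_L2[OF h]])
  define d where "d k = \<psi> k h" for k
  have d: "d k = \<alpha> k * c' k + (if Suc k < N then \<epsilon> (Suc k) * c' (Suc k) else 0)" if "k < N" for k
    unfolding d_def h_def by (rule \<psi>_sum_F[OF that]) (simp add: c'_def)
  have d0: "d k = 0" if "k < N" for k
  proof (rule bidiag_kernel[OF _ _ that])
    show "\<alpha> k * d k + (if Suc k < N then \<epsilon> (Suc k) * d (Suc k) else 0) = 0" if "k < N" for k
      unfolding d_def by (rule trans[OF \<psi>_T[OF h that, symmetric] Th])
    show "d k = 0" if "k < N" "\<alpha> k = 0" for k
      using d[OF that(1)] that \<epsilon>[of k] by (auto simp: c'_def)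
  qed
  have c': "c' k = 0" if "k < N" for k
  proof (rule bidiag_kernel[OF _ _ that])
    show "\<alpha> k * c' k + (if Suc k < N then \<epsilon> (Suc k) * c' (Suc k) else 0) = 0" if "k < N" for k
      using d[OF that] d0[OF that] by simp
  qed (simp add: c'_def)
  show ?thesis
  proof
    fix j assume "j \<in> nonzero"
    then show "c j = 0" using c'[of j] by (simp add: c'_def)
  qed
qed

text \<open>Among preimages of more than \<open>N\<close> functions, some non-trivial combination is
  annihilated by all \<open>N\<close> functionals \<open>V p\<close>, hence by
  \<open>T\<close>.\<close>

lemma card_le_range:
  assumes S: "S \<subseteq> T ` L2" and ind: "ae_independent \<mu> S"
  shows "card S \<le> N"
proof (rule ccontr)
  assume "\<not> ?thesis"
  then have "card {..<N} < card S" by simp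
  have fin: "finite S" using ind by (simp add: ae_independent_def)
  have "\<forall>s\<in>S. \<exists>f. f \<in> L2 \<and> s = T f" using S by blast
  from bchoice[OF this] obtain f where f': "\<forall>s\<in>S. f s \<in> L2 \<and> s = T (f s)" ..
  have f: "\<And>s. s \<in> S \<Longrightarrow> f s \<in> L2" "\<And>s. s \<in> S \<Longrightarrow> T (f s) = s"
    using bspec[OF f'] by (blast, metis)
  obtain c where c: "\<exists>s\<in>S. c s \<noteq> 0" "\<forall>p\<in>{..<N}. (\<Sum>s\<in>S. c s * V p (f s)) = 0"
    using nontrivial_homogeneous_solution[OF finite_lessThan fin \<open>card {..<N} < card S\<close>, of "\<lambda>s p. V p (f s)"]
    by blast
  let ?h = "\<lambda>x. \<Sum>s\<in>S. c s *s f s x"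
  have "(\<Sum>s\<in>S. c s *s s x) = 0" if x: "x \<in> space \<mu>" for x
  proof -
    have "(\<Sum>s\<in>S. c s *s s x) = (\<Sum>s\<in>S. c s *s T (f s) x)"
      by (intro sum.cong refl) (simp add: f(2))
    also have "\<dots> = T ?h x" by (rule T_sum[OF f(1) x, symmetric])
    also have "\<dots> = (\<Sum>p<N. V p ?h *s U p x)" by (intro T L2_fun_sum f(1) x)
    also have "\<dots> = 0" using c(2) by (simp add: V_sum f(1))
    finally show ?thesis .
  qed
  then have "AE x in \<mu>. (\<Sum>s\<in>S. c s *s s x) = 0" by (intro AE_I2)
  then show False using ind c(1) unfolding ae_independent_def by blast
qed

lemma card_nonzero_le_rank: "card nonzero \<le> the_enat (ae_dim \<mu> (T ` L2))"
proof -
  have fin: "finite nonzero" by simp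
  note ind = ae_independent_image[where I = nonzero and \<mu> = \<mu> and G = "\<lambda>j. T (F j)", OF fin TF_independent]
  have "enat (card ((\<lambda>j. T (F j)) ` nonzero)) \<le> ae_dim \<mu> (T ` L2)"
    by (rule ae_dim_ge[OF _ ind(2)]) (auto intro: F_L2)
  then have "enat (card nonzero) \<le> ae_dim \<mu> (T ` L2)"
    using card_image[OF ind(1)] by simp
  \<comment> \<open>The dimension must be finite for \<open>the_enat\<close> to return its
    value.\<close>
  moreover have "ae_dim \<mu> (T ` L2) \<le> enat N" by (rule ae_dim_le) (rule card_le_range)
  ultimately show ?thesis by (cases "ae_dim \<mu> (T ` L2)") auto
qed

section \<open>Generalized eigenspaces for non-zero eigenvalues\<close>

lemma D_L2: "g \<in> L2 \<Longrightarrow> D z g \<in> L2"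
  unfolding D_def using L2_fun_add[OF T_L2 L2_fun_scale[of g \<mu> "- z"], of g] by simp

lemma D_pow_L2: "g \<in> L2 \<Longrightarrow> (D z ^^ m) g \<in> L2"
  by (induction m) (auto intro: D_L2)

text \<open>The coefficients \<open>V p f\<close> depend only on the class of \<open>f\<close>, so
  one application of \<open>T\<close> removes the ambiguity on null sets.\<close>

lemma T_cong:
  "f \<in> L2 \<Longrightarrow> g \<in> L2 \<Longrightarrow> AE x in \<mu>. f x = g x \<Longrightarrow> x \<in> space \<mu> \<Longrightarrow> T f x = T g x"
  using V_cong[of f g] by (simp add: T)

lemma D_sum:
  assumes "\<And>s. s \<in> S \<Longrightarrow> f s \<in> L2" and "x \<in> space \<mu>"
  shows "D z (\<lambda>x. \<Sum>s\<in>S. c s *s f s x) x = (\<Sum>s\<in>S. c s *s D z (f s) x)"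
  using T_sum[of S f x c, OF assms]
  by (simp add: D_apply vector_ssub_ldistrib sum_subtractf vector_scalar_sum_right mult.commute)

lemma D_pow_sum:
  assumes "\<And>s. s \<in> S \<Longrightarrow> f s \<in> L2" and "x \<in> space \<mu>"
  shows "(D z ^^ m) (\<lambda>x. \<Sum>s\<in>S. c s *s f s x) x = (\<Sum>s\<in>S. c s *s (D z ^^ m) (f s) x)"
  using assms(2)
proof (induction m arbitrary: x)
  case (Suc m)
  let ?g = "(D z ^^ m) (\<lambda>x. \<Sum>s\<in>S. c s *s f s x)" and ?h = "\<lambda>x. \<Sum>s\<in>S. c s *s (D z ^^ m) (f s) x"
  \<comment> \<open>The induction hypothesis holds on \<open>space \<mu>\<close> and does not equate
    the functions themselves; \<open>T_cong\<close> carries it through the operator.\<close>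
  have "T ?g x = T ?h x"
    by (rule T_cong) (use assms(1) Suc in \<open>auto intro!: D_pow_L2 L2_fun_sum \<close>)
  then have "D z ?g x = D z ?h x"
    using Suc D_apply[of z ?g x] D_apply[of z ?h x] by simp
  also have "\<dots> = (\<Sum>s\<in>S. c s *s D z ((D z ^^ m) (f s)) x)"
    by (rule D_sum) (use assms(1) Suc in \<open>auto intro!: D_pow_L2\<close>)
  finally show ?case by simp
qed simp

lemma D_pow_scale:
  assumes "f \<in> L2" and "x \<in> space \<mu>"
  shows "(D z ^^ m) (\<lambda>x. c *s f x) x = c *s (D z ^^ m) f x"
  using D_pow_sum[where S = "{()}" and f = "\<lambda>_. f" and c = "\<lambda>_. c" and z = z] assms by simp

lemma D_pow_zero:
  assumes "g \<in> L2" and "AE x in \<mu>. g x = 0"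
  shows "AE x in \<mu>. (D z ^^ m) g x = 0"
proof (induction m)
  case (Suc m)
  have T0: "T ((D z ^^ m) g) x = 0" if "x \<in> space \<mu>" for x
    using Suc that assms by (simp add: T D_pow_L2 V_eq_0)
  have "(D z ^^ Suc m) g x = T ((D z ^^ m) g) x - z *s (D z ^^ m) g x" for x
    by (simp add: D_apply[of z "(D z ^^ m) g" x])
  then show ?case using Suc AE_space by (auto elim!: eventually_elim2 simp: T0)
qed (simp add: assms)

abbreviation "genspace z \<equiv> {f \<in> L2. \<exists>n. AE x in \<mu>. (D z ^^ n) f x = 0}"

text \<open>\<open>D (\<alpha> j)\<close> sends \<open>F j\<close> to \<open>\<epsilon> j\<close>
  times \<open>F (j - 1)\<close>. Either this coefficient vanishes, or the two share their
  eigenvalue and the induction continues down the chain.\<close>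

lemma F_genspace:
  assumes "j < N"
  shows "F j \<in> genspace (\<alpha> j)"
proof -
  have "\<forall>x\<in>space \<mu>. (D (\<alpha> j) ^^ Suc j) (F j) x = 0" using assms
  proof (induction j)
    case 0
    then show ?case by (simp add: D_apply T_F)
  next
    case (Suc j)
    let ?z = "\<alpha> (Suc j)"
    have D1: "D ?z (F (Suc j)) x = \<epsilon> (Suc j) *s F j x" if "x \<in> space \<mu>" for x
      using Suc.prems that by (simp add: D_apply T_F)
    have "(D ?z ^^ Suc j) (D ?z (F (Suc j))) x = 0" if x: "x \<in> space \<mu>" for x
    proof -
      have "(D ?z ^^ Suc j) (D ?z (F (Suc j))) x = (D ?z ^^ Suc j) (\<lambda>x. \<epsilon> (Suc j) *s F j x) x"
      proof -
        have cong: "x \<in> space \<mu> \<Longrightarrow> (D ?z ^^ m) f x = (D ?z ^^ m) g x"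
          if "f \<in> L2" "g \<in> L2" "\<And>x. x \<in> space \<mu> \<Longrightarrow> f x = g x" for f g m x
        proof (induction m arbitrary: x)
          case (Suc m)
          have "T ((D ?z ^^ m) f) x = T ((D ?z ^^ m) g) x"
            by (rule T_cong) (use that Suc in \<open>auto intro!: D_pow_L2 \<close>)
          then show ?case
            using Suc D_apply[of ?z "(D ?z ^^ m) f" x] D_apply[of ?z "(D ?z ^^ m) g" x] by simp
        qed (use that in simp)
        show ?thesis by (rule cong) (use D1 x in \<open>auto intro!: D_L2 F_L2 L2_fun_scale\<close>)
      qed
      also have "\<dots> = \<epsilon> (Suc j) *s (D ?z ^^ Suc j) (F j) x" by (rule D_pow_scale[OF F_L2 x])
      also have "\<dots> = 0"
        using Suc.IH Suc.prems \<epsilon>[of j] x by (cases "\<epsilon> (Suc j) = 0") auto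
      finally show ?thesis .
    qed
    then show ?case by (simp only: funpow_Suc_right o_apply) simp
  qed
  then have "AE x in \<mu>. (D (\<alpha> j) ^^ Suc j) (F j) x = 0" by (intro AE_I2) blast
  then show ?thesis using F_L2 by blast
qed

lemma \<psi>_D:
  assumes "g \<in> L2" "k < N"
  shows "\<psi> k (D z g) = (\<alpha> k - z) * \<psi> k g + (if Suc k < N then \<epsilon> (Suc k) * \<psi> (Suc k) g else 0)"
proof -
  have "V p (D z g) = V p (T g) - z * V p g" if "p < N" for p
    using V_lin[OF T_L2[OF assms(1)] assms(1) that, of 1 "- z"] by (simp add: D_def)
  then have "\<psi> k (D z g) = \<psi> k (T g) - z * \<psi> k g"
    by (simp add: \<psi>_def right_diff_distrib sum_subtractf sum_distrib_left mult.left_commute)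
  then show ?thesis using \<psi>_T[OF assms] by (simp add: algebra_simps)
qed

text \<open>On coordinates, \<open>D z\<close> acts as \<open>J - z\<close>. In a row with
  \<open>\<alpha> k \<noteq> z\<close> the diagonal entry is invertible and a coupled index has the
  same eigenvalue, so induction on the exponent and downwards on \<open>k\<close> gives
  zero.\<close>

lemma \<psi>_genspace:
  assumes "f \<in> genspace z" and "k < N" and "\<alpha> k \<noteq> z"
  shows "\<psi> k f = 0"
proof -
  obtain n where n: "f \<in> L2" "AE x in \<mu>. (D z ^^ n) f x = 0" using assms(1) by auto
  then show ?thesis using assms(2,3)
  proof (induction n arbitrary: f k)
    case 0
    then show ?case by (intro \<psi>_zero) auto
  next
    case (Suc n)
    have D0: "\<psi> k (D z f) = 0" if "k < N" "\<alpha> k \<noteq> z" for k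
      using Suc.IH[of "D z f" k] Suc.prems(1,2) that
      by (simp add: D_L2 funpow_Suc_right del: funpow.simps)
    show ?case using Suc.prems(3,4)
    proof (induction "N - k" arbitrary: k rule: less_induct)
      case (less k)
      have "(if Suc k < N then \<epsilon> (Suc k) * \<psi> (Suc k) f else 0) = 0"
      proof (cases "Suc k < N \<and> \<epsilon> (Suc k) \<noteq> 0")
        case True
        then have "\<psi> (Suc k) f = 0" using less.prems \<epsilon>[of k] by (intro less.hyps) auto
        then show ?thesis by simp
      qed auto
      then show ?case using \<psi>_D[OF Suc.prems(1) less.prems(1), of z] D0[OF less.prems] less.prems(2)
        by simp
    qed
  qed
qed

text \<open>Too many independent functions would admit a non-trivial combination \<open>h\<close> on
  which the \<open>\<psi> k\<close> with \<open>\<alpha> k = z\<close> vanish; the others vanish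
  anyway. Then \<open>T h = 0\<close>, so powers of \<open>D z\<close> multiply \<open>h\<close> by
  powers of \<open>- z\<close>; a common power also annihilates it, hence \<open>h\<close> is zero
  almost everywhere.\<close>

lemma card_le_genspace:
  assumes z: "z \<noteq> 0" and S: "S \<subseteq> genspace z" and ind: "ae_independent \<mu> S"
  shows "card S \<le> card {j\<in>{..<N}. \<alpha> j = z}"
proof (rule ccontr)
  let ?J = "{j\<in>{..<N}. \<alpha> j = z}"
  assume "\<not> ?thesis"
  then have lt: "card ?J < card S" by simp
  have fin: "finite S" using ind by (simp add: ae_independent_def)
  obtain c where c: "\<exists>s\<in>S. c s \<noteq> 0" "\<forall>k\<in>?J. (\<Sum>s\<in>S. c s * \<psi> k s) = 0"
    using nontrivial_homogeneous_solution[OF _ fin lt, of "\<lambda>s k. \<psi> k s"] by auto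
  define h where "h = (\<lambda>x. \<Sum>s\<in>S. c s *s s x)"
  have SL: "s \<in> L2" if "s \<in> S" for s using S that by auto
  have h: "h \<in> L2" unfolding h_def using L2_fun_sum[of S "\<lambda>s. s" \<mu> c] SL by simp
  have \<psi>h: "\<psi> k h = 0" if k: "k < N" for k
  proof -
    have "\<psi> k h = (\<Sum>s\<in>S. c s * \<psi> k s)" unfolding h_def by (rule \<psi>_sum) (rule SL)
    also have "\<dots> = 0"
    proof (cases "\<alpha> k = z")
      case False
      then have "\<psi> k s = 0" if "s \<in> S" for s using \<psi>_genspace[OF _ k] S that by blast
      then show ?thesis by simp
    qed (use c(2) k in auto)
    finally show ?thesis .
  qed
  have Th: "T h x = 0" if "x \<in> space \<mu>" for x
    using that by (simp add: T h V_from_\<psi> \<psi>h)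
  have Dh: "(D z ^^ m) h x = (- z) ^ m *s h x" if "x \<in> space \<mu>" for m x
    using that
  proof (induction m arbitrary: x)
    case (Suc m)
    have "T ((D z ^^ m) h) x = T (\<lambda>x. (- z) ^ m *s h x) x"
      by (rule T_cong) (use Suc h in \<open>auto intro!: D_pow_L2 L2_fun_scale \<close>)
    also have "\<dots> = (- z) ^ m *s T h x"
      using T_sum[of "{()}" "\<lambda>_. h" x "\<lambda>_. (- z) ^ m"] h Suc.prems by simp
    finally show ?case
      using Suc Th[OF Suc.prems] D_apply[of z "(D z ^^ m) h" x] by simp
  qed simp
  have "\<exists>m. \<forall>s\<in>S. AE x in \<mu>. (D z ^^ m) s x = 0"
  proof -
    have "\<forall>s\<in>S. \<exists>n. AE x in \<mu>. (D z ^^ n) s x = 0" using S by auto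
    then obtain n where n: "\<And>s. s \<in> S \<Longrightarrow> AE x in \<mu>. (D z ^^ n s) s x = 0" by metis
    have "AE x in \<mu>. (D z ^^ (sum n S)) s x = 0" if s: "s \<in> S" for s
    proof -
      have "sum n S = (sum n S - n s) + n s" using member_le_sum[of s S n] s fin by simp
      then have "(D z ^^ (sum n S)) s = (D z ^^ (sum n S - n s)) ((D z ^^ n s) s)"
        by (metis comp_apply funpow_add)
      then show ?thesis using D_pow_zero[OF D_pow_L2[OF SL[OF s]] n[OF s]] by simp
    qed
    then show ?thesis by blast
  qed
  then obtain m where m: "\<And>s. s \<in> S \<Longrightarrow> AE x in \<mu>. (D z ^^ m) s x = 0" by auto
  have "AE x in \<mu>. \<forall>s\<in>S. (D z ^^ m) s x = 0"
    using m fin by (simp add: AE_finite_all)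
  then have "AE x in \<mu>. (\<Sum>s\<in>S. c s *s s x) = 0"
    using AE_space
  proof eventually_elim
    case (elim x)
    have "(- z) ^ m *s h x = (D z ^^ m) h x" using Dh elim by simp
    also have "\<dots> = (\<Sum>s\<in>S. c s *s (D z ^^ m) s x)"
      unfolding h_def by (rule D_pow_sum) (use SL elim in auto)
    also have "\<dots> = 0" using elim by simp
    finally show ?case using z by (simp add: h_def)
  qed
  then show False using ind c(1) by (auto simp: ae_independent_def)
qed

lemma ae_dim_genspace:
  assumes z: "z \<noteq> 0"
  shows "ae_dim \<mu> (genspace z) = enat (card {j\<in>{..<N}. \<alpha> j = z})"
proof (rule antisym)
  let ?J = "{j\<in>{..<N}. \<alpha> j = z}"
  show "ae_dim \<mu> (genspace z) \<le> enat (card ?J)"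
    by (rule ae_dim_le) (rule card_le_genspace[OF z])
  have ind: "\<forall>j\<in>?J. c j = 0" if "AE x in \<mu>. (\<Sum>j\<in>?J. c j *s F j x) = 0" for c
  proof -
    define c' where "c' j = (if \<alpha> j = z then c j else 0)" for j
    have "(\<Sum>j\<in>nonzero. c' j *s F j x) = (\<Sum>j\<in>?J. c j *s F j x)" for x
      using z by (intro sum.mono_neutral_cong_right) (auto simp: c'_def)
    then have "\<forall>j\<in>nonzero. c' j = 0" using that by (intro F_independent) simp
    then show ?thesis using z by (auto simp: c'_def)
  qed
  note ind' = ae_independent_image[where I = ?J and \<mu> = \<mu> and G = F, OF _ ind]
  have "enat (card (F ` ?J)) \<le> ae_dim \<mu> (genspace z)"
    by (rule ae_dim_ge) (use F_genspace ind'(2) in auto)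
  then show "enat (card ?J) \<le> ae_dim \<mu> (genspace z)"
    using card_image[OF ind'(1)] by simp
qed

end


section \<open>The operator of a quaternion kernel\<close>

text \<open>The entries of \<open>qmat\<close> with indices 0 and 1, so that a quaternion matrix of
  size \<open>n\<close> becomes a complex one of size \<open>2 n\<close> by division with
  remainder.\<close>

definition qent :: "cquat \<Rightarrow> nat \<Rightarrow> nat \<Rightarrow> complex" where
  "qent q c d =
    (if c = 0 then if d = 0 then qs q + \<i> * qz q else \<i> * qx q - qy q
     else if d = 0 then \<i> * qx q + qy q else qs q - \<i> * qz q)"

lemma qent_mult: "qent (p * q) c d = qent p c 0 * qent q 0 d + qent p c 1 * qent q 1 d"
  by (simp add: qent_def times_cquat_def algebra_simps)

lemma qent_add: "qent (p + q) c d = qent p c d + qent q c d"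
  by (simp add: qent_def algebra_simps)

lemma qent_0 [simp]: "qent 0 c d = 0"
  by (simp add: qent_def)

lemma qent_sum: "qent (sum f A) c d = (\<Sum>x\<in>A. qent (f x) c d)"
  by (induction A rule: infinite_finite_induct) (simp_all add: qent_add)

lemma qmat_nth:
  "vec_nth (vec_nth (qmat q) 1) 1 = qent q 0 0" "vec_nth (vec_nth (qmat q) 1) 2 = qent q 0 1"
  "vec_nth (vec_nth (qmat q) 2) 1 = qent q 1 0" "vec_nth (vec_nth (qmat q) 2) 2 = qent q 1 1"
  by (simp_all add: qmat_def qent_def)

lemma sum_double: "(\<Sum>k<2 * n. f k) = (\<Sum>l<n. f (2 * l) + f (Suc (2 * l)))"
  by (induction n) (simp_all add: add.assoc)

definition cmat :: "(nat \<Rightarrow> nat \<Rightarrow> cquat) \<Rightarrow> nat \<Rightarrow> nat \<Rightarrow> complex" where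
  "cmat A i j = qent (A (i div 2) (j div 2)) (i mod 2) (j mod 2)"

lemma mpow_cmat: "mpow (2 * n) (cmat A) s i j = cmat (mpow n A s) i j"
proof (induction s arbitrary: i j)
  case 0
  have q: "qent 1 c d = (if c = d then 1 else 0)" if "c < 2" "d < 2" for c d
  proof -
    have "c = 0 \<or> c = 1" "d = 0 \<or> d = 1" using that by auto
    then show ?thesis by (elim disjE) (simp_all add: qent_def)
  qed
  show ?case
  proof (cases "i div 2 = j div 2")
    case True
    have ij: "i mod 2 = j mod 2 \<longleftrightarrow> i = j"
    proof
      assume "i mod 2 = j mod 2"
      then have "i div 2 * 2 + i mod 2 = j div 2 * 2 + j mod 2" unfolding True by (rule arg_cong)
      then show "i = j" unfolding div_mult_mod_eq .
    qed (rule arg_cong)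
    have "cmat (mpow n A 0) i j = qent 1 (i mod 2) (j mod 2)"
      unfolding cmat_def mpow.simps mdelta_def if_P[OF True] ..
    also have "\<dots> = mdelta i j" unfolding mdelta_def ij[symmetric] by (rule q) simp_all
    finally show ?thesis by simp
  next
    case False
    then have "i \<noteq> j" by auto
    then have "mdelta i j = (0::complex)" by (simp add: mdelta_def)
    moreover have "cmat (mpow n A 0) i j = 0"
      unfolding cmat_def mpow.simps mdelta_def if_not_P[OF False] by (rule qent_0)
    ultimately show ?thesis by simp
  qed
next
  case (Suc s)
  have "mpow (2 * n) (cmat A) (Suc s) i j =
    (\<Sum>l<n. cmat A i (2 * l) * cmat (mpow n A s) (2 * l) j +
      cmat A i (Suc (2 * l)) * cmat (mpow n A s) (Suc (2 * l)) j)"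
    by (simp add: mmul_def Suc sum_double)
  also have "\<dots> = cmat (mpow n A (Suc s)) i j"
    by (simp add: cmat_def mmul_def qent_sum qent_mult)
  finally show ?case .
qed

text \<open>The trace of \<open>\<phi>(q)\<close> is twice the scalar part of \<open>q\<close>: the
  origin of the factor 2 between power sums of eigenvalues and cycle weights.\<close>

lemma trace_cmat: "(\<Sum>i<2 * n. cmat B i i) = 2 * qs (\<Sum>k<n. B k k)"
  by (simp add: sum_double cmat_def qs_sum qent_def sum_distrib_left)

definition sq_integrable :: "'b measure \<Rightarrow> ('b \<Rightarrow> complex) \<Rightarrow> bool" where
  "sq_integrable M f \<longleftrightarrow> f \<in> borel_measurable M \<and> integrable M (\<lambda>x. (cmod (f x))\<^sup>2)"

lemma sq_integrable_cmult: "sq_integrable M f \<Longrightarrow> sq_integrable M (\<lambda>x. c * f x)"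
  unfolding sq_integrable_def by (simp add: norm_mult power_mult_distrib borel_measurable_times)

lemma sq_integrable_add:
  "sq_integrable M f \<Longrightarrow> sq_integrable M g \<Longrightarrow> sq_integrable M (\<lambda>x. f x + g x)"
  by (simp add: sq_integrable_def square_integrable_norm_add borel_measurable_add)

lemma sq_integrable_diff:
  "sq_integrable M f \<Longrightarrow> sq_integrable M g \<Longrightarrow> sq_integrable M (\<lambda>x. f x - g x)"
  using sq_integrable_add[OF _ sq_integrable_cmult[of M g "-1"], of f] by simp

lemma sq_integrable_qent: "square_integrable_quat \<mu> q \<Longrightarrow> sq_integrable \<mu> (\<lambda>x. qent (q x) c d)"
proof -
  assume q: "square_integrable_quat \<mu> q"
  then have "sq_integrable \<mu> (\<lambda>x. qs (q x))" "sq_integrable \<mu> (\<lambda>x. qx (q x))"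
    "sq_integrable \<mu> (\<lambda>x. qy (q x))" "sq_integrable \<mu> (\<lambda>x. qz (q x))"
    by (auto simp: square_integrable_quat_def sq_integrable_def)
  then show ?thesis
    unfolding qent_def
    by (cases "c = 0"; cases "d = 0")
      (simp_all add: sq_integrable_add sq_integrable_diff sq_integrable_cmult)
qed

lemma sq_integrable_mult:
  "sq_integrable M f \<Longrightarrow> sq_integrable M g \<Longrightarrow> integrable M (\<lambda>x. f x * g x)"
  unfolding sq_integrable_def by (intro integrable_mult_square_integrable) auto

lemma sq_integrable_nth: "f \<in> L2_fun \<mu> \<Longrightarrow> sq_integrable \<mu> (\<lambda>x. vec_nth (f x) i)"
  using square_integrable_bounded_linear[OF bounded_linear_vec_nth, of f \<mu> i]
  by (simp add: sq_integrable_def L2_fun_def)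

lemma bounded_linear_vector_scalar_left: "bounded_linear (\<lambda>c::complex. c *s (w :: complex^2))"
  unfolding linear_conv_bounded_linear[symmetric]
proof (rule linearI)
  show "(r *\<^sub>R b) *s w = r *\<^sub>R (b *s w)" for r b
    unfolding Finite_Cartesian_Product.vec_eq_iff by simp
qed (simp add: vector_sadd_rdistrib)

lemma L2_fun_direction: "sq_integrable \<mu> f \<Longrightarrow> (\<lambda>x. f x *s w) \<in> L2_fun \<mu>"
  using square_integrable_bounded_linear[OF bounded_linear_vector_scalar_left, of f \<mu> w]
  by (simp add: sq_integrable_def L2_fun_def)

lemma vec2_eq_iff: "(a :: complex^2) = b \<longleftrightarrow> vec_nth a 1 = vec_nth b 1 \<and> vec_nth a 2 = vec_nth b 2"
  unfolding Finite_Cartesian_Product.vec_eq_iff forall_2 ..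

lemma qent_qint: "qintegrable M F \<Longrightarrow> qent (qint M F) c d = (LINT x|M. qent (F x) c d)"
  unfolding qintegrable_def all_less_4
  by (simp add: qent_def sel_qint)

context quat_expansion
begin

text \<open>Column \<open>p mod 2\<close> of the matrix of \<open>u (p div 2)\<close>. Together with
  the rows \<open>Vrow\<close>, these columns split \<open>\<phi>(K)\<close> into \<open>2 n\<close>
  terms of rank at most one.\<close>

definition Ucol :: "nat \<Rightarrow> 'a \<Rightarrow> complex^2" where
  "Ucol p x = vector [qent (u (p div 2) x) 0 (p mod 2), qent (u (p div 2) x) 1 (p mod 2)]"

definition Vrow :: "nat \<Rightarrow> 'a \<Rightarrow> complex^2 \<Rightarrow> complex" where
  "Vrow p y w = qent (v (p div 2) y) (p mod 2) 0 * vec_nth w 1 + qent (v (p div 2) y) (p mod 2) 1 * vec_nth w 2"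

definition Vfun :: "nat \<Rightarrow> ('a \<Rightarrow> complex^2) \<Rightarrow> complex" where
  "Vfun p f = (LINT y|\<mu>. Vrow p y (f y))"

lemma Ucol_L2:
  assumes "p < 2 * n"
  shows "Ucol p \<in> L2_fun \<mu>"
proof -
  have "square_integrable_quat \<mu> (u (p div 2))" using assms by (intro u) simp
  note q = sq_integrable_qent[OF this]
  have "Ucol p = (\<lambda>x. qent (u (p div 2) x) 0 (p mod 2) *s vector [1, 0] + qent (u (p div 2) x) 1 (p mod 2) *s vector [0, 1])"
    by (simp add: fun_eq_iff Ucol_def vec2_eq_iff)
  then show ?thesis using L2_fun_add[OF L2_fun_direction[OF q] L2_fun_direction[OF q]] by simp
qed

lemma Vrow_integrable:
  assumes "p < 2 * n" "f \<in> L2_fun \<mu>"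
  shows "integrable \<mu> (\<lambda>y. Vrow p y (f y))"
proof -
  have "square_integrable_quat \<mu> (v (p div 2))" using assms by (intro v) simp
  note q = sq_integrable_qent[OF this]
  show ?thesis
    unfolding Vrow_def
    by (intro Bochner_Integration.integrable_add sq_integrable_mult q sq_integrable_nth assms)
qed

lemma Vfun_Ucol:
  assumes "p < 2 * n" "q < 2 * n"
  shows "Vfun p (Ucol q) = cmat gram p q"
proof -
  have "qintegrable \<mu> (\<lambda>x. v (p div 2) x * u (q div 2) x)"
    using assms by (intro vu_integrable) auto
  from qent_qint[OF this, of "p mod 2" "q mod 2"] show ?thesis
    by (simp add: Vfun_def Vrow_def Ucol_def cmat_def gram_def qent_mult)
qed

lemma qmat_ker: "qmat (ker x y) *v w = (\<Sum>p<2 * n. Vrow p y w *s Ucol p x)"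
proof -
  have row: "qent (ker x y) c 0 * vec_nth w 1 + qent (ker x y) c 1 * vec_nth w 2 =
      (\<Sum>p<2 * n. Vrow p y w * qent (u (p div 2) x) c (p mod 2))" for c
  proof -
    have V: "Vrow (2 * l) y w = qent (v l y) 0 0 * vec_nth w 1 + qent (v l y) 0 1 * vec_nth w 2"
      "Vrow (Suc (2 * l)) y w = qent (v l y) 1 0 * vec_nth w 1 + qent (v l y) 1 1 * vec_nth w 2" for l
      by (simp_all add: Vrow_def)
    have "qent (ker x y) c 0 * vec_nth w 1 + qent (ker x y) c 1 * vec_nth w 2 =
      (\<Sum>l<n. qent (u l x * v l y) c 0 * vec_nth w 1 + qent (u l x * v l y) c 1 * vec_nth w 2)"
      unfolding ker_def qent_sum sum_distrib_right sum.distrib ..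
    also have "\<dots> = (\<Sum>l<n. Vrow (2 * l) y w * qent (u l x) c 0 + Vrow (Suc (2 * l)) y w * qent (u l x) c 1)"
      unfolding V by (intro sum.cong refl) (simp add: qent_mult algebra_simps)
    finally show ?thesis by (simp add: sum_double)
  qed
  have U: "vec_nth (Ucol p x) 1 = qent (u (p div 2) x) 0 (p mod 2)"
    "vec_nth (Ucol p x) 2 = qent (u (p div 2) x) 1 (p mod 2)" for p
    by (simp_all add: Ucol_def)
  show ?thesis
    unfolding vec2_eq_iff using row[of 0] row[of 1]
    by (simp add: matrix_vector_mult_def sum_2 qmat_nth U)
qed

lemma kernel_operator_eq:
  assumes K: "\<And>x y. x \<in> space \<mu> \<Longrightarrow> y \<in> space \<mu> \<Longrightarrow> K x y = ker x y"
    and f: "f \<in> L2_fun \<mu>" and x: "x \<in> space \<mu>"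
  shows "kernel_operator \<mu> K f x = (\<Sum>p<2 * n. Vfun p f *s Ucol p x)"
proof -
  have "kernel_operator \<mu> K f x = (LINT y|\<mu>. (\<Sum>p<2 * n. Vrow p y (f y) *s Ucol p x))"
    unfolding kernel_operator_def
    by (rule Bochner_Integration.integral_cong[OF refl]) (simp add: K x qmat_ker)
  also have "\<dots> = (\<Sum>p<2 * n. LINT y|\<mu>. Vrow p y (f y) *s Ucol p x)"
    by (rule Bochner_Integration.integral_sum)
      (rule integrable_bounded_linear[OF bounded_linear_vector_scalar_left], use Vrow_integrable f in auto)
  also have "\<dots> = (\<Sum>p<2 * n. Vfun p f *s Ucol p x)"
    unfolding Vfun_def
    by (intro sum.cong refl integral_bounded_linear[OF bounded_linear_vector_scalar_left] Vrow_integrable f) auto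
  finally show ?thesis .
qed

text \<open>The functionals \<open>Vfun p\<close> take on the columns \<open>Ucol q\<close> the
  entries of \<open>\<phi>\<close> of the Gram matrix, so a single Jordan form supplies both the
  power sums in the determinant and the spectrum of the integral operator.\<close>

theorem spectral_data:
  assumes K: "\<And>x y. x \<in> space \<mu> \<Longrightarrow> y \<in> space \<mu> \<Longrightarrow> K x y = ker x y"
  obtains \<alpha> :: "nat \<Rightarrow> complex" where
    "\<And>s. 2 * half_trace s = (\<Sum>j<2 * n. \<alpha> j ^ s)"
    "\<And>z. z \<noteq> 0 \<Longrightarrow> algebraic_multiplicity \<mu> K z = enat (card {j\<in>{..<2 * n}. \<alpha> j = z})"
    "card {j\<in>{..<2 * n}. \<alpha> j \<noteq> 0} div 2 \<le> kernel_rank \<mu> K"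
proof (rule jordan_data[of "2 * n" "cmat gram"])
  fix \<alpha> \<epsilon> P Q
  assume jd:
    "\<And>i j. i < 2 * n \<Longrightarrow> j < 2 * n \<Longrightarrow> mmul (2 * n) P Q i j = mdelta i j"
    "\<And>i j. i < 2 * n \<Longrightarrow> j < 2 * n \<Longrightarrow> mmul (2 * n) Q P i j = mdelta i j"
    "\<And>i j. i < 2 * n \<Longrightarrow> j < 2 * n \<Longrightarrow> cmat gram i j = mmul (2 * n) P (mmul (2 * n) (bidiag \<alpha> \<epsilon>) Q) i j"
    "\<And>j. Suc j < 2 * n \<Longrightarrow> \<epsilon> (Suc j) \<noteq> 0 \<Longrightarrow> \<alpha> j = \<alpha> (Suc j)"
  interpret finite_rank_operator \<mu> "2 * n" Ucol Vfun "kernel_operator \<mu> K" P Q \<alpha> \<epsilon>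
  proof
    show "Vfun p (\<lambda>x. a *s f x + b *s g x) = a * Vfun p f + b * Vfun p g"
      if "f \<in> L2_fun \<mu>" "g \<in> L2_fun \<mu>" "p < 2 * n" for p f g a b
    proof -
      have "Vrow p y (a *s f y + b *s g y) = a * Vrow p y (f y) + b * Vrow p y (g y)" for y
        by (simp add: Vrow_def algebra_simps)
      then show ?thesis using Vrow_integrable that by (simp add: Vfun_def)
    qed
    show "Vfun p f = Vfun p g"
      if "f \<in> L2_fun \<mu>" "g \<in> L2_fun \<mu>" "p < 2 * n" "AE x in \<mu>. f x = g x" for p f g
      unfolding Vfun_def
      using Vrow_integrable that by (intro integral_cong_AE) auto
  qed (use jd Ucol_L2 Vfun_Ucol kernel_operator_eq[OF K] in auto)
  show thesis
  proof (rule that[of \<alpha>])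
    show "2 * half_trace s = (\<Sum>j<2 * n. \<alpha> j ^ s)" for s
    proof -
      have "2 * half_trace s = (\<Sum>i<2 * n. mpow (2 * n) (cmat gram) s i i)"
        by (simp add: half_trace_def trace_cmat mpow_cmat)
      also have "\<dots> = (\<Sum>j<2 * n. \<alpha> j ^ s)" by (rule trace_mpow) (use jd in auto)
      finally show ?thesis .
    qed
    show "algebraic_multiplicity \<mu> K z = enat (card {j\<in>{..<2 * n}. \<alpha> j = z})" if "z \<noteq> 0" for z
      using ae_dim_genspace[OF that]
      by (simp add: algebraic_multiplicity_def generalized_eigenspace_def D_def[abs_def])
    show "card {j\<in>{..<2 * n}. \<alpha> j \<noteq> 0} div 2 \<le> kernel_rank \<mu> K"
      unfolding kernel_rank_def by (intro div_le_mono card_nonzero_le_rank)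
  qed
qed

end


section \<open>Factorial moments of the number of points\<close>

lemma prod_falling: "(\<Prod>j<m. c - j) = fact m * (c choose m)" for c m :: nat
proof (induction m)
  case (Suc m)
  have "(c - m) * (c choose m) = Suc m * (c choose Suc m)"
    using binomial_absorption[of m c] binomial_absorb_comp[of c m] by simp
  then show ?case using Suc by (simp add: algebra_simps)
qed simp

lemma ennreal_ffact_of_nat: "ennreal_ffact m (of_nat c) = ennreal (fact m * real (c choose m))"
proof -
  have "ennreal_ffact m (of_nat c) = (\<Prod>j<m. of_nat (c - j))"
    unfolding ennreal_ffact_def
  proof (rule prod.cong[OF refl])
    fix j
    show "(of_nat c :: ennreal) - of_nat j = of_nat (c - j)"
    proof (cases "j \<le> c")
      case True
      have "(of_nat c :: ennreal) - of_nat j = ennreal (real c) - ennreal (real j)"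
        by (simp add: ennreal_of_nat_eq_real_of_nat)
      also have "\<dots> = ennreal (real c - real j)" by (rule ennreal_minus) simp
      finally show ?thesis using True by (simp add: ennreal_of_nat_eq_real_of_nat of_nat_diff)
    next
      case False
      then show ?thesis by (simp add: diff_eq_0_iff_ennreal of_nat_less_top)
    qed
  qed
  also have "\<dots> = of_nat (fact m * (c choose m))" by (simp only: prod_falling of_nat_prod[symmetric])
  finally show ?thesis by (simp add: ennreal_of_nat_eq_real_of_nat)
qed

lemma ennreal_ffact_eq_0D:
  assumes "ennreal_ffact m c = 0" and "c = \<infinity> \<or> (\<exists>k. c = of_nat k)"
  shows "\<exists>k<m. c = of_nat k"
  using assms(2)
proof
  assume "c = \<infinity>"
  then have "ennreal_ffact m c \<noteq> 0" by (simp add: ennreal_ffact_def prod_zero_iff)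
  then show ?thesis using assms(1) by simp
next
  assume "\<exists>k. c = of_nat k"
  then obtain k where k: "c = of_nat k" by auto
  then have "k < m" using assms(1) by (simp add: ennreal_ffact_of_nat)
  then show ?thesis using k by auto
qed

text \<open>The vanishing moment of order \<open>d + 1\<close> bounds the count by \<open>d\<close>
  almost surely. The generating function is then a finite binomial sum, integrated term by
  term.\<close>

lemma falling_moments:
  fixes c :: "'b \<Rightarrow> nat" and N :: "'b \<Rightarrow> ennreal" and e :: "nat \<Rightarrow> real"
  assumes "prob_space P" and N[measurable]: "N \<in> borel_measurable P"
    and c[measurable]: "c \<in> measurable P (count_space UNIV)"
    and Nc: "\<And>\<xi>. \<xi> \<in> space P \<Longrightarrow> N \<xi> = \<infinity> \<or> N \<xi> = of_nat (c \<xi>)"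
    and mom: "\<And>m. (\<integral>\<^sup>+\<xi>. ennreal_ffact m (N \<xi>) \<partial>P) = ennreal (fact m * e m)"
    and e: "\<And>m. e m \<ge> 0" "\<And>m. m > d \<Longrightarrow> e m = 0"
  shows "AE \<xi> in P. N \<xi> = of_nat (c \<xi>)"
    and "(LINT \<xi>|P. (1 + w) ^ c \<xi>) = (\<Sum>m\<le>d. complex_of_real (e m) * w ^ m)"
proof -
  interpret prob_space P by fact
  have ff[measurable]: "(\<lambda>\<xi>. ennreal_ffact m (N \<xi>)) \<in> borel_measurable P" for m
    unfolding ennreal_ffact_def by measurable
  have "(\<integral>\<^sup>+\<xi>. ennreal_ffact (Suc d) (N \<xi>) \<partial>P) = 0" using mom[of "Suc d"] e(2)[of "Suc d"] by simp
  then have "AE \<xi> in P. ennreal_ffact (Suc d) (N \<xi>) = 0" by (subst (asm) nn_integral_0_iff_AE) auto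
  then have bound: "AE \<xi> in P. N \<xi> = of_nat (c \<xi>) \<and> c \<xi> \<le> d"
    using AE_space
  proof eventually_elim
    case (elim \<xi>)
    obtain k where k: "k < Suc d" "N \<xi> = of_nat k"
      using ennreal_ffact_eq_0D[OF elim(1)] Nc[OF elim(2)] by blast
    then have "N \<xi> \<noteq> \<infinity>" by simp
    then have Nx: "N \<xi> = of_nat (c \<xi>)" using Nc[OF elim(2)] by blast
    then have "c \<xi> = k" using k(2) by simp
    then show ?case using Nx k(1) by simp
  qed
  then show "AE \<xi> in P. N \<xi> = of_nat (c \<xi>)" by eventually_elim simp
  have hb: "has_bochner_integral P (\<lambda>\<xi>. fact m * real (c \<xi> choose m)) (fact m * e m)" for m
  proof (rule has_bochner_integral_nn_integral)
    have "(\<integral>\<^sup>+\<xi>. ennreal (fact m * real (c \<xi> choose m)) \<partial>P) = (\<integral>\<^sup>+\<xi>. ennreal_ffact m (N \<xi>) \<partial>P)"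
      using bound by (intro nn_integral_cong_AE) (auto elim!: eventually_mono simp: ennreal_ffact_of_nat)
    then show "(\<integral>\<^sup>+\<xi>. ennreal (fact m * real (c \<xi> choose m)) \<partial>P) = ennreal (fact m * e m)"
      using mom by simp
  qed (use e in auto)
  have "has_bochner_integral P (\<lambda>\<xi>. inverse (fact m) * (fact m * real (c \<xi> choose m))) (inverse (fact m) * (fact m * e m))" for m
    by (intro has_bochner_integral_mult_right hb)
  then have "has_bochner_integral P (\<lambda>\<xi>. real (c \<xi> choose m)) (e m)" for m
    by (simp add: field_simps)
  from has_bochner_integral_of_real[OF this]
  have hc: "has_bochner_integral P (\<lambda>\<xi>. complex_of_real (real (c \<xi> choose m))) (complex_of_real (e m))" for m .
  have "has_bochner_integral P (\<lambda>\<xi>. \<Sum>m\<le>d. complex_of_real (real (c \<xi> choose m)) * w ^ m)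
      (\<Sum>m\<le>d. complex_of_real (e m) * w ^ m)"
    by (intro has_bochner_integral_sum has_bochner_integral_mult_left hc)
  then have "(\<Sum>m\<le>d. complex_of_real (e m) * w ^ m) =
      (LINT \<xi>|P. (\<Sum>m\<le>d. complex_of_real (real (c \<xi> choose m)) * w ^ m))"
    by (rule has_bochner_integral_integral_eq[symmetric])
  also have "\<dots> = (LINT \<xi>|P. (1 + w) ^ c \<xi>)"
  proof (rule integral_cong_AE)
    show "AE \<xi> in P. (\<Sum>m\<le>d. complex_of_real (real (c \<xi> choose m)) * w ^ m) = (1 + w) ^ c \<xi>"
      using bound
    proof eventually_elim
      case (elim \<xi>)
      have "(1 + w) ^ c \<xi> = (\<Sum>m\<le>c \<xi>. complex_of_real (real (c \<xi> choose m)) * w ^ m)"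
        using binomial_ring[of w 1 "c \<xi>"] by (simp add: add.commute)
      also have "\<dots> = (\<Sum>m\<le>d. complex_of_real (real (c \<xi> choose m)) * w ^ m)"
        using elim by (intro sum.mono_neutral_left) auto
      finally show ?case by simp
    qed
  qed measurable
  finally show "(LINT \<xi>|P. (1 + w) ^ c \<xi>) = (\<Sum>m\<le>d. complex_of_real (e m) * w ^ m)" ..
qed

lemma npoints_configuration:
  assumes "\<xi> \<in> configurations \<Lambda>"
  shows "npoints \<Lambda> \<xi> = (if finite \<xi> then of_nat (card \<xi>) else \<infinity>)"
proof -
  have "\<xi> \<inter> \<Lambda> = \<xi>" using assms by (auto simp: configurations_def)
  then show ?thesis by (simp add: npoints_def emeasure_count_space)
qed

text \<open>The generating events fix a finite number of points. \<open>card\<close> is 0 on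
  infinite configurations as well as on the empty one, so its zero level is obtained as a
  complement.\<close>

lemma npoints_count_measurable:
  assumes "random_point_field \<Lambda> P"
  shows "space P = configurations \<Lambda>"
    and "npoints \<Lambda> \<in> borel_measurable P"
    and "card \<in> measurable P (count_space UNIV)"
proof -
  have sets: "sets P = sets (configuration_space \<Lambda>)" using assms by (simp add: random_point_field_def)
  have sub: "{{\<xi> \<in> configurations \<Lambda>. npoints A \<xi> = of_nat n} | A n. A \<in> sets (restrict_space borel \<Lambda>)}
      \<subseteq> Pow (configurations \<Lambda>)" by auto
  show sp: "space P = configurations \<Lambda>"
    unfolding sets_eq_imp_space_eq[OF sets] configuration_space_def by (rule space_measure_of[OF sub])
  have "\<Lambda> \<in> sets (restrict_space borel \<Lambda>)"
    using sets.top[of "restrict_space borel \<Lambda>"] by (simp add: space_restrict_space)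
  then have lev: "{\<xi> \<in> space P. npoints \<Lambda> \<xi> = of_nat n} \<in> sets P" for n
    unfolding sets sp configuration_space_def sets_measure_of[OF sub] by (intro sigma_sets.Basic) blast
  have pos: "{\<xi> \<in> space P. card \<xi> = Suc k} = {\<xi> \<in> space P. npoints \<Lambda> \<xi> = of_nat (Suc k)}" for k
  proof -
    have "card \<xi> = Suc k \<longleftrightarrow> npoints \<Lambda> \<xi> = of_nat (Suc k)" if "\<xi> \<in> space P" for \<xi>
    proof (cases "finite \<xi>")
      case True
      then show ?thesis using npoints_configuration[of \<xi> \<Lambda>] that sp by (simp only: if_True of_nat_eq_iff)
    next
      case False
      then show ?thesis using npoints_configuration[of \<xi> \<Lambda>] that sp by (auto simp del: of_nat_Suc)
    qed
    then show ?thesis by blast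
  qed
  have S: "{\<xi> \<in> space P. card \<xi> = Suc k} \<in> sets P" for k unfolding pos by (rule lev)
  have "{\<xi> \<in> space P. card \<xi> = 0} = space P - (\<Union>k. {\<xi> \<in> space P. card \<xi> = Suc k})"
    using not0_implies_Suc by auto
  then have Z: "{\<xi> \<in> space P. card \<xi> = 0} \<in> sets P" using S by auto
  have "{\<xi> \<in> space P. card \<xi> = k} \<in> sets P" for k using S Z by (cases k) auto
  then have pre: "card -` {k} \<inter> space P \<in> sets P" for k
    by (simp add: vimage_def Int_def conj_commute)
  show card: "card \<in> measurable P (count_space UNIV)"
    using pre by (simp add: measurable_count_space_eq2_countable)
  \<comment> \<open>Zero cardinality of a non-empty configuration marks infinity, which recovers
    \<open>npoints\<close> from measurable pieces.\<close>
  have "(\<lambda>\<xi>. if npoints \<Lambda> \<xi> = 0 then 0 else if card \<xi> = 0 then \<infinity> else (of_nat (card \<xi>) :: ennreal)) \<in> borel_measurable P"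
  proof (intro measurable_If)
    show "{\<xi> \<in> space P. npoints \<Lambda> \<xi> = 0} \<in> sets P" using lev[of 0] by simp
    show "{\<xi> \<in> space P. card \<xi> = 0} \<in> sets P" by (rule Z)
    show "(\<lambda>\<xi>. of_nat (card \<xi>)) \<in> borel_measurable P"
      by (rule measurable_compose[OF card]) simp
  qed auto
  also have "?this \<longleftrightarrow> npoints \<Lambda> \<in> borel_measurable P"
    by (rule measurable_cong) (auto simp: sp npoints_configuration)
  finally show "npoints \<Lambda> \<in> borel_measurable P" .
qed

text \<open>The defining identity is used with the single block \<open>\<Lambda>\<close> taken
  \<open>k\<close> times, whose product set is the whole space.\<close>

lemma correlation_total:
  assumes R: "correlation_function \<Lambda> \<mu> P k R" and \<mu>: "space \<mu> = \<Lambda>"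
  shows "(\<integral>\<^sup>+\<xi>. ennreal_ffact k (npoints \<Lambda> \<xi>) \<partial>P) = (\<integral>\<^sup>+x. ennreal (R x) \<partial>Pi\<^sub>M {..<k} (\<lambda>_. \<mu>))"
proof -
  have "\<forall>m A \<kappa>. (\<forall>i<m. A i \<in> sets \<mu>) \<and> disjoint_family_on A {..<m} \<and> (\<Sum>i<m. \<kappa> i) = k \<longrightarrow>
        (\<integral>\<^sup>+\<xi>. (\<Prod>i<m. ennreal_ffact (\<kappa> i) (npoints (A i) \<xi>)) \<partial>P) =
        (\<integral>\<^sup>+x. ennreal (R x) * indicator (block_product m A \<kappa>) x \<partial>Pi\<^sub>M {..<k} (\<lambda>_. \<mu>))"
    using R unfolding correlation_function_def by blast
  from this[rule_format, of 1 "\<lambda>_. \<Lambda>" "\<lambda>_. k"]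
  have "(\<integral>\<^sup>+\<xi>. ennreal_ffact k (npoints \<Lambda> \<xi>) \<partial>P) =
      (\<integral>\<^sup>+x. ennreal (R x) * indicator (block_product 1 (\<lambda>_. \<Lambda>) (\<lambda>_. k)) x \<partial>Pi\<^sub>M {..<k} (\<lambda>_. \<mu>))"
    using sets.top[of \<mu>] \<mu> by (simp add: disjoint_family_on_def)
  also have "\<dots> = (\<integral>\<^sup>+x. ennreal (R x) \<partial>Pi\<^sub>M {..<k} (\<lambda>_. \<mu>))"
    by (intro nn_integral_cong) (auto simp: block_product_def space_PiM PiE_iff \<mu> indicator_def)
  finally show ?thesis .
qed


section \<open>The characteristic function\<close>

text \<open>Homogeneity: \<open>w\<close> enters once for every point, in whatever cycle the point
  lies.\<close>

lemma cycle_coeff_scale: "cycle_coeff (\<lambda>s. w ^ s * f s) m = w ^ m * cycle_coeff f m"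
proof (induction m rule: less_induct)
  case (less m)
  show ?case
  proof (cases m)
    case (Suc k)
    have "(\<Sum>j\<le>k. w ^ Suc j * f (Suc j) * cycle_coeff (\<lambda>s. w ^ s * f s) (k - j)) =
      (\<Sum>j\<le>k. w ^ Suc k * (f (Suc j) * cycle_coeff f (k - j)))"
    proof (rule sum.cong[OF refl])
      fix j assume j: "j \<in> {..k}"
      then have cc: "cycle_coeff (\<lambda>s. w ^ s * f s) (k - j) = w ^ (k - j) * cycle_coeff f (k - j)"
        by (intro less) (simp add: Suc)
      have pw: "w ^ Suc k = w ^ Suc j * w ^ (k - j)"
        using j by (simp add: power_add[symmetric])
      show "w ^ Suc j * f (Suc j) * cycle_coeff (\<lambda>s. w ^ s * f s) (k - j) =
          w ^ Suc k * (f (Suc j) * cycle_coeff f (k - j))"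
        unfolding cc pw by (simp only: mult_ac)
    qed
    then show ?thesis unfolding Suc by (simp add: sum_distrib_left[symmetric] del: power_Suc of_nat_Suc)
  qed simp
qed

context quat_expansion
begin

text \<open>The scalar is absorbed into \<open>u\<close>. Self-duality survives complex scalars
  because \<open>qconj\<close> does not conjugate coefficients.\<close>

lemma scaled_expansion: "quat_expansion \<mu> n (\<lambda>k x. cquat_of_complex w * u k x) v"
proof
  fix k assume k: "k < n"
  have "(\<lambda>x. c (u k x)) \<in> borel_measurable \<mu>" "integrable \<mu> (\<lambda>x. (cmod (c (u k x)))\<^sup>2)"
    if "c \<in> {qs, qx, qy, qz}" for c
    using u[OF k] that unfolding square_integrable_quat_def by blast+
  then show "square_integrable_quat \<mu> (\<lambda>x. cquat_of_complex w * u k x)"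
    by (simp add: square_integrable_quat_def norm_mult power_mult_distrib borel_measurable_times)
next
  fix x y assume "x \<in> space \<mu>" "y \<in> space \<mu>"
  then have "cquat_of_complex w * (\<Sum>k<n. u k y * v k x) = qconj (cquat_of_complex w * (\<Sum>k<n. u k x * v k y))"
    unfolding qconj_simps(4) by (intro arg_cong[where f = "(*) (cquat_of_complex w)"] self_dual)
  then show "(\<Sum>k<n. cquat_of_complex w * u k y * v k x) = qconj (\<Sum>k<n. cquat_of_complex w * u k x * v k y)"
    by (simp only: sum_distrib_left mult.assoc)
qed (use v in auto)

lemma scaled_half_trace:
  "quat_expansion.half_trace \<mu> n (\<lambda>k x. cquat_of_complex w * u k x) v s = w ^ s * half_trace s"
proof -
  interpret scaled: quat_expansion \<mu> n "\<lambda>k x. cquat_of_complex w * u k x" v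
    by (rule scaled_expansion)
  have comm: "p * (cquat_of_complex c * q) = cquat_of_complex c * (p * q)" for p q c
    by (simp add: cquat_eq_iff times_cquat_def cquat_of_complex_def algebra_simps)
  have g: "scaled.gram k l = cquat_of_complex w * gram k l" for k l
  proof (rule cquat_eqI)
    fix i :: nat assume "i < 4"
    then show "qcomp i (scaled.gram k l) = qcomp i (cquat_of_complex w * gram k l)"
      unfolding scaled.gram_def gram_def comm by (simp add: qcomp_qint qcomp_scale)
  qed
  have "mpow n scaled.gram s k l = cquat_of_complex (w ^ s) * mpow n gram s k l" for k l
  proof (induction s arbitrary: k l)
    case (Suc s)
    have st: "cquat_of_complex w * gram k j * (cquat_of_complex (w ^ s) * mpow n gram s j l) =
        cquat_of_complex (w ^ Suc s) * (gram k j * mpow n gram s j l)" for j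
      unfolding comm by (simp add: cquat_of_complex_mult mult.assoc cquat_of_complex_commute[of "cquat_of_complex w"])
    show ?case
      unfolding mpow.simps mmul_def sum_distrib_left by (intro sum.cong refl) (simp only: Suc g st)
  qed simp
  then show ?thesis
    unfolding scaled.half_trace_def half_trace_def by (simp add: qs_sum sum_distrib_left)
qed

text \<open>With \<open>w\<close> kept general, one computation covers both \<open>K\<close> itself,
  whose terms give the moments, and the kernel in the Fredholm determinant.\<close>

lemma fredholm_term_scaled:
  fixes w :: complex
  assumes K: "\<And>x y. x \<in> space \<mu> \<Longrightarrow> y \<in> space \<mu> \<Longrightarrow> K x y = ker x y"
  defines "Kw \<equiv> \<lambda>x y. cquat_of_complex w * K x y"
  shows "integrable (Pi\<^sub>M {..<m} (\<lambda>_. \<mu>)) (fredholm_integrand Kw m)"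
    and "fredholm_term \<mu> Kw m = w ^ m * cycle_coeff (\<lambda>s. (-1) ^ (s - 1) * half_trace s) m"
proof -
  interpret scaled: quat_expansion \<mu> n "\<lambda>k x. cquat_of_complex w * u k x" v
    by (rule scaled_expansion)
  have ker: "Kw x y = scaled.ker x y" if "x \<in> space \<mu>" "y \<in> space \<mu>" for x y
    using that by (simp add: Kw_def K ker_def scaled.ker_def sum_distrib_left mult.assoc)
  \<comment> \<open>The kernels agree on \<open>space \<mu>\<close> only; the determinant evaluates
    them at points of index below \<open>m\<close>, because the permutations preserve that
    range.\<close>
  have eq: "fredholm_integrand Kw m x = fredholm_integrand scaled.ker m x"
    if x: "x \<in> space (Pi\<^sub>M {..<m} (\<lambda>_. \<mu>))" for x
  proof -
    have X: "x i \<in> space \<mu>" if "i < m" for i using x that by (auto simp: space_PiM PiE_iff)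
    have "cycle_product (\<lambda>i j. Kw (x i) (x j)) p q = cycle_product (\<lambda>i j. scaled.ker (x i) (x j)) p q"
      if p: "p permutes {..<m}" and q: "q \<in> cycle_maxima m p" for p q
    proof -
      have sub: "set (support p q) \<subseteq> {..<m}"
        using cycle_maxima_cycles(4)[OF p] q by blast
      have "Kw (x i) (x (p i)) = scaled.ker (x i) (x (p i))" if "i \<in> set (support p q)" for i
      proof -
        have "i < m" using that sub by blast
        moreover have "p i < m" using permutes_in_image[OF p, of i] calculation by simp
        ultimately show ?thesis by (intro ker X)
      qed
      then show ?thesis
        unfolding cycle_product_def by (intro arg_cong[where f=prod_list] map_cong refl) blast
    qed
    then have "DetM m (\<lambda>i j. Kw (x i) (x j)) = DetM m (\<lambda>i j. scaled.ker (x i) (x j))"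
      unfolding DetM_def
      by (intro sum.cong refl arg_cong2[where f="(*)"] arg_cong[where f=prod_list] map_cong)
        (auto simp: cycle_maxima_def)
    then show ?thesis by (simp add: fredholm_integrand_def)
  qed
  show "integrable (Pi\<^sub>M {..<m} (\<lambda>_. \<mu>)) (fredholm_integrand Kw m)"
    using scaled.integral_fredholm_integrand(1)[of m]
    by (subst Bochner_Integration.integrable_cong[OF refl eq]) auto
  have "(LINT x|Pi\<^sub>M {..<m} (\<lambda>_. \<mu>). fredholm_integrand Kw m x) =
      (LINT x|Pi\<^sub>M {..<m} (\<lambda>_. \<mu>). fredholm_integrand scaled.ker m x)"
    by (rule Bochner_Integration.integral_cong[OF refl eq])
  also have "\<dots> = fact m * cycle_coeff (\<lambda>s. (-1) ^ (s - 1) * scaled.half_trace s) m"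
    by (rule scaled.integral_fredholm_integrand(2))
  also have "(\<lambda>s. (-1) ^ (s - 1) * scaled.half_trace s) = (\<lambda>s. w ^ s * ((-1) ^ (s - 1) * half_trace s))"
    unfolding scaled_half_trace by (simp add: fun_eq_iff mult_ac)
  also have "cycle_coeff \<dots> m = w ^ m * cycle_coeff (\<lambda>s. (-1) ^ (s - 1) * half_trace s) m"
    by (rule cycle_coeff_scale)
  finally show "fredholm_term \<mu> Kw m = w ^ m * cycle_coeff (\<lambda>s. (-1) ^ (s - 1) * half_trace s) m"
    by (simp add: fredholm_term_def)
qed

end

lemma fredholm_series_finite:
  assumes "\<And>m. m \<ge> 1 \<Longrightarrow> integrable (Pi\<^sub>M {..<m} (\<lambda>_. \<mu>)) (fredholm_integrand K m)"
    and term_eq: "\<And>m. fredholm_term \<mu> K m = of_real (e m) * w ^ m"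
    and e: "e 0 = 1" "\<And>m. m > d \<Longrightarrow> e m = 0"
  shows "fredholm_DetM_exists \<mu> K"
    and "fredholm_DetM \<mu> K = (\<Sum>m\<le>d. of_real (e m) * w ^ m)"
proof -
  have zero: "fredholm_term \<mu> K (Suc m) = 0" if "m \<notin> {..<d}" for m
    using that e(2)[of "Suc m"] by (simp add: term_eq)
  have "summable (\<lambda>m. fredholm_term \<mu> K (Suc m))"
    by (rule summable_finite[of "{..<d}"]) (use zero in auto)
  then show "fredholm_DetM_exists \<mu> K" using assms(1) by (simp add: fredholm_DetM_exists_def)
  have "(\<Sum>m. fredholm_term \<mu> K (Suc m)) = (\<Sum>m<d. fredholm_term \<mu> K (Suc m))"
    by (rule suminf_finite) (use zero in auto)
  then show "fredholm_DetM \<mu> K = (\<Sum>m\<le>d. of_real (e m) * w ^ m)"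
    unfolding fredholm_DetM_def sum.atMost_shift by (simp add: term_eq e)
qed

text \<open>The source of positivity: the determinant is a nonnegative correlation function, so its
  total integral is a factorial moment. Integrability identifies the Bochner integral with the
  nonnegative one.\<close>

lemma pfaffian_moments:
  assumes \<mu>: "space \<mu> = \<Lambda>"
    and pf: "pfaffian_point_field \<Lambda> \<mu> P K"
    and int: "integrable (Pi\<^sub>M {..<m} (\<lambda>_. \<mu>)) (fredholm_integrand K m)"
    and m: "m \<ge> 1"
  obtains c where "c \<ge> 0" "fredholm_term \<mu> K m = of_real c"
    "(\<integral>\<^sup>+\<xi>. ennreal_ffact m (npoints \<Lambda> \<xi>) \<partial>P) = ennreal (fact m * c)"
proof -
  let ?M = "Pi\<^sub>M {..<m} (\<lambda>_. \<mu>)"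
  obtain R where R: "correlation_function \<Lambda> \<mu> P m R"
    "\<And>x. x \<in> Pi\<^sub>E {..<m} (\<lambda>_. \<Lambda>) \<Longrightarrow> cquat_of_complex (of_real (R x)) = DetM m (\<lambda>i j. K (x i) (x j))"
    using pf m unfolding pfaffian_point_field_def by blast
  have sp: "space ?M = Pi\<^sub>E {..<m} (\<lambda>_. \<Lambda>)" by (simp add: space_PiM \<mu>)
  have F: "fredholm_integrand K m x = of_real (R x)" if "x \<in> space ?M" for x
    using arg_cong[OF R(2)[of x], of qs] that unfolding sp by (simp add: fredholm_integrand_def)
  have R0: "0 \<le> R x" if "x \<in> space ?M" for x
    using R(1) that unfolding sp correlation_function_def by blast
  have "integrable ?M (\<lambda>x. complex_of_real (R x))"
    using int by (subst (asm) Bochner_Integration.integrable_cong[OF refl F]) auto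
  from integrable_Re[OF this] have iR: "integrable ?M R" by simp
  have nn: "0 \<le> (LINT x|?M. R x)" using R0 by (intro Bochner_Integration.integral_nonneg)
  show thesis
  proof (rule that[of "(LINT x|?M. R x) / fact m"])
    show "(LINT x|?M. R x) / fact m \<ge> 0" using nn by simp
    have "(LINT x|?M. fredholm_integrand K m x) = (LINT x|?M. complex_of_real (R x))"
      by (rule Bochner_Integration.integral_cong[OF refl F])
    then show "fredholm_term \<mu> K m = of_real ((LINT x|?M. R x) / fact m)"
      by (simp add: fredholm_term_def)
    have "(\<integral>\<^sup>+\<xi>. ennreal_ffact m (npoints \<Lambda> \<xi>) \<partial>P) = (\<integral>\<^sup>+x. ennreal (R x) \<partial>?M)"
      by (rule correlation_total[OF R(1) \<mu>])
    also have "\<dots> = ennreal (LINT x|?M. R x)"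
      using R0 by (intro nn_integral_eq_integral iR AE_I2)
    finally show "(\<integral>\<^sup>+\<xi>. ennreal_ffact m (npoints \<Lambda> \<xi>) \<partial>P) = ennreal (fact m * ((LINT x|?M. R x) / fact m))"
      by simp
  qed
qed

theorem theorem1p8:
  fixes \<Lambda> :: "'a::topological_space set"
    and \<mu> :: "'a measure"
    and P :: "'a set measure"
    and K :: "'a \<Rightarrow> 'a \<Rightarrow> cquat"
    and t :: real
  assumes "space \<mu> = \<Lambda>" and "sets \<mu> = sets (restrict_space borel \<Lambda>)"
    and "sigma_finite_measure \<mu>"
    and "pfaffian_point_field \<Lambda> \<mu> P K"
    and "finite_rank_kernel \<mu> K"
  shows "(AE \<xi> in P. finite \<xi>) \<and>
    fredholm_DetM_exists \<mu> (\<lambda>x y. cquat_of_complex (iexp t - 1) * K x y) \<and>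
    (\<exists>eig. eigenvalue_listing \<mu> K eig) \<and>
    (\<forall>eig. eigenvalue_listing \<mu> K eig \<longrightarrow>
       char (distr P borel (\<lambda>\<xi>. real (card \<xi>))) t
         = (\<Prod>k = 1..kernel_rank \<mu> K. 1 + (iexp t - 1) * eig k) \<and>
       (\<Prod>k = 1..kernel_rank \<mu> K. 1 + (iexp t - 1) * eig k)
         = fredholm_DetM \<mu> (\<lambda>x y. cquat_of_complex (iexp t - 1) * K x y))"
proof -
  obtain n u v where uv: "\<And>k. k < n \<Longrightarrow> square_integrable_quat \<mu> (u k)"
    "\<And>k. k < n \<Longrightarrow> square_integrable_quat \<mu> (v k)"
    "\<And>x y. x \<in> space \<mu> \<Longrightarrow> y \<in> space \<mu> \<Longrightarrow> K x y = (\<Sum>k<(n::nat). u k x * v k y)"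
    using assms(5) unfolding finite_rank_kernel_def by blast
  have rpf: "random_point_field \<Lambda> P" and sd: "self_dual_kernel \<Lambda> K"
    using assms(4) by (simp_all add: pfaffian_point_field_def)
  interpret sigma_finite_measure \<mu> by fact
  interpret quat_expansion \<mu> n u v
  proof
    fix x y assume "x \<in> space \<mu>" "y \<in> space \<mu>"
    then show "(\<Sum>k<n. u k y * v k x) = qconj (\<Sum>k<n. u k x * v k y)"
      using sd uv(3)[of x y] uv(3)[of y x] assms(1) unfolding self_dual_kernel_def by metis
  qed (use uv in auto)
  have K: "K x y = ker x y" if "x \<in> space \<mu>" "y \<in> space \<mu>" for x y
    using uv(3)[OF that] by (simp add: ker_def)
  define w where "w = iexp t - 1"
  let ?Kw = "\<lambda>x y. cquat_of_complex w * K x y"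
  define f where "f = (\<lambda>s. (-1) ^ (s - 1) * half_trace s)"
  have K1: "(\<lambda>x y. cquat_of_complex 1 * K x y) = K" by simp
  have term_K: "integrable (Pi\<^sub>M {..<m} (\<lambda>_. \<mu>)) (fredholm_integrand K m)"
    "fredholm_term \<mu> K m = cycle_coeff f m" for m
    using fredholm_term_scaled[OF K, where w = 1 and m = m] unfolding K1 f_def by simp_all
  \<comment> \<open>Order 0 lies outside the correlation functions; there the coefficient and the
    moment are both 1, as \<open>P\<close> is a probability measure.\<close>
  have "\<exists>c\<ge>0. cycle_coeff f m = of_real c \<and>
      (\<integral>\<^sup>+\<xi>. ennreal_ffact m (npoints \<Lambda> \<xi>) \<partial>P) = ennreal (fact m * c)" for m
  proof (cases "m = 0")
    case True
    have "prob_space P" using rpf by (simp add: random_point_field_def)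
    then show ?thesis
      using True by (intro exI[of _ 1]) (simp add: ennreal_ffact_def prob_space.emeasure_space_1)
  next
    case False
    then have "m \<ge> 1" by simp
    from pfaffian_moments[OF assms(1,4) term_K(1) this] term_K(2)[of m] show ?thesis by metis
  qed
  then obtain e where e: "\<And>m. e m \<ge> 0" "\<And>m. cycle_coeff f m = of_real (e m)"
    "\<And>m. (\<integral>\<^sup>+\<xi>. ennreal_ffact m (npoints \<Lambda> \<xi>) \<partial>P) = ennreal (fact m * e m)" by metis
  have e0: "e 0 = 1" using e(2)[of 0] by simp
  obtain \<alpha> where \<alpha>: "\<And>s. 2 * half_trace s = (\<Sum>j<2 * n. \<alpha> j ^ s)"
    "\<And>z. z \<noteq> 0 \<Longrightarrow> algebraic_multiplicity \<mu> K z = enat (card {j\<in>{..<2 * n}. \<alpha> j = z})"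
    "card {j\<in>{..<2 * n}. \<alpha> j \<noteq> 0} div 2 \<le> kernel_rank \<mu> K"
    using spectral_data[OF K] by blast
  note core = eigenvalue_product_eq_cycle_series[OF \<alpha>(1) e(2)[unfolded f_def] e(1)]
  have Kw: "integrable (Pi\<^sub>M {..<m} (\<lambda>_. \<mu>)) (fredholm_integrand ?Kw m)"
    "fredholm_term \<mu> ?Kw m = of_real (e m) * w ^ m" for m
    using fredholm_term_scaled[OF K, where w = w and m = m] e(2)[of m] unfolding f_def by simp_all
  have series: "fredholm_DetM_exists \<mu> ?Kw" "fredholm_DetM \<mu> ?Kw = (\<Sum>m\<le>2 * n. of_real (e m) * w ^ m)"
    by (rule fredholm_series_finite[of \<mu> ?Kw e w "2 * n"], rule Kw, rule Kw, rule e0, erule core(1))+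
  note meas = npoints_count_measurable[OF rpf]
  have prob: "prob_space P" using rpf by (simp add: random_point_field_def)
  have Nc: "npoints \<Lambda> \<xi> = \<infinity> \<or> npoints \<Lambda> \<xi> = of_nat (card \<xi>)" if "\<xi> \<in> space P" for \<xi>
    using npoints_configuration[of \<xi> \<Lambda>] that meas(1) by auto
  have moments: "AE \<xi> in P. npoints \<Lambda> \<xi> = of_nat (card \<xi>)"
    "(LINT \<xi>|P. (1 + w) ^ card \<xi>) = (\<Sum>m\<le>2 * n. of_real (e m) * w ^ m)"
    by (rule falling_moments[where d = "2 * n", OF prob meas(2,3) _ e(3,1)], erule Nc, erule core(1))+
  have fin: "AE \<xi> in P. finite \<xi>"
    using moments(1) AE_space
  proof eventually_elim
    case (elim \<xi>)
    then show ?case using npoints_configuration[of \<xi> \<Lambda>] meas(1) by (cases "finite \<xi>") auto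
  qed
  have char: "char (distr P borel (\<lambda>\<xi>. real (card \<xi>))) t = (\<Sum>m\<le>2 * n. of_real (e m) * w ^ m)"
  proof -
    have [measurable]: "(\<lambda>\<xi>. real (card \<xi>)) \<in> borel_measurable P"
      by (rule measurable_compose[OF meas(3)]) simp
    have "char (distr P borel (\<lambda>\<xi>. real (card \<xi>))) t = (LINT \<xi>|P. iexp (t * real (card \<xi>)))"
      unfolding char_def by (subst integral_distr) auto
    \<comment> \<open>By the choice of \<open>w\<close>, \<open>1 + w\<close> is
      \<open>iexp t\<close>, so the characteristic function is the generating function at
      \<open>1 + w\<close>.\<close>
    also have "\<dots> = (LINT \<xi>|P. (1 + w) ^ card \<xi>)"
      by (intro Bochner_Integration.integral_cong refl)
        (simp add: w_def exp_of_nat_mult[symmetric] mult_ac)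
    also have "\<dots> = (\<Sum>m\<le>2 * n. of_real (e m) * w ^ m)" by (rule moments(2))
    finally show ?thesis .
  qed
  have listing: "eigenvalue_listing \<mu> K eig \<longleftrightarrow>
    (\<forall>z. z \<noteq> 0 \<longrightarrow> card {j\<in>{..<2 * n}. \<alpha> j = z} = 2 * card {k \<in> {1..kernel_rank \<mu> K}. eig k = z})" for eig
    unfolding eigenvalue_listing_def using \<alpha>(2) by simp
  have "\<exists>eig. eigenvalue_listing \<mu> K eig"
    unfolding listing using exists_halved_listing[of "{..<2 * n}" \<alpha> "kernel_rank \<mu> K"] core(2) \<alpha>(3) by blast
  moreover have "(\<Prod>k = 1..kernel_rank \<mu> K. 1 + w * eig k) = (\<Sum>m\<le>2 * n. of_real (e m) * w ^ m)"
    if "eigenvalue_listing \<mu> K eig" for eig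
    using that unfolding listing by (intro core(3)) blast
  ultimately show ?thesis
    unfolding w_def[symmetric] using fin series char by simp
qed

end
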